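(* Let $K$ be a field of characteristic zero. Let $2\leq d_1<d_2<d_3$ be integers such that $d_1+d_2\leq d_3+1$. Let $f_1,f_2,f_3\in S=K[x_1,x_2,x_3]$ be a regular sequence of homogeneous polynomials of degrees $d_1,d_2,d_3$, let $I=(f_1,f_2,f_3)$ and let $J=\operatorname{Gin}(I)$ be the generic initial ideal with respect to the reverse lexicographic order. If $S/I$ has the strong Lefschetz property, then $J$ is the ideal generated by - $x_1^{d_1}$; $x_1^{d_1-j}x_2^{d_2-d_1+2j-1}$ for $1\leq j\leq d_1-1$; $x_2^{d_1+d_2-1}$; $x_2^{d_1+d_2-2}x_3^{d_3-d_1-d_2+2}$; - $x_3^{d_3-d_1-d_2+2j+2}x_2^{d_1+d_2-2j-2}\{x_1,x_2\}^j$ for $1\leq j\leq d_1-2$; - $x_3^{d_3+d_1-d_2-2+2j}x_2^{d_2-d_1+1-j}\{x_1,x_2\}^{d_1-1}$ for $1\leq j\leq d_2-d_1$; - $x_3^{d_3+d_2-d_1+2j-2}\{x_1,x_2\}^{d_1-j}$ for $1\leq j\leq d_1$.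
   Context: $\{x_1,x_2\}^j$ denotes the set of all monomials of degree $j$ in $x_1,x_2$ (with $\{x_1,x_2\}^0=\{1\}$), and $m\{x_1,x_2\}^j$ is the set of products of the monomial $m$ with elements of it. $S/I$ has the strong Lefschetz property (SLP) if there is a linear form $\ell\in S$ such that for all integers $b\geq 1$ and $t\geq 0$ the multiplication map $\ell^b:(S/I)_t\to(S/I)_{t+b}$ is injective or surjective. $\operatorname{Gin}(I)$ is the common initial ideal, with respect to the graded reverse lexicographic order with $x_1>x_2>x_3$, of $\alpha I$ for all $\alpha$ in a nonempty Zariski open subset of $GL_3(K)$ acting by linear changes of coordinates. *)

theory Defs
  imports "HOL-Analysis.Analysis" "HOL-Library.Poly_Mapping"
begin

text \<open>
  Polynomials in the variables indexed by \<open>'i\<close> with coefficients in \<open>'k\<close> are finitely supported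
  functions from exponent vectors to coefficients; the ring structure (convolution) is the one of
  \<open>HOL-Library.Poly_Mapping\<close>. The ring \<open>S = K[x\<^sub>1, x\<^sub>2, x\<^sub>3]\<close> uses the index type \<open>3\<close>, whose
  elements are \<open>1\<close>, \<open>2\<close> and \<open>3\<close> (where \<open>3 = 0\<close>). The predefined linear order on the type \<open>3\<close>
  is not used anywhere.
\<close>

type_synonym ('i, 'k) mpol = "('i \<Rightarrow>\<^sub>0 nat) \<Rightarrow>\<^sub>0 'k"
type_synonym 'k pol3 = "(3, 'k) mpol"

definition Const :: "'k::zero \<Rightarrow> ('i, 'k) mpol" where
  "Const c = Poly_Mapping.single 0 c"

definition monom_of :: "('i \<Rightarrow>\<^sub>0 nat) \<Rightarrow> ('i, 'k::zero_neq_one) mpol" where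
  "monom_of m = Poly_Mapping.single m 1"

definition Var :: "'i \<Rightarrow> ('i, 'k::zero_neq_one) mpol" where
  "Var i = monom_of (Poly_Mapping.single i 1)"

definition eval_poly ::
    "('k::zero \<Rightarrow> 'r::comm_semiring_1) \<Rightarrow> ('i \<Rightarrow> 'r) \<Rightarrow> ('i, 'k) mpol \<Rightarrow> 'r" where
  "eval_poly \<phi> x p =
     (\<Sum>m\<in>Poly_Mapping.keys p. \<phi> (Poly_Mapping.lookup p m) *
        (\<Prod>i\<in>Poly_Mapping.keys m. x i ^ Poly_Mapping.lookup m i))"

definition deg_exp :: "('i::finite \<Rightarrow>\<^sub>0 nat) \<Rightarrow> nat" where
  "deg_exp m = (\<Sum>i\<in>UNIV. Poly_Mapping.lookup m i)"

text \<open>The homogeneous component of degree \<open>d\<close> of the polynomial ring; it contains \<open>0\<close>.\<close>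

definition forms :: "nat \<Rightarrow> ('i::finite, 'k::zero) mpol set" where
  "forms d = {f. \<forall>m\<in>Poly_Mapping.keys f. deg_exp m = d}"


lemma module_times: "module ((*) :: 'a::comm_ring_1 \<Rightarrow> 'a \<Rightarrow> 'a)"
  by standard (simp_all add: algebra_simps)

definition ideal_gen :: "'a::comm_ring_1 set \<Rightarrow> 'a set" where
  "ideal_gen B = module.span (*) B"

definition regular_sequence :: "'a::comm_ring_1 list \<Rightarrow> bool" where
  "regular_sequence fs \<longleftrightarrow>
     (\<forall>i<length fs. \<forall>g. g * fs ! i \<in> ideal_gen (set (take i fs)) \<longrightarrow>
        g \<in> ideal_gen (set (take i fs))) \<and>
     ideal_gen (set fs) \<noteq> UNIV"


text \<open>
  Elements of a quotient ring \<open>R/I\<close> are represented by their cosets \<open>f + I\<close>;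
  \<open>quot_mult I h\<close> sends \<open>a + I\<close> to \<open>h * a + I\<close> (the summand \<open>I\<close> is needed because \<open>h * (a + I)\<close>
  need not be a full coset).
\<close>

definition coset :: "'a::comm_ring_1 set \<Rightarrow> 'a \<Rightarrow> 'a set" where
  "coset I f = {f + u | u. u \<in> I}"

definition quot_mult :: "'a::comm_ring_1 set \<Rightarrow> 'a \<Rightarrow> 'a set \<Rightarrow> 'a set" where
  "quot_mult I h A = {h * a + u | a u. a \<in> A \<and> u \<in> I}"

definition quot_part :: "('i::finite, 'k::comm_ring_1) mpol set \<Rightarrow> nat \<Rightarrow> ('i, 'k) mpol set set" where
  "quot_part I t = coset I ` forms t"

lemma quot_mult_coset:
  assumes "I = ideal_gen B"
  shows "quot_mult I h (coset I a) = coset I (h * a)"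
proof -
  interpret module "(*) :: 'a::comm_ring_1 \<Rightarrow> 'a \<Rightarrow> 'a" by (rule module_times)
  have add: "u + v \<in> I" if "u \<in> I" "v \<in> I" for u v
    using that by (simp add: assms ideal_gen_def span_add)
  have mult: "c * u \<in> I" if "u \<in> I" for c u
    using that by (simp add: assms ideal_gen_def span_scale)
  have zero: "0 \<in> I"
    by (simp add: assms ideal_gen_def span_zero)
  show ?thesis
  proof (intro equalityI subsetI)
    fix x assume "x \<in> quot_mult I h (coset I a)"
    then obtain u v where "u \<in> I" "v \<in> I" "x = h * (a + u) + v"
      by (auto simp: quot_mult_def coset_def)
    then have "x = h * a + (h * u + v)" "h * u + v \<in> I"
      by (auto simp: algebra_simps intro: add mult)
    then show "x \<in> coset I (h * a)"
      by (auto simp: coset_def)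
  next
    fix x assume "x \<in> coset I (h * a)"
    then obtain v where "v \<in> I" "x = h * (a + 0) + v"
      by (auto simp: coset_def)
    then show "x \<in> quot_mult I h (coset I a)"
      using zero unfolding quot_mult_def coset_def by blast
  qed
qed

definition strong_Lefschetz :: "('i::finite, 'k::comm_ring_1) mpol set \<Rightarrow> bool" where
  "strong_Lefschetz I \<longleftrightarrow>
     (\<exists>l\<in>forms 1. \<forall>b\<ge>1. \<forall>t.
        inj_on (quot_mult I (l ^ b)) (quot_part I t) \<or>
        quot_mult I (l ^ b) ` quot_part I t = quot_part I (t + b))"


text \<open>
  Graded reverse lexicographic order with \<open>x\<^sub>1 > x\<^sub>2 > x\<^sub>3\<close>: among exponents of the same degree, the
  one with the larger last differing entry is the smaller one. When the degrees and the last two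
  entries agree, so do the first entries.
\<close>

definition grevlex_less :: "(3 \<Rightarrow>\<^sub>0 nat) \<Rightarrow> (3 \<Rightarrow>\<^sub>0 nat) \<Rightarrow> bool" where
  "grevlex_less m n \<longleftrightarrow>
     deg_exp m < deg_exp n \<or>
     deg_exp m = deg_exp n \<and>
       (Poly_Mapping.lookup m 3 > Poly_Mapping.lookup n 3 \<or>
        Poly_Mapping.lookup m 3 = Poly_Mapping.lookup n 3 \<and>
        Poly_Mapping.lookup m 2 > Poly_Mapping.lookup n 2)"

definition is_initial_exp :: "'k::zero pol3 \<Rightarrow> (3 \<Rightarrow>\<^sub>0 nat) \<Rightarrow> bool" where
  "is_initial_exp f m \<longleftrightarrow>
     m \<in> Poly_Mapping.keys f \<and> (\<forall>n\<in>Poly_Mapping.keys f. n \<noteq> m \<longrightarrow> grevlex_less n m)"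

definition initial_ideal :: "'k::comm_ring_1 pol3 set \<Rightarrow> 'k pol3 set" where
  "initial_ideal I = ideal_gen {monom_of m | f m. f \<in> I \<and> is_initial_exp f m}"

text \<open>
  The action of a matrix by \<open>x\<^sub>j \<mapsto> \<Sum>\<^sub>i A\<^sub>i\<^sub>j x\<^sub>i\<close>. Using \<open>A\<^sup>T\<close> or \<open>A\<^sup>-\<^sup>1\<close> instead would not affect
  generic initial ideals, since transposition and inversion are homeomorphisms of \<open>GL\<^sub>3(K)\<close>.
\<close>

definition lin_subst :: "'k::comm_ring_1 ^ 3 ^ 3 \<Rightarrow> 'k pol3 \<Rightarrow> 'k pol3" where
  "lin_subst A = eval_poly Const (\<lambda>j. \<Sum>i\<in>UNIV. Const (A $ i $ j) * Var i)"

text \<open>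
  Zariski open subsets of \<open>GL\<^sub>3(K)\<close>. Regular functions on \<open>GL\<^sub>3\<close> are polynomials in the entries
  divided by powers of the determinant, so the closed subsets are the zero sets of polynomials in
  the entries.
\<close>

definition zariski_open_GL3 :: "('k::field ^ 3 ^ 3) set \<Rightarrow> bool" where
  "zariski_open_GL3 U \<longleftrightarrow>
     (\<exists>P :: (3 \<times> 3, 'k) mpol set.
        U = {A. invertible A \<and> (\<exists>p\<in>P. eval_poly id (\<lambda>(i, j). A $ i $ j) p \<noteq> 0)})"

definition is_Gin :: "'k::field pol3 set \<Rightarrow> 'k pol3 set \<Rightarrow> bool" where
  "is_Gin I J \<longleftrightarrow>
     (\<exists>U. zariski_open_GL3 U \<and> U \<noteq> {} \<and> (\<forall>A\<in>U. initial_ideal (lin_subst A ` I) = J))"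

text \<open>
  Over an infinite field \<open>is_Gin I\<close> holds for exactly one ideal when \<open>I\<close> is a homogeneous ideal
  (Galligo's theorem), so that the description below is meaningful.
\<close>

definition Gin :: "'k::field pol3 set \<Rightarrow> 'k pol3 set" where
  "Gin I = (THE J. is_Gin I J)"


text \<open>The set \<open>{x\<^sub>1, x\<^sub>2}\<^sup>j\<close> of monomials of degree \<open>j\<close> in \<open>x\<^sub>1\<close> and \<open>x\<^sub>2\<close>.\<close>

definition monos12 :: "nat \<Rightarrow> 'k::comm_ring_1 pol3 set" where
  "monos12 j = {Var 1 ^ a * Var 2 ^ b | a b. a + b = j}"

end

theory Submission
  imports Defs "HOL-Computational_Algebra.Polynomial"
begin

text \<open>
  Put \<open>s = d\<^sub>1 + d\<^sub>2 + d\<^sub>3 - 3\<close>, the socle degree of \<open>S/I\<close>. The listed monomials generate the ideal of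
  all \<open>x\<^sub>1^a x\<^sub>2^b x\<^sub>3^c\<close> with \<open>a \<ge> d\<^sub>1\<close> or \<open>2a + b \<ge> d\<^sub>1 + d\<^sub>2 - 1\<close> or \<open>2a + 2b + c > s\<close>
  (\<open>ideal_gen_gin_gens\<close>). The other monomials, with exponents in \<open>std_exps\<close>, have to be shown to be the
  standard monomials of \<open>I\<close> in generic coordinates.

  \<^bold>\<open>Initial ideals from one spanning condition.\<close> Suppose that in some coordinates the complementary
  monomials form a basis of \<open>S/I\<close>. Then they are the standard monomials: a monomial \<open>m\<close> with
  \<open>2a + 2b + c > s\<close> is larger than every complementary monomial of its degree, because these contain
  higher powers of \<open>x\<^sub>3\<close>; in the remaining cases \<open>x\<^sub>1^a x\<^sub>2^b\<close> is larger than every complementary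
  monomial of its degree, and one multiplies by \<open>x\<^sub>3^c\<close> (\<open>reduce_monom\<close>, \<open>initial_ideal_eq\<close>). In
  particular neither Borel-fixedness nor the general existence theorem for generic initial ideals is
  needed.

  \<^bold>\<open>Openness.\<close> There are at most as many complementary monomials of degree \<open>t\<close> as the dimension of
  \<open>(S/I)\<^sub>t\<close> (\<open>card_std_exps_le\<close>). So, as soon as they span for one matrix, they form a basis, and for
  a matrix \<open>A\<close> to have this property in degree \<open>t\<close> it suffices that the degree \<open>t\<close> part of \<open>A I\<close>
  meets their span in \<open>0\<close>. This is an open condition on \<open>A\<close> (\<open>disjoint_supported_open\<close>), and only the
  degrees \<open>t \<le> s\<close> matter. Nonempty open sets meet (\<open>zariski_open_GL3_meet\<close>), so the generic initial
  ideal is unique, and a single good matrix remains to be found (\<open>exists_std_spanning\<close>).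

  \<^bold>\<open>A good matrix.\<close> The Hilbert function \<open>h\<close> of a complete intersection is symmetric, and
  \<open>h t - h (t - 1)\<close> is, for \<open>2t \<le> s\<close>, the Hilbert function \<open>e t\<close> of a complete intersection of
  degrees \<open>d\<^sub>1, d\<^sub>2\<close> in two variables. Let \<open>l\<close> be a strong Lefschetz element. By symmetry,
  for \<open>2u \<le> s\<close>, \<open>l^(s - 2u)\<close> maps \<open>(S/I)\<^sub>u\<close> bijectively onto \<open>(S/I)\<^bsub>s - u\<^esub>\<close>. Move \<open>l\<close> to \<open>x\<^sub>3\<close>. For degrees
  \<open>t > s/2\<close> the complementary monomials are \<open>x\<^sub>3^(2t - s)\<close> times those of degree \<open>s - t\<close>. For
  \<open>t \<le> s/2\<close> they are \<open>x\<^sub>3\<close> times those of degree \<open>t - 1\<close> together with the \<open>x\<^sub>1^a x\<^sub>2^(t - a)\<close>,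
  \<open>a < e t\<close>; since \<open>x\<^sub>3\<close> is injective on \<open>(S/I)\<^bsub>t - 1\<^esub>\<close>, the forms of degree \<open>t\<close> in \<open>I\<close>, restricted to
  \<open>x\<^sub>3 = 0\<close>, have dimension \<open>t + 1 - e t\<close>. After replacing \<open>x\<^sub>2\<close> by \<open>x\<^sub>2 + c x\<^sub>1\<close> for generic \<open>c\<close>, they
  have to form a complement of the multiples of \<open>x\<^sub>2^(t + 1 - e t)\<close>. Dehomogenized, this says that an
  \<open>n\<close>-dimensional space of univariate polynomials contains no nonzero element vanishing to order \<open>n\<close> at
  a generic point, which holds in characteristic \<open>0\<close> by a Wronskian argument
  (\<open>wronskian_relation\<close>, \<open>generic_vanishing_order\<close>, \<open>generic_plane_complement\<close>).
\<close>

section \<open>Finite-dimensional subspaces\<close>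

text \<open>Vector spaces of possibly infinite dimension, with the notion of a finite-dimensional subset
  added.\<close>

locale vec_space = vector_space scale
  for scale :: "'a::field \<Rightarrow> 'b::ab_group_add \<Rightarrow> 'b"
begin

text \<open>Contained in the span of a finite set; the set itself need not be a subspace.\<close>

definition fin_dim :: "'b set \<Rightarrow> bool" where
  "fin_dim V \<longleftrightarrow> (\<exists>B. finite B \<and> V \<subseteq> span B)"

lemma fin_dim_subset: "fin_dim W \<Longrightarrow> V \<subseteq> W \<Longrightarrow> fin_dim V"
  by (auto simp: fin_dim_def)

lemma independent_finite:
  assumes "fin_dim V" "B \<subseteq> V" "independent B"
  shows "finite B"
  using assms independent_span_bound unfolding fin_dim_def by blast

lemma extend_to_basis:
  assumes "fin_dim V" "subspace V" "C \<subseteq> V" "independent C"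
  obtains B where "C \<subseteq> B" "B \<subseteq> V" "independent B" "span B = V" "finite B" "card B = dim V"
proof -
  obtain B where B: "C \<subseteq> B" "B \<subseteq> V" "independent B" "V \<subseteq> span B"
    using maximal_independent_subset_extend[OF assms(3,4)] by metis
  have "span B = V" using span_minimal[OF B(2) assms(2)] B(4) by (intro equalityI)
  moreover have "finite B" using independent_finite[OF assms(1) B(2,3)] .
  moreover have "card B = dim V" using basis_card_eq_dim[OF B(2,4,3)] .
  ultimately show thesis using B that by metis
qed

lemma fin_dim_dim_mono:
  assumes "fin_dim W" "subspace W" "V \<subseteq> W"
  shows "dim V \<le> dim W"
proof -
  obtain B where "finite B" "span B = W" "card B = dim W"
    using extend_to_basis[OF assms(1,2) empty_subsetI independent_empty] by metis
  then show ?thesis using dim_le_card[of V B] assms by auto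
qed

lemma fin_dim_subspace_eq:
  assumes "fin_dim W" "subspace V" "subspace W" "V \<subseteq> W" "dim W \<le> dim V"
  shows "V = W"
proof -
  have fV: "fin_dim V" using assms fin_dim_subset by blast
  obtain B where B: "independent B" "span B = V" "finite B" "card B = dim V" "B \<subseteq> V"
    using extend_to_basis[OF fV assms(2) empty_subsetI independent_empty] by metis
  obtain C where C: "B \<subseteq> C" "span C = W" "finite C" "card C = dim W"
    using extend_to_basis[OF assms(1,3) _ B(1)] B(5) assms(4) by (metis subset_trans)
  have "B = C" using card_seteq[OF C(3,1)] B C assms(5) by simp
  then show ?thesis using B C by simp
qed

lemma fin_dim_sum:
  assumes "fin_dim U" "fin_dim W"
  shows "fin_dim {x + y | x y. x \<in> U \<and> y \<in> W}"
proof -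
  obtain B C where "finite B" "finite C" "U \<subseteq> span B" "W \<subseteq> span C"
    using assms by (auto simp: fin_dim_def)
  then have "{x + y | x y. x \<in> U \<and> y \<in> W} \<subseteq> span (B \<union> C)"
    unfolding span_Un by auto
  with \<open>finite B\<close> \<open>finite C\<close> show ?thesis unfolding fin_dim_def by blast
qed

end

text \<open>Two vector spaces over the same field, for statements about linear maps between them.\<close>

locale vec_space_pair = vs1: vec_space s1 + vs2: vec_space s2
  for s1 :: "'a::field \<Rightarrow> 'b::ab_group_add \<Rightarrow> 'b"
  and s2 :: "'a::field \<Rightarrow> 'c::ab_group_add \<Rightarrow> 'c"
begin

sublocale vector_space_pair s1 s2 ..

lemma fin_dim_image:
  assumes f: "Vector_Spaces.linear s1 s2 f" and V: "vs1.fin_dim V"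
  shows "vs2.fin_dim (f ` V)"
proof -
  obtain B where "finite B" "V \<subseteq> vs1.span B" using V by (auto simp: vs1.fin_dim_def)
  then have "finite (f ` B)" "f ` V \<subseteq> vs2.span (f ` B)"
    using linear_span_image[OF f, of B] by auto
  then show ?thesis unfolding vs2.fin_dim_def by (intro exI conjI)
qed

lemma rank_nullity:
  assumes f: "Vector_Spaces.linear s1 s2 f" and V: "vs1.fin_dim V" "vs1.subspace V"
  shows "vs1.dim V = vs2.dim (f ` V) + vs1.dim {v \<in> V. f v = 0}"
proof -
  define K where "K = {v \<in> V. f v = 0}"
  have K: "vs1.subspace K" unfolding K_def
    using V(2) linear_add[OF f] linear_scale[OF f] linear_0[OF f] by (auto simp: vs1.subspace_def)
  have fK: "vs1.fin_dim K" using V(1) by (rule vs1.fin_dim_subset) (auto simp: K_def)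
  obtain C where C: "C \<subseteq> K" "vs1.independent C" "vs1.span C = K" "finite C" "card C = vs1.dim K"
    using vs1.extend_to_basis[OF fK K empty_subsetI vs1.independent_empty] by metis
  have "C \<subseteq> V" using C K_def by auto
  then obtain B where B: "C \<subseteq> B" "B \<subseteq> V" "vs1.independent B" "vs1.span B = V" "finite B"
      "card B = vs1.dim V"
    using vs1.extend_to_basis[OF V] C by metis
  have split: "V = {x + y | x y. x \<in> K \<and> y \<in> vs1.span (B - C)}"
    using B C vs1.span_Un[of C "B - C"] by (simp add: Un_absorb1)
  have disj: "x = 0" if "x \<in> vs1.span (B - C)" "x \<in> K" for x
  proof -
    have "vs1.independent (C \<union> (B - C))" using B by (simp add: Un_absorb1)
    have "x \<in> vs1.span C" using that C by simp
    have r1: "vs1.representation B x b = 0" if "b \<notin> C" for b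
      using vs1.representation_extend[OF B(3) \<open>x \<in> vs1.span C\<close> B(1)]
      vs1.representation_ne_zero[of C x b] that by auto
    have r2: "vs1.representation B x b = 0" if "b \<in> C" for b
      using vs1.representation_extend[OF B(3) \<open>x \<in> vs1.span (B - C)\<close>]
      vs1.representation_ne_zero[of "B - C" x b] that by auto
    have "x \<in> vs1.span B" using that(1) vs1.span_mono[of "B - C" B] by blast
    then have "x = (\<Sum>b | vs1.representation B x b \<noteq> 0. s1 (vs1.representation B x b) b)"
      using vs1.sum_nonzero_representation_eq[OF B(3)] by simp
    also have "\<dots> = 0" using r1 r2 by (intro sum.neutral) blast
    finally show ?thesis .
  qed
  have inj: "inj_on f (vs1.span (B - C))"
  proof (rule inj_onI)
    fix x y assume xy: "x \<in> vs1.span (B - C)" "y \<in> vs1.span (B - C)" "f x = f y"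
    have "x - y \<in> vs1.span (B - C)" using xy by (simp add: vs1.span_diff)
    moreover have "vs1.span (B - C) \<subseteq> V" using B vs1.span_mono[of "B - C" B] by auto
    ultimately have "x - y \<in> K" using linear_diff[OF f] xy by (auto simp: K_def)
    with \<open>x - y \<in> vs1.span (B - C)\<close> have "x - y = 0" by (rule disj)
    then show "x = y" by simp
  qed
  have ind: "vs2.independent (f ` (B - C))"
    using linear_independent_injective_image[OF f vs1.independent_mono[OF B(3)] inj] by auto
  have "f ` V = f ` vs1.span (B - C)"
  proof
    show "f ` V \<subseteq> f ` vs1.span (B - C)"
    proof
      fix z assume "z \<in> f ` V"
      then obtain x y where "x \<in> K" "y \<in> vs1.span (B - C)" "z = f (x + y)" using split by auto
      then have "z = f y" using linear_add[OF f] by (simp add: K_def)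
      then show "z \<in> f ` vs1.span (B - C)" using \<open>y \<in> _\<close> by blast
    qed
    show "f ` vs1.span (B - C) \<subseteq> f ` V" using B vs1.span_mono[of "B - C" B] by auto
  qed
  then have "f ` V = vs2.span (f ` (B - C))" using linear_span_image[OF f] by metis
  then have "vs2.dim (f ` V) = card (f ` (B - C))" using ind
    by (metis vs2.dim_span_eq_card_independent)
  also have "\<dots> = card (B - C)"
    by (rule card_image) (metis inj inj_on_subset vs1.span_superset)
  also have "\<dots> = vs1.dim V - vs1.dim K" using B C by (metis card_Diff_subset)
  finally have "vs2.dim (f ` V) = vs1.dim V - vs1.dim K" .
  moreover have "vs1.dim K \<le> vs1.dim V"
    by (rule vs1.fin_dim_dim_mono) (use V in \<open>auto simp: K_def\<close>)
  ultimately show ?thesis unfolding K_def by simp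
qed

lemma dim_image_inj:
  assumes f: "Vector_Spaces.linear s1 s2 f" and V: "vs1.fin_dim V" "vs1.subspace V"
    and inj: "\<And>v. v \<in> V \<Longrightarrow> f v = 0 \<Longrightarrow> v = 0"
  shows "vs2.dim (f ` V) = vs1.dim V"
proof -
  have "{v \<in> V. f v = 0} \<subseteq> vs1.span {}" using inj by auto
  then have "vs1.dim {v \<in> V. f v = 0} = 0" using vs1.dim_le_card[of _ "{}"] by fastforce
  then show ?thesis using rank_nullity[OF f V] by simp
qed

end

context vec_space begin

text \<open>Every subspace is the kernel of some endomorphism.\<close>

lemma exists_linear_kernel:
  assumes "subspace U"
  obtains P where "Vector_Spaces.linear scale scale P" "\<And>v. P v = 0 \<longleftrightarrow> v \<in> U"
proof -
  interpret vec_space_pair scale scale ..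
  obtain C where C: "C \<subseteq> U" "independent C" "U \<subseteq> span C" using basis_exists[of U] by metis
  then have sC: "span C = U" using span_minimal[OF C(1) assms] by (intro equalityI)
  define B where "B = extend_basis C"
  have B: "C \<subseteq> B" "independent B" "span B = UNIV"
    using C extend_basis_superset independent_extend_basis span_extend_basis unfolding B_def by auto
  define P where "P = construct B (\<lambda>b. if b \<in> C then 0 else b)"
  have l: "Vector_Spaces.linear scale scale P" unfolding P_def by (rule linear_construct[OF B(2)])
  have P1: "P b = (if b \<in> C then 0 else b)" if "b \<in> B" for b
    unfolding P_def using construct_basis[OF B(2) that] .
  have "P b = 0" if "b \<in> C" for b using P1[of b] B(1) that by auto
  then have P0: "P v = 0" if "v \<in> U" for v
    using linear_eq_0_on_span[OF l, of C v] that sC by metis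
  have Pid: "P v = v" if "v \<in> span (B - C)" for v
    using linear_eq_on[OF l linear_ident that] P1 by auto
  have "v \<in> U" if "P v = 0" for v
  proof -
    have "v \<in> span (C \<union> (B - C))" using B by (simp add: Un_absorb1)
    then obtain x y where xy: "x \<in> U" "y \<in> span (B - C)" "v = x + y"
      unfolding span_Un using sC by auto
    then have "y = 0" using that linear_add[OF l] P0 Pid by auto
    with xy show ?thesis by simp
  qed
  with P0 l show thesis using that by blast
qed

lemma dim_sum_Int:
  assumes U: "subspace U" "fin_dim U" and W: "subspace W" "fin_dim W"
  shows "dim {x + y | x y. x \<in> U \<and> y \<in> W} + dim (U \<inter> W) = dim U + dim W"
proof -
  interpret vec_space_pair scale scale ..
  obtain P where P: "Vector_Spaces.linear scale scale P" "\<And>v. P v = 0 \<longleftrightarrow> v \<in> U"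
    using exists_linear_kernel[OF U(1)] by blast
  let ?S = "{x + y | x y. x \<in> U \<and> y \<in> W}"
  have S: "subspace ?S" using U W by (simp add: subspace_sums)
  have US: "U \<subseteq> ?S"
  proof
    fix u assume "u \<in> U"
    moreover have "u = u + 0" "0 \<in> W" using W subspace_0 by auto
    ultimately show "u \<in> ?S" by blast
  qed
  have "dim ?S = dim (P ` ?S) + dim {v \<in> ?S. P v = 0}"
    by (rule rank_nullity[OF P(1) fin_dim_sum[OF U(2) W(2)] S])
  also have "{v \<in> ?S. P v = 0} = U" using P(2) US by auto
  also have "P ` ?S = P ` W"
  proof
    show "P ` ?S \<subseteq> P ` W"
    proof
      fix z assume "z \<in> P ` ?S"
      then obtain x y where "x \<in> U" "y \<in> W" "z = P (x + y)" by auto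
      then have "z = P y" using linear_add[OF P(1)] P(2) by simp
      then show "z \<in> P ` W" using \<open>y \<in> W\<close> by blast
    qed
    show "P ` W \<subseteq> P ` ?S"
    proof (rule image_mono, rule subsetI)
      fix w assume "w \<in> W"
      moreover have "w = 0 + w" "0 \<in> U" using U subspace_0 by auto
      ultimately show "w \<in> ?S" by blast
    qed
  qed
  finally have 1: "dim ?S = dim (P ` W) + dim U" .
  have "dim W = dim (P ` W) + dim {v \<in> W. P v = 0}" by (rule rank_nullity[OF P(1) W(2,1)])
  moreover have "{v \<in> W. P v = 0} = U \<inter> W" using P(2) by auto
  ultimately show ?thesis using 1 by simp
qed

end

section \<open>Evaluation homomorphisms\<close>

text \<open>Homomorphisms of commutative rings, as a predicate on functions.\<close>

definition ring_hom :: "('a::comm_ring_1 \<Rightarrow> 'b::comm_ring_1) \<Rightarrow> bool" where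
  "ring_hom h \<longleftrightarrow> h 1 = 1 \<and> (\<forall>x y. h (x + y) = h x + h y \<and> h (x * y) = h x * h y)"

lemma ring_hom_1: "ring_hom h \<Longrightarrow> h 1 = 1"
  and ring_hom_add: "ring_hom h \<Longrightarrow> h (x + y) = h x + h y"
  and ring_hom_mult: "ring_hom h \<Longrightarrow> h (x * y) = h x * h y"
  by (auto simp: ring_hom_def)

lemma ring_hom_0: "ring_hom h \<Longrightarrow> h 0 = 0"
  using ring_hom_add[of h 0 0] by simp

lemma ring_hom_minus: "ring_hom h \<Longrightarrow> h (- x) = - h x"
  using ring_hom_add[of h x "- x"] ring_hom_0[of h] by (simp add: eq_neg_iff_add_eq_0 add.commute)

lemma ring_hom_diff: "ring_hom h \<Longrightarrow> h (x - y) = h x - h y"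
  using ring_hom_add[of h x "- y"] ring_hom_minus[of h y] by simp

lemma ring_hom_sum: "ring_hom h \<Longrightarrow> h (sum f A) = (\<Sum>x\<in>A. h (f x))"
  by (induction A rule: infinite_finite_induct) (simp_all add: ring_hom_0 ring_hom_add)

lemma ring_hom_prod: "ring_hom h \<Longrightarrow> h (prod f A) = (\<Prod>x\<in>A. h (f x))"
  by (induction A rule: infinite_finite_induct) (simp_all add: ring_hom_1 ring_hom_mult)

lemma ring_hom_power: "ring_hom h \<Longrightarrow> h (x ^ n) = h x ^ n"
  by (induction n) (simp_all add: ring_hom_1 ring_hom_mult)

lemma ring_hom_id: "ring_hom id" by (simp add: ring_hom_def)

lemma ring_hom_comp: "ring_hom g \<Longrightarrow> ring_hom h \<Longrightarrow> ring_hom (\<lambda>x. g (h x))"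
  by (simp add: ring_hom_def)

lemma ring_hom_Const: "ring_hom (Const :: 'k::comm_ring_1 \<Rightarrow> ('i, 'k) mpol)"
  by (auto simp: ring_hom_def Const_def single_add mult_single)

lemma Const_times_monom_of: "Const c * monom_of m = Poly_Mapping.single m (c::'k::comm_ring_1)"
  by (simp add: Const_def monom_of_def mult_single)

lemma lookup_Const_times: "Poly_Mapping.lookup (Const c * p) m = c * Poly_Mapping.lookup p m"
  for c :: "'k::comm_ring_1"
proof -
  have "Const c * p = Poly_Mapping.map ((*) c) p" by (simp add: Const_def mult_map_scale_conv_mult)
  then show ?thesis by (simp add: Poly_Mapping.map.rep_eq when_def)
qed

lemma monom_of_mult: "monom_of (m + n) = monom_of m * (monom_of n :: ('i, 'k::comm_ring_1) mpol)"
  by (simp add: monom_of_def mult_single)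

lemma lookup_monom_of: "Poly_Mapping.lookup (monom_of m :: ('i, 'k::zero_neq_one) mpol) n = (1 when m = n)"
  by (simp add: monom_of_def lookup_single)

lemma keys_monom_of [simp]: "Poly_Mapping.keys (monom_of m :: ('i, 'k::zero_neq_one) mpol) = {m}"
  by (simp add: monom_of_def)

lemma mpol_eq_sum:
  fixes p :: "('i, 'k::comm_ring_1) mpol"
  assumes "finite A" "Poly_Mapping.keys p \<subseteq> A"
  shows "p = (\<Sum>m\<in>A. Const (Poly_Mapping.lookup p m) * monom_of m)"
proof (rule poly_mapping_eqI)
  fix n
  have "Poly_Mapping.lookup (\<Sum>m\<in>A. Const (Poly_Mapping.lookup p m) * monom_of m) n
    = (\<Sum>m\<in>A. Poly_Mapping.lookup p m when m = n)"
    by (simp add: lookup_sum Const_times_monom_of lookup_single)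
  also have "\<dots> = (if n \<in> A then Poly_Mapping.lookup p n else 0)"
    using assms(1) by (simp add: when_def)
  also have "\<dots> = Poly_Mapping.lookup p n" using assms(2) by (auto simp: in_keys_iff)
  finally show "Poly_Mapping.lookup p n
    = Poly_Mapping.lookup (\<Sum>m\<in>A. Const (Poly_Mapping.lookup p m) * monom_of m) n" by simp
qed

text \<open>The value of the monomial with exponent \<open>m\<close> at the point \<open>x\<close>.\<close>

definition eval_monom :: "('i \<Rightarrow> 'r::comm_semiring_1) \<Rightarrow> ('i::finite \<Rightarrow>\<^sub>0 nat) \<Rightarrow> 'r" where
  "eval_monom x m = (\<Prod>i\<in>UNIV. x i ^ Poly_Mapping.lookup m i)"

lemma eval_monom_add: "eval_monom x (m + n) = eval_monom x m * eval_monom x n"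
  by (simp add: eval_monom_def lookup_add power_add prod.distrib)

lemma eval_poly_eq_sum:
  assumes "finite A" "Poly_Mapping.keys p \<subseteq> A" "\<phi> 0 = 0"
  shows "eval_poly \<phi> x p = (\<Sum>m\<in>A. \<phi> (Poly_Mapping.lookup p m) * eval_monom x m)"
proof -
  have "(\<Prod>i\<in>Poly_Mapping.keys m. x i ^ Poly_Mapping.lookup m i) = eval_monom x m" for m
    unfolding eval_monom_def by (rule prod.mono_neutral_left) (auto simp: in_keys_iff)
  then have "eval_poly \<phi> x p = (\<Sum>m\<in>Poly_Mapping.keys p. \<phi> (Poly_Mapping.lookup p m) * eval_monom x m)"
    by (simp add: eval_poly_def)
  also have "\<dots> = (\<Sum>m\<in>A. \<phi> (Poly_Mapping.lookup p m) * eval_monom x m)"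
    by (rule sum.mono_neutral_left) (use assms in \<open>auto simp: in_keys_iff\<close>)
  finally show ?thesis .
qed

lemma eval_poly_single:
  fixes x :: "'i::finite \<Rightarrow> 'r::comm_ring_1" and \<phi> :: "'k::comm_ring_1 \<Rightarrow> 'r"
  assumes "\<phi> 0 = 0" shows "eval_poly \<phi> x (Poly_Mapping.single m c) = \<phi> c * eval_monom x m"
  using eval_poly_eq_sum[of "{m}" "Poly_Mapping.single m c" \<phi> x] assms by simp

lemma eval_poly_add:
  fixes x :: "'i::finite \<Rightarrow> 'r::comm_ring_1" and \<phi> :: "'k::comm_ring_1 \<Rightarrow> 'r"
  assumes "ring_hom \<phi>" shows "eval_poly \<phi> x (p + q) = eval_poly \<phi> x p + eval_poly \<phi> x q"
proof -
  let ?A = "Poly_Mapping.keys p \<union> Poly_Mapping.keys q"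
  have "eval_poly \<phi> x r = (\<Sum>m\<in>?A. \<phi> (Poly_Mapping.lookup r m) * eval_monom x m)"
    if "Poly_Mapping.keys r \<subseteq> ?A" for r
    by (rule eval_poly_eq_sum) (use that ring_hom_0[OF assms] in auto)
  from this[of p] this[of q] this[of "p + q"] show ?thesis
    by (simp add: Poly_Mapping.keys_add lookup_add ring_hom_add[OF assms] distrib_right sum.distrib)
qed

lemma eval_poly_0: "eval_poly \<phi> x 0 = 0" by (simp add: eval_poly_def)

lemma eval_poly_sum:
  fixes x :: "'i::finite \<Rightarrow> 'r::comm_ring_1" and \<phi> :: "'k::comm_ring_1 \<Rightarrow> 'r"
  assumes "ring_hom \<phi>" shows "eval_poly \<phi> x (sum f A) = (\<Sum>a\<in>A. eval_poly \<phi> x (f a))"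
  by (induction A rule: infinite_finite_induct) (simp_all add: eval_poly_0 eval_poly_add[OF assms])

lemma ring_hom_eval_poly:
  fixes x :: "'i::finite \<Rightarrow> 'r::comm_ring_1" and \<phi> :: "'k::comm_ring_1 \<Rightarrow> 'r"
  assumes h: "ring_hom \<phi>" shows "ring_hom (eval_poly \<phi> x)"
proof -
  note h0 = ring_hom_0[OF h]
  have "eval_poly \<phi> x (p * q) = eval_poly \<phi> x p * eval_poly \<phi> x q" for p q
  proof -
    let ?s = "\<lambda>p m. Poly_Mapping.single m (Poly_Mapping.lookup p m)"
    have p: "p = (\<Sum>m\<in>Poly_Mapping.keys p. ?s p m)" for p :: "('i, 'k) mpol"
      using mpol_eq_sum[of "Poly_Mapping.keys p" p] by (simp add: Const_times_monom_of)
    have "p * q = (\<Sum>m\<in>Poly_Mapping.keys p. \<Sum>n\<in>Poly_Mapping.keys q. ?s p m * ?s q n)"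
      by (subst p[of p], subst p[of q], rule sum_product)
    then have "eval_poly \<phi> x (p * q) = (\<Sum>m\<in>Poly_Mapping.keys p. \<Sum>n\<in>Poly_Mapping.keys q.
        eval_poly \<phi> x (?s p m) * eval_poly \<phi> x (?s q n))"
      by (simp add: eval_poly_sum[OF h] mult_single eval_poly_single h0 ring_hom_mult[OF h]
          eval_monom_add mult_ac)
    also have "\<dots> = (\<Sum>m\<in>Poly_Mapping.keys p. eval_poly \<phi> x (?s p m))
        * (\<Sum>n\<in>Poly_Mapping.keys q. eval_poly \<phi> x (?s q n))"
      by (simp add: sum_product)
    also have "\<dots> = eval_poly \<phi> x p * eval_poly \<phi> x q"
      by (simp add: eval_poly_sum[OF h, symmetric] p[symmetric])
    finally show ?thesis .
  qed
  moreover have "eval_poly \<phi> x 1 = 1"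
    using eval_poly_single[of \<phi> x 0 1] h0 ring_hom_1[OF h] by (simp add: eval_monom_def)
  ultimately show ?thesis by (simp add: ring_hom_def eval_poly_add[OF h])
qed

lemma eval_poly_Const:
  fixes x :: "'i::finite \<Rightarrow> 'r::comm_ring_1" and \<phi> :: "'k::comm_ring_1 \<Rightarrow> 'r"
  assumes "ring_hom \<phi>" shows "eval_poly \<phi> x (Const c) = \<phi> c"
  using eval_poly_single[of \<phi> x 0 c] ring_hom_0[OF assms] by (simp add: Const_def eval_monom_def)

lemma eval_poly_monom_of:
  fixes x :: "'i::finite \<Rightarrow> 'r::comm_ring_1" and \<phi> :: "'k::comm_ring_1 \<Rightarrow> 'r"
  assumes "ring_hom \<phi>" shows "eval_poly \<phi> x (monom_of m) = eval_monom x m"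
  using eval_poly_single[of \<phi> x m 1] ring_hom_0[OF assms] ring_hom_1[OF assms]
  by (simp add: monom_of_def)

lemma eval_poly_Var:
  fixes x :: "'i::finite \<Rightarrow> 'r::comm_ring_1" and \<phi> :: "'k::comm_ring_1 \<Rightarrow> 'r"
  assumes "ring_hom \<phi>" shows "eval_poly \<phi> x (Var i) = x i"
proof -
  have "eval_monom x (Poly_Mapping.single i 1) = (\<Prod>j\<in>{i}. x j ^ 1)"
    unfolding eval_monom_def by (rule prod.mono_neutral_cong_right) (auto simp: lookup_single when_def)
  then show ?thesis by (simp add: Var_def eval_poly_monom_of[OF assms])
qed

lemma hom_eval_monom: "ring_hom h \<Longrightarrow> h (eval_monom x m) = eval_monom (\<lambda>i. h (x i)) m"
  by (simp add: eval_monom_def ring_hom_prod ring_hom_power)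

lemma hom_eval_poly:
  fixes x :: "'i::finite \<Rightarrow> 'r::comm_ring_1"
  assumes "ring_hom h" "ring_hom \<phi>"
  shows "h (eval_poly \<phi> x p) = eval_poly (\<lambda>c. h (\<phi> c)) (\<lambda>i. h (x i)) p"
  by (simp add: eval_poly_eq_sum[of "Poly_Mapping.keys p" p] ring_hom_0 assms ring_hom_sum
      ring_hom_mult hom_eval_monom)

lemma eval_monom_Var: "eval_monom Var m = (monom_of m :: ('i::finite, 'k::comm_ring_1) mpol)"
proof -
  have *: "Var i ^ n = (monom_of (Poly_Mapping.single i n) :: ('i, 'k) mpol)" for i n
  proof (induction n)
    case 0
    then show ?case by (simp add: monom_of_def)
  next
    case (Suc n)
    then show ?case using single_add[of i 1 n] by (simp add: Var_def flip: monom_of_mult)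
  qed
  have **: "(\<Prod>i\<in>A. monom_of (f i)) = (monom_of (sum f A) :: ('i, 'k) mpol)"
    for A and f :: "'i \<Rightarrow> ('i \<Rightarrow>\<^sub>0 nat)"
  proof (induction A rule: infinite_finite_induct)
    case (insert x F) then show ?case by (simp add: monom_of_mult)
  qed (auto simp: monom_of_def)
  have "m = (\<Sum>i\<in>UNIV. Poly_Mapping.single i (Poly_Mapping.lookup m i))"
  proof (rule poly_mapping_eqI)
    fix k
    have "(\<Sum>i\<in>UNIV. Poly_Mapping.lookup (Poly_Mapping.single i (Poly_Mapping.lookup m i)) k)
      = (\<Sum>i\<in>UNIV. if i = k then Poly_Mapping.lookup m i else 0)"
      by (rule sum.cong) (auto simp: lookup_single)
    then show "Poly_Mapping.lookup m k
      = Poly_Mapping.lookup (\<Sum>i\<in>UNIV. Poly_Mapping.single i (Poly_Mapping.lookup m i)) k"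
      by (simp add: lookup_sum)
  qed
  then show ?thesis by (simp add: eval_monom_def * **)
qed

lemma eval_poly_Const_Var: "eval_poly Const Var p = (p :: ('i::finite, 'k::comm_ring_1) mpol)"
  using eval_poly_eq_sum[of "Poly_Mapping.keys p" p Const Var]
    mpol_eq_sum[of "Poly_Mapping.keys p" p] ring_hom_0[OF ring_hom_Const]
  by (simp add: eval_monom_Var)

text \<open>Applying a homomorphism to all coefficients of a polynomial.\<close>

lemma eval_poly_map_coeffs:
  fixes p :: "('i::finite, 'd::comm_ring_1) mpol"
  assumes "ring_hom h"
  shows "Poly_Mapping.lookup (eval_poly (\<lambda>c. Const (h c)) Var p) m = h (Poly_Mapping.lookup p m)"
proof -
  have "eval_poly (\<lambda>c. Const (h c)) Var p
     = (\<Sum>n\<in>insert m (Poly_Mapping.keys p). Const (h (Poly_Mapping.lookup p n)) * monom_of n)"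
    by (subst eval_poly_eq_sum[of "insert m (Poly_Mapping.keys p)"])
      (auto simp: ring_hom_0[OF assms] ring_hom_0[OF ring_hom_Const] eval_monom_Var)
  also have "Poly_Mapping.lookup \<dots> m
     = (\<Sum>n\<in>insert m (Poly_Mapping.keys p). if n = m then h (Poly_Mapping.lookup p n) else 0)"
    by (simp add: lookup_sum lookup_Const_times lookup_monom_of when_def if_distrib cong: if_cong)
  also have "\<dots> = h (Poly_Mapping.lookup p m)" by (simp only: sum.delta finite_insert finite_keys) simp
  finally show ?thesis .
qed

section \<open>Linear substitutions\<close>

text \<open>The image of the variable \<open>x\<^sub>j\<close> under the substitution given by a matrix.\<close>

definition lin_form :: "'k::comm_ring_1 ^ 3 ^ 3 \<Rightarrow> 3 \<Rightarrow> 'k pol3" where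
  "lin_form A j = (\<Sum>i\<in>UNIV. Const (A $ i $ j) * Var i)"

lemma lin_subst_eq: "lin_subst A = eval_poly Const (lin_form A)"
  unfolding lin_subst_def lin_form_def[abs_def] ..

lemma ring_hom_lin_subst: "ring_hom (lin_subst A)"
  unfolding lin_subst_eq by (rule ring_hom_eval_poly[OF ring_hom_Const])

lemma lin_subst_Const: "lin_subst A (Const c) = Const c"
  unfolding lin_subst_eq by (rule eval_poly_Const[OF ring_hom_Const])

lemma lin_subst_Var: "lin_subst A (Var j) = lin_form A j"
  unfolding lin_subst_eq by (rule eval_poly_Var[OF ring_hom_Const])

lemma lin_subst_lin_subst: "lin_subst A (lin_subst B p) = lin_subst (A ** B) p"
proof -
  have "lin_subst A (lin_form B j) = lin_form (A ** B) j" for j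
  proof -
    have "lin_subst A (lin_form B j)
      = (\<Sum>i\<in>UNIV. Const (B $ i $ j) * (\<Sum>k\<in>UNIV. Const (A $ k $ i) * Var k))"
      by (simp add: lin_form_def ring_hom_sum[OF ring_hom_lin_subst] lin_subst_Const
          ring_hom_mult[OF ring_hom_lin_subst] lin_subst_Var)
    also have "\<dots> = (\<Sum>i\<in>UNIV. \<Sum>k\<in>UNIV. Const (A $ k $ i * B $ i $ j) * Var k)"
      by (simp add: sum_distrib_left ring_hom_mult[OF ring_hom_Const] mult_ac)
    also have "\<dots> = (\<Sum>k\<in>UNIV. \<Sum>i\<in>UNIV. Const (A $ k $ i * B $ i $ j) * Var k)"
      by (rule sum.swap)
    also have "\<dots> = lin_form (A ** B) j"
      by (simp add: lin_form_def matrix_matrix_mult_def ring_hom_sum[OF ring_hom_Const]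
          sum_distrib_right)
    finally show ?thesis .
  qed
  then show ?thesis
    using hom_eval_poly[OF ring_hom_lin_subst ring_hom_Const, of A "lin_form B" p]
    by (simp add: lin_subst_eq[of B] lin_subst_Const) (simp add: lin_subst_eq)
qed

lemma lin_subst_mat_1: "lin_subst (mat 1) p = p"
proof -
  have "lin_form (mat 1) j = (Var j :: 'a pol3)" for j
  proof -
    have "lin_form (mat 1) j = (\<Sum>i\<in>UNIV. if i = j then (Var i :: 'a pol3) else 0)"
      unfolding lin_form_def
      by (rule sum.cong) (auto simp: mat_def ring_hom_0[OF ring_hom_Const] ring_hom_1[OF ring_hom_Const])
    then show ?thesis by simp
  qed
  then have "lin_form (mat 1) = (Var :: 3 \<Rightarrow> 'a pol3)" by (rule ext)
  then show ?thesis by (simp add: lin_subst_eq eval_poly_Const_Var)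
qed

section \<open>Linear independence is an open condition\<close>

text \<open>Linear independence of a finite family of vectors, given by their coordinates over a ring; the
  index set \<open>'m\<close> of the coordinates may be infinite.\<close>

definition indep_family :: "'i set \<Rightarrow> ('i \<Rightarrow> 'm \<Rightarrow> 'e::comm_ring_1) \<Rightarrow> bool" where
  "indep_family I v \<longleftrightarrow> (\<forall>c. (\<forall>m. (\<Sum>i\<in>I. c i * v i m) = 0) \<longrightarrow> (\<forall>i\<in>I. c i = 0))"

text \<open>If a family with coordinates in a ring \<open>D\<close> becomes independent under one homomorphism \<open>\<phi>0\<close> to a
  domain, then there is \<open>P \<in> D\<close> with \<open>\<phi>0 P \<noteq> 0\<close> such that it becomes independent under every
  homomorphism to a domain that does not kill \<open>P\<close>. The proof is Gaussian elimination without
  division; \<open>P\<close> is the product of the pivots.\<close>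

lemma indep_family_open:
  fixes v :: "'i \<Rightarrow> 'm \<Rightarrow> 'd::comm_ring_1" and \<phi>0 :: "'d \<Rightarrow> 'e::idom"
  assumes "finite I" "ring_hom \<phi>0" "indep_family I (\<lambda>i m. \<phi>0 (v i m))"
  obtains P where "\<phi>0 P \<noteq> 0"
    "\<And>\<phi> :: 'd \<Rightarrow> 'k::idom. ring_hom \<phi> \<Longrightarrow> \<phi> P \<noteq> 0 \<Longrightarrow> indep_family I (\<lambda>i m. \<phi> (v i m))"
proof -
  have "\<exists>P. \<phi>0 P \<noteq> 0 \<and> (\<forall>\<phi> :: 'd \<Rightarrow> 'k. ring_hom \<phi> \<longrightarrow> \<phi> P \<noteq> 0 \<longrightarrow>
      indep_family I (\<lambda>i m. \<phi> (v i m)))"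
    using assms(1,3)
  proof (induction I arbitrary: v rule: finite_induct)
    case empty
    then show ?case
      using ring_hom_1[OF assms(2)] by (intro exI[of _ 1]) (simp add: indep_family_def)
  next
    case (insert j I)
    have "\<exists>m0. \<phi>0 (v j m0) \<noteq> 0"
    proof (rule ccontr)
      assume "\<not> ?thesis"
      then have "(\<Sum>i\<in>insert j I. (if i = j then 1 else 0) * \<phi>0 (v i m)) = 0" for m
        using insert.hyps by (intro sum.neutral) auto
      then have "\<forall>i\<in>insert j I. (if i = j then 1 else (0::'e)) = 0"
        using insert.prems[unfolded indep_family_def, rule_format, of "\<lambda>i. if i = j then 1 else 0"] by blast
      then show False by simp
    qed
    then obtain m0 where m0: "\<phi>0 (v j m0) \<noteq> 0" ..
    \<comment> \<open>Clear the coordinate \<open>m0\<close> with the pivot \<open>v j m0\<close>.\<close>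
    define w where "w = (\<lambda>i m. v j m0 * v i m - v i m0 * v j m)"
    have "indep_family I (\<lambda>i m. \<phi>0 (w i m))"
      unfolding indep_family_def
    proof (intro allI impI)
      fix c :: "'i \<Rightarrow> 'e" assume c: "\<forall>m. (\<Sum>i\<in>I. c i * \<phi>0 (w i m)) = 0"
      define b where "b = (\<lambda>i. if i = j then - (\<Sum>i\<in>I. c i * \<phi>0 (v i m0)) else c i * \<phi>0 (v j m0))"
      have "(\<Sum>i\<in>insert j I. b i * \<phi>0 (v i m)) = 0" for m
      proof -
        have "(\<Sum>i\<in>I. b i * \<phi>0 (v i m)) = (\<Sum>i\<in>I. c i * \<phi>0 (v j m0) * \<phi>0 (v i m))"
          using insert.hyps by (intro sum.cong) (auto simp: b_def)
        then have "(\<Sum>i\<in>insert j I. b i * \<phi>0 (v i m)) = (\<Sum>i\<in>I. c i * \<phi>0 (w i m))"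
          using insert.hyps by (simp add: b_def w_def ring_hom_diff[OF assms(2)]
              ring_hom_mult[OF assms(2)] right_diff_distrib sum_subtractf sum_distrib_left mult_ac)
        then show ?thesis using c by simp
      qed
      then have "\<forall>i\<in>insert j I. b i = 0" using insert.prems unfolding indep_family_def by blast
      then show "\<forall>i\<in>I. c i = 0" using insert.hyps m0 by (auto simp: b_def split: if_splits)
    qed
    then obtain P where P: "\<phi>0 P \<noteq> 0"
      "\<And>\<phi> :: 'd \<Rightarrow> 'k. ring_hom \<phi> \<Longrightarrow> \<phi> P \<noteq> 0 \<Longrightarrow> indep_family I (\<lambda>i m. \<phi> (w i m))"
      using insert.IH by blast
    show ?case
    proof (intro exI[of _ "P * v j m0"] conjI allI impI)
      show "\<phi>0 (P * v j m0) \<noteq> 0" using P(1) m0 by (simp add: ring_hom_mult[OF assms(2)])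
      fix \<phi> :: "'d \<Rightarrow> 'k" assume h: "ring_hom \<phi>" and "\<phi> (P * v j m0) \<noteq> 0"
      then have ne: "\<phi> P \<noteq> 0" "\<phi> (v j m0) \<noteq> 0" by (auto simp: ring_hom_mult[OF h])
      show "indep_family (insert j I) (\<lambda>i m. \<phi> (v i m))"
        unfolding indep_family_def
      proof (intro allI impI)
        fix c :: "'i \<Rightarrow> 'k" assume c: "\<forall>m. (\<Sum>i\<in>insert j I. c i * \<phi> (v i m)) = 0"
        have c': "(\<Sum>i\<in>I. c i * \<phi> (v i m)) = - (c j * \<phi> (v j m))" for m
          using c insert.hyps by (simp add: eq_neg_iff_add_eq_0 add.commute)
        have "(\<Sum>i\<in>I. c i * \<phi> (w i m)) = 0" for m
        proof -
          have "(\<Sum>i\<in>I. c i * \<phi> (w i m))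
            = \<phi> (v j m0) * (\<Sum>i\<in>I. c i * \<phi> (v i m)) - \<phi> (v j m) * (\<Sum>i\<in>I. c i * \<phi> (v i m0))"
            by (simp add: w_def ring_hom_diff[OF h] ring_hom_mult[OF h] right_diff_distrib
                sum_subtractf sum_distrib_left mult_ac)
          then show ?thesis by (simp add: c' mult_ac)
        qed
        then have z: "\<forall>i\<in>I. c i = 0" using P(2)[OF h ne(1)] unfolding indep_family_def by blast
        then have "c j * \<phi> (v j m0) = 0" using c'[of m0] by simp
        with z ne show "\<forall>i\<in>insert j I. c i = 0" by simp
      qed
    qed
  qed
  then show thesis using that by blast
qed

section \<open>Wronskians\<close>

lemma lead_coeff_pderiv:
  "lead_coeff (pderiv p) = of_nat (degree p) * lead_coeff (p :: 'k::field_char_0 poly)"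
proof (cases "degree p")
  case 0
  then have "pderiv p = 0" by (simp add: pderiv_eq_0_iff)
  with 0 show ?thesis by simp
qed (simp add: degree_pderiv coeff_pderiv)

text \<open>Polynomials with vanishing Wronskian are proportional, in characteristic \<open>0\<close>.\<close>

lemma pderiv_proportional:
  fixes a b :: "'k::field_char_0 poly"
  assumes "a * pderiv b = pderiv a * b" "b \<noteq> 0"
  shows "\<exists>c. a = smult c b"
proof -
  have deg: "degree a = degree b" if "a * pderiv b = pderiv a * b" "a \<noteq> 0" for a :: "'k poly"
  proof -
    have "lead_coeff a * (of_nat (degree b) * lead_coeff b)
      = of_nat (degree a) * lead_coeff a * lead_coeff b"
      using arg_cong[OF that(1), of lead_coeff] by (simp only: lead_coeff_mult lead_coeff_pderiv)
    then show ?thesis using that(2) assms(2) by simp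
  qed
  define c where "c = coeff a (degree b) / lead_coeff b"
  define d where "d = a - smult c b"
  have "d * pderiv b = pderiv d * b"
    using assms(1) by (simp add: d_def pderiv_diff pderiv_smult algebra_simps)
  have "d = 0"
  proof (rule ccontr)
    assume "d \<noteq> 0"
    then have "degree d = degree b" using deg \<open>d * pderiv b = pderiv d * b\<close> by blast
    then have "lead_coeff d = coeff a (degree b) - c * lead_coeff b" by (simp add: d_def)
    then have "lead_coeff d = 0" using assms(2) by (simp add: c_def)
    with \<open>d \<noteq> 0\<close> show False by simp
  qed
  then show ?thesis by (auto simp: d_def)
qed

lemma pderiv_sum: "pderiv (sum f A) = (\<Sum>i\<in>A. pderiv (f i))"
  by (induction A rule: infinite_finite_induct) (simp_all add: pderiv_add)

text \<open>The rows of derivatives of linearly independent polynomials are independent even over the ring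
  of polynomials. From a relation with coefficients \<open>a i\<close> one obtains, by differentiating it and
  eliminating the index \<open>j\<close>, a relation between fewer polynomials; by induction it is trivial, so all
  \<open>a i\<close> are constant multiples of \<open>a j\<close>.\<close>

lemma wronskian_relation:
  fixes f a :: "'i \<Rightarrow> 'k::field_char_0 poly"
  assumes "finite I" "\<And>c. (\<Sum>i\<in>I. smult (c i) (f i)) = 0 \<Longrightarrow> \<forall>i\<in>I. c i = 0"
    and "\<And>j. j < card I \<Longrightarrow> (\<Sum>i\<in>I. a i * (pderiv ^^ j) (f i)) = 0"
  shows "\<forall>i\<in>I. a i = 0"
  using assms
proof (induction "card I" arbitrary: I a)
  case 0
  then show ?case by simp
next
  case (Suc n)
  have sub: "\<forall>i\<in>I-{j}. c i = 0" if "(\<Sum>i\<in>I-{j}. smult (c i) (f i)) = 0" "j \<in> I" for c j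
  proof -
    have "(\<Sum>i\<in>I. smult (if i = j then 0 else c i) (f i)) = (\<Sum>i\<in>I-{j}. smult (c i) (f i))"
      using that(2) Suc.prems(1) by (simp add: sum.remove[of I j])
    with that(1) have "\<forall>i\<in>I. (if i = j then 0 else c i) = 0" by (intro Suc.prems(2)) simp
    then have "(if i = j then 0 else c i) = 0" if "i \<in> I" for i using that by blast
    then show ?thesis by (metis DiffD1 DiffD2 singletonI)
  qed
  show ?case
  proof (rule ccontr)
    assume ne: "\<not> ?thesis"
    then obtain j where j: "j \<in> I" "a j \<noteq> 0" by blast
    have n: "n = card (I - {j})" using Suc.hyps(2) j Suc.prems(1) by simp
    define b where "b = (\<lambda>i. a j * pderiv (a i) - pderiv (a j) * a i)"
    have "\<forall>i\<in>I-{j}. b i = 0"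
    proof (rule Suc.hyps(1)[OF n])
      fix k assume k: "k < card (I - {j})"
      let ?f = "\<lambda>k i. (pderiv ^^ k) (f i)"
      have 0: "(\<Sum>i\<in>I. a i * ?f k i) = 0" "(\<Sum>i\<in>I. a i * ?f (Suc k) i) = 0"
        using Suc.prems(3)[of k] Suc.prems(3)[of "Suc k"] k n Suc.hyps(2) by auto
      have "0 = pderiv (\<Sum>i\<in>I. a i * ?f k i)" using 0 by simp
      also have "\<dots> = (\<Sum>i\<in>I. a i * ?f (Suc k) i) + (\<Sum>i\<in>I. pderiv (a i) * ?f k i)"
        by (simp add: pderiv_sum pderiv_mult sum.distrib mult.commute)
      finally have 1: "(\<Sum>i\<in>I. pderiv (a i) * ?f k i) = 0" using 0 by simp
      have "(\<Sum>i\<in>I. b i * ?f k i)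
        = a j * (\<Sum>i\<in>I. pderiv (a i) * ?f k i) - pderiv (a j) * (\<Sum>i\<in>I. a i * ?f k i)"
        by (simp add: b_def algebra_simps sum_subtractf sum_distrib_left)
      then have "(\<Sum>i\<in>I. b i * ?f k i) = 0" using 0 1 by simp
      moreover have "b j = 0" by (simp add: b_def mult.commute)
      ultimately show "(\<Sum>i\<in>I-{j}. b i * ?f k i) = 0"
        using j Suc.prems(1) by (simp add: sum.remove[of I j])
    qed (use Suc.prems(1) sub[OF _ j(1)] in auto)
    then have "\<exists>c. a i = smult c (a j)" if "i \<in> I" for i
      using that j pderiv_proportional[of "a i" "a j"]
      by (cases "i = j") (auto simp: b_def mult.commute intro: exI[of _ 1])
    then obtain c where c: "\<And>i. i \<in> I \<Longrightarrow> a i = smult (c i) (a j)" by metis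
    have "a j * (\<Sum>i\<in>I. smult (c i) (f i)) = (\<Sum>i\<in>I. a i * f i)"
      using c by (simp add: sum_distrib_left)
    also have "\<dots> = 0" using Suc.prems(3)[of 0] Suc.hyps(2) by simp
    finally have "(\<Sum>i\<in>I. smult (c i) (f i)) = 0" using j by simp
    then have "c j = 0" using Suc.prems(2) j by blast
    then show False using c[OF j(1)] j by simp
  qed
qed

lemma power_dvd_pderiv:
  fixes f :: "'k::field_char_0 poly"
  assumes "[:- c, 1:] ^ n dvd f" "j < n"
  shows "poly ((pderiv ^^ j) f) c = 0"
  using assms
proof (induction j arbitrary: n f)
  case 0
  then have "[:- c, 1:] dvd f" using dvd_power[of n "[:- c, 1:]"] dvd_trans by blast
  then show ?case by (simp add: poly_eq_0_iff_dvd)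
next
  case (Suc j)
  obtain m where m: "n = Suc m" using Suc.prems(2) by (cases n) auto
  obtain g where g: "f = [:- c, 1:] ^ Suc m * g" using Suc.prems(1) unfolding m by (elim dvdE)
  define p where "p = [:- c, 1:]"
  have "pderiv p = 1" by (simp add: p_def pderiv_pCons one_pCons)
  then have "pderiv f = p ^ m * (p * pderiv g + smult (of_nat (Suc m)) g)"
    unfolding g p_def[symmetric] pderiv_mult pderiv_power_Suc by (simp add: algebra_simps)
  then have "[:- c, 1:] ^ m dvd pderiv f" by (simp add: p_def del: mult_pCons_left mult_pCons_right)
  then have "poly ((pderiv ^^ j) (pderiv f)) c = 0" using Suc m by blast
  then show ?case by (simp add: funpow_swap1)
qed

text \<open>At all points but finitely many, no nonzero element of an \<open>n\<close>-dimensional space of polynomials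
  vanishes to order \<open>n\<close>.\<close>

lemma generic_vanishing_order:
  fixes f :: "'i \<Rightarrow> 'k::field_char_0 poly"
  assumes "finite I" "\<And>c. (\<Sum>i\<in>I. smult (c i) (f i)) = 0 \<Longrightarrow> \<forall>i\<in>I. c i = 0"
  obtains P where "P \<noteq> 0" "\<And>z b. poly P z \<noteq> 0 \<Longrightarrow>
    [:- z, 1:] ^ card I dvd (\<Sum>i\<in>I. smult (b i) (f i)) \<Longrightarrow> \<forall>i\<in>I. b i = 0"
proof -
  define v where "v = (\<lambda>i j. if j < card I then (pderiv ^^ j) (f i) else 0)"
  have "indep_family I (\<lambda>i m. id (v i m))"
    unfolding indep_family_def
  proof (intro allI impI)
    fix a assume a: "\<forall>m. (\<Sum>i\<in>I. a i * id (v i m)) = 0"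
    show "\<forall>i\<in>I. a i = 0"
    proof (rule wronskian_relation[OF assms])
      fix j assume "j < card I"
      then show "(\<Sum>i\<in>I. a i * (pderiv ^^ j) (f i)) = 0"
        using spec[OF a, of j] by (simp add: v_def)
    qed
  qed
  then obtain P :: "'k poly" where P: "id P \<noteq> 0" and ind:
    "\<And>\<phi> :: 'k poly \<Rightarrow> 'k. ring_hom \<phi> \<Longrightarrow> \<phi> P \<noteq> 0 \<Longrightarrow> indep_family I (\<lambda>i m. \<phi> (v i m))"
    using indep_family_open[OF assms(1) ring_hom_id, where v = v and 'k = 'k] by blast
  show thesis
  proof (rule that[of P])
    show "P \<noteq> 0" using P by simp
    fix z b assume z: "poly P z \<noteq> 0" and dvd: "[:- z, 1:] ^ card I dvd (\<Sum>i\<in>I. smult (b i) (f i))"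
    have "ring_hom (\<lambda>p. poly p z)" by (simp add: ring_hom_def)
    note ind = ind[OF this z]
    have pd: "(pderiv ^^ j) (\<Sum>i\<in>I. smult (b i) (f i)) = (\<Sum>i\<in>I. smult (b i) ((pderiv ^^ j) (f i)))" for j
      by (induction j) (simp_all add: pderiv_sum pderiv_smult)
    have "(\<Sum>i\<in>I. b i * poly (v i j) z) = 0" for j
    proof (cases "j < card I")
      case True
      then have "poly (\<Sum>i\<in>I. smult (b i) ((pderiv ^^ j) (f i))) z = 0"
        using power_dvd_pderiv[OF dvd True] by (simp add: pd)
      then show ?thesis using True by (simp add: v_def poly_sum)
    qed (simp add: v_def)
    then show "\<forall>i\<in>I. b i = 0" using ind unfolding indep_family_def by blast
  qed
qed

section \<open>Vector spaces of polynomials\<close>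

text \<open>Scalar multiplication of polynomials.\<close>

abbreviation scale_pol :: "'k::field \<Rightarrow> 'k pol3 \<Rightarrow> 'k pol3" where
  "scale_pol c p \<equiv> Const c * p"

interpretation pol: vec_space "scale_pol :: 'k::field \<Rightarrow> 'k pol3 \<Rightarrow> 'k pol3"
  by unfold_locales (simp_all add: algebra_simps ring_hom_add[OF ring_hom_Const]
      ring_hom_mult[OF ring_hom_Const] ring_hom_1[OF ring_hom_Const])

interpretation upol: vec_space "smult :: 'k::field \<Rightarrow> 'k poly \<Rightarrow> 'k poly"
  by unfold_locales (simp_all add: smult_add_right smult_add_left)

interpretation pol_pol: vec_space_pair
    "scale_pol :: 'k::field \<Rightarrow> 'k pol3 \<Rightarrow> 'k pol3" "scale_pol :: 'k::field \<Rightarrow> 'k pol3 \<Rightarrow> 'k pol3" ..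

interpretation pol_upol: vec_space_pair
    "scale_pol :: 'k::field \<Rightarrow> 'k pol3 \<Rightarrow> 'k pol3" "smult :: 'k::field \<Rightarrow> 'k poly \<Rightarrow> 'k poly" ..

lemma linear_times: "Vector_Spaces.linear scale_pol scale_pol (\<lambda>g. f * (g :: 'k::field pol3))"
  by (simp add: Vector_Spaces.linear_iff pol.vector_space_axioms distrib_left mult.left_commute)

text \<open>The polynomials all of whose monomials have exponents in a given set.\<close>

definition supported :: "(3 \<Rightarrow>\<^sub>0 nat) set \<Rightarrow> 'k::zero pol3 set" where
  "supported A = {f. Poly_Mapping.keys f \<subseteq> A}"

lemma supported_iff: "f \<in> supported A \<longleftrightarrow> (\<forall>m. m \<notin> A \<longrightarrow> Poly_Mapping.lookup f m = 0)"
  by (auto simp: supported_def in_keys_iff)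

lemma supported_mono: "A \<subseteq> B \<Longrightarrow> supported A \<subseteq> supported B"
  by (auto simp: supported_def)

lemma subspace_supported: "pol.subspace (supported A :: 'k::field pol3 set)"
  by (auto simp: pol.subspace_def supported_iff lookup_add lookup_Const_times)

lemma monom_of_supported: "m \<in> A \<Longrightarrow> (monom_of m :: 'k::field pol3) \<in> supported A"
  by (simp add: supported_def)

lemma inj_monom_of: "inj (monom_of :: _ \<Rightarrow> 'k::field pol3)"
  by (rule injI) (metis keys_monom_of singleton_inject)

lemma span_monomials:
  assumes "finite A" shows "pol.span (monom_of ` A) = (supported A :: 'k::field pol3 set)"
proof
  show "pol.span (monom_of ` A) \<subseteq> (supported A :: 'k pol3 set)"
    by (rule pol.span_minimal[OF _ subspace_supported]) (auto intro: monom_of_supported)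
  show "(supported A :: 'k pol3 set) \<subseteq> pol.span (monom_of ` A)"
  proof
    fix f :: "'k pol3" assume "f \<in> supported A"
    then have "f = (\<Sum>m\<in>A. Const (Poly_Mapping.lookup f m) * monom_of m)"
      by (intro mpol_eq_sum assms) (simp add: supported_def)
    also have "\<dots> \<in> pol.span (monom_of ` A)"
      by (intro pol.span_sum pol.span_scale pol.span_base) simp
    finally show "f \<in> pol.span (monom_of ` A)" .
  qed
qed

lemma fin_dim_supported:
  assumes "finite A" shows "pol.fin_dim (supported A :: 'k::field pol3 set)"
  unfolding pol.fin_dim_def using assms span_monomials[OF assms] by (metis finite_imageI order_refl)

lemma dim_supported:
  assumes "finite A" shows "pol.dim (supported A :: 'k::field pol3 set) = card A"
proof -
  have "pol.independent (monom_of ` A :: 'k pol3 set)"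
  proof (rule pol.independent_if_scalars_zero)
    show "finite (monom_of ` A :: 'k pol3 set)" using assms by simp
    fix c :: "'k pol3 \<Rightarrow> 'k" and x :: "'k pol3"
    assume 0: "(\<Sum>x\<in>monom_of ` A. Const (c x) * x) = 0" and "x \<in> monom_of ` A"
    then obtain m where m: "m \<in> A" "x = monom_of m" by blast
    have "0 = (\<Sum>n\<in>A. Const (c (monom_of n)) * monom_of n)"
      using 0 by (simp add: sum.reindex[OF inj_on_subset[OF inj_monom_of subset_UNIV]])
    then have "0 = Poly_Mapping.lookup (\<Sum>n\<in>A. Const (c (monom_of n)) * monom_of n) m"
      by (metis lookup_zero)
    also have "\<dots> = (\<Sum>n\<in>A. if n = m then c (monom_of n) else 0)"
      by (simp add: lookup_sum lookup_Const_times lookup_monom_of when_def if_distrib cong: if_cong)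
    also have "\<dots> = c x" using assms m by simp
    finally show "c x = 0" by simp
  qed
  then have "pol.dim (supported A :: 'k pol3 set) = card (monom_of ` A :: 'k pol3 set)"
    using span_monomials[OF assms] by (metis pol.dim_span_eq_card_independent)
  also have "\<dots> = card A" by (rule card_image) (rule inj_on_subset[OF inj_monom_of], simp)
  finally show ?thesis .
qed

section \<open>Homogeneous components\<close>

text \<open>The exponent of \<open>x\<^sub>1^a x\<^sub>2^b x\<^sub>3^c\<close>.\<close>

definition expo :: "nat \<Rightarrow> nat \<Rightarrow> nat \<Rightarrow> (3 \<Rightarrow>\<^sub>0 nat)" where
  "expo a b c = Poly_Mapping.single 1 a + Poly_Mapping.single 2 b + Poly_Mapping.single 3 c"

lemma distinct_3: "(1::3) \<noteq> 2" "(2::3) \<noteq> 3" "(1::3) \<noteq> 3" "(2::3) \<noteq> 1" "(3::3) \<noteq> 2" "(3::3) \<noteq> 1"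
  by auto

lemma lookup_expo [simp]:
  "Poly_Mapping.lookup (expo a b c) 1 = a"
  "Poly_Mapping.lookup (expo a b c) 2 = b"
  "Poly_Mapping.lookup (expo a b c) 3 = c"
  using distinct_3 by (simp_all add: expo_def lookup_add lookup_single when_def)

lemma exponent_eqI:
  assumes "Poly_Mapping.lookup m 1 = Poly_Mapping.lookup n 1"
    "Poly_Mapping.lookup m 2 = Poly_Mapping.lookup n 2"
    "Poly_Mapping.lookup m 3 = Poly_Mapping.lookup n (3::3)"
  shows "m = n"
  using assms by (intro poly_mapping_eqI) (metis exhaust_3)

lemma expo_lookup: "expo (Poly_Mapping.lookup m 1) (Poly_Mapping.lookup m 2) (Poly_Mapping.lookup m 3) = m"
  by (rule exponent_eqI) simp_all

lemma expo_add: "expo a b c + expo a' b' c' = expo (a + a') (b + b') (c + c')"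
  by (rule exponent_eqI) (simp_all add: lookup_add)

lemma deg_exp_3: "deg_exp m = Poly_Mapping.lookup m 1 + Poly_Mapping.lookup m 2 + Poly_Mapping.lookup m (3::3)"
  by (simp add: deg_exp_def sum_3)

lemma deg_exp_expo [simp]: "deg_exp (expo a b c) = a + b + c"
  by (simp add: deg_exp_3)

lemma deg_exp_add: "deg_exp (m + n) = deg_exp m + deg_exp n"
  by (simp add: deg_exp_def lookup_add sum.distrib)

lemma monom_of_expo: "monom_of (expo a b c) = (Var 1 ^ a * Var 2 ^ b * Var 3 ^ c :: 'k::comm_ring_1 pol3)"
  unfolding eval_monom_Var[symmetric] eval_monom_def UNIV_3 by (simp add: mult.assoc)

lemma forms_eq_supported: "forms t = (supported {m. deg_exp m = t} :: 'k::zero pol3 set)"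
  by (auto simp: forms_def supported_def)

lemma finite_deg_exp: "finite {m :: 3 \<Rightarrow>\<^sub>0 nat. deg_exp m = t}"
proof (rule finite_subset)
  show "{m. deg_exp m = t} \<subseteq> (\<lambda>(a, b, c). expo a b c) ` ({..t} \<times> {..t} \<times> {..t})"
  proof
    fix m :: "3 \<Rightarrow>\<^sub>0 nat" assume "m \<in> {m. deg_exp m = t}"
    then have "m = (\<lambda>(a, b, c). expo a b c)
        (Poly_Mapping.lookup m 1, Poly_Mapping.lookup m 2, Poly_Mapping.lookup m 3)"
      "Poly_Mapping.lookup m 1 \<le> t" "Poly_Mapping.lookup m 2 \<le> t" "Poly_Mapping.lookup m 3 \<le> t"
      by (auto simp: expo_lookup deg_exp_3)
    then show "m \<in> (\<lambda>(a, b, c). expo a b c) ` ({..t} \<times> {..t} \<times> {..t})" by blast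
  qed
qed simp

lemma fin_dim_forms: "pol.fin_dim (forms t :: 'k::field pol3 set)"
  unfolding forms_eq_supported by (rule fin_dim_supported[OF finite_deg_exp])

lemma subspace_forms: "pol.subspace (forms t :: 'k::field pol3 set)"
  unfolding forms_eq_supported by (rule subspace_supported)

text \<open>Exponents of degree \<open>t + 1\<close> either are divisible by \<open>x\<^sub>3\<close> or are one of \<open>t + 2\<close> exponents in the
  first two variables.\<close>

lemma card_deg_exp: "2 * card {m :: 3 \<Rightarrow>\<^sub>0 nat. deg_exp m = t} = (t + 1) * (t + 2)"
proof (induction t)
  case 0
  have "{m :: 3 \<Rightarrow>\<^sub>0 nat. deg_exp m = 0} = {expo 0 0 0}"
    by (auto simp: deg_exp_3 intro: exponent_eqI)
  then show ?case by simp
next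
  case (Suc t)
  let ?f = "\<lambda>m. m + expo 0 0 1" and ?g = "\<lambda>a. expo a (Suc t - a) 0"
  have split: "{m. deg_exp m = Suc t} = ?f ` {m. deg_exp m = t} \<union> ?g ` {..Suc t}"
  proof (intro equalityI subsetI)
    fix m :: "3 \<Rightarrow>\<^sub>0 nat" assume m: "m \<in> {m. deg_exp m = Suc t}"
    obtain a b c where abc: "m = expo a b c" using expo_lookup[of m] by metis
    show "m \<in> ?f ` {m. deg_exp m = t} \<union> ?g ` {..Suc t}"
    proof (cases c)
      case 0
      then have "b = Suc t - a" "a \<le> Suc t" using m abc by auto
      then have "m = ?g a" "a \<le> Suc t" using 0 abc by auto
      then show ?thesis by blast
    next
      case (Suc c')
      then have "m = ?f (expo a b c')" "deg_exp (expo a b c') = t" using m abc by (auto simp: expo_add)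
      then show ?thesis by blast
    qed
  qed (auto simp: deg_exp_add)
  have inj: "inj_on ?f {m. deg_exp m = t}" "inj_on ?g {..Suc t}"
    by (auto simp: inj_on_def dest: arg_cong[of _ _ "\<lambda>m. Poly_Mapping.lookup m 1"])
  have "?f m \<noteq> ?g a" for m a
  proof
    assume "?f m = ?g a"
    from arg_cong[OF this, of "\<lambda>m. Poly_Mapping.lookup m 3"] show False by (simp add: lookup_add)
  qed
  then have disj: "?f ` {m. deg_exp m = t} \<inter> ?g ` {..Suc t} = {}" by blast
  have "card {m :: 3 \<Rightarrow>\<^sub>0 nat. deg_exp m = Suc t} = card {m :: 3 \<Rightarrow>\<^sub>0 nat. deg_exp m = t} + (t + 2)"
    unfolding split by (subst card_Un_disjoint[OF _ _ disj]) (simp_all add: finite_deg_exp card_image inj)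
  then show ?case using Suc by (simp add: algebra_simps)
qed

lemma dim_forms: "2 * pol.dim (forms t :: 'k::field pol3 set) = (t + 1) * (t + 2)"
  unfolding forms_eq_supported dim_supported[OF finite_deg_exp] by (rule card_deg_exp)

lemma forms_add: "f \<in> forms d \<Longrightarrow> g \<in> forms d \<Longrightarrow> f + g \<in> (forms d :: 'k::field pol3 set)"
  by (rule pol.subspace_add[OF subspace_forms])

lemma forms_0: "0 \<in> (forms d :: 'k::field pol3 set)"
  by (rule pol.subspace_0[OF subspace_forms])

lemma forms_diff: "f \<in> forms d \<Longrightarrow> g \<in> forms d \<Longrightarrow> f - g \<in> (forms d :: 'k::field pol3 set)"
  by (rule pol.subspace_diff[OF subspace_forms])

lemma forms_sum: "(\<And>i. i \<in> A \<Longrightarrow> f i \<in> forms d) \<Longrightarrow> sum f A \<in> (forms d :: 'k::field pol3 set)"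
  by (rule pol.subspace_sum[OF subspace_forms])

lemma forms_mult:
  assumes "f \<in> forms d" "g \<in> forms e" shows "f * g \<in> (forms (d + e) :: 'k::field pol3 set)"
proof -
  have "deg_exp m = d + e" if m: "m \<in> Poly_Mapping.keys (f * g)" for m
  proof -
    obtain a b where "m = a + b" "a \<in> Poly_Mapping.keys f" "b \<in> Poly_Mapping.keys g"
      using subsetD[OF keys_mult m] by blast
    then show ?thesis using assms by (simp add: forms_def deg_exp_add)
  qed
  then show ?thesis by (simp add: forms_def)
qed

lemma monom_of_forms: "monom_of m \<in> (forms t :: 'k::field pol3 set) \<longleftrightarrow> deg_exp m = t"
  by (simp add: forms_def)

lemma forms_power: "f \<in> forms d \<Longrightarrow> f ^ n \<in> (forms (d * n) :: 'k::field pol3 set)"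
proof (induction n)
  case 0
  then show ?case by (simp add: forms_def deg_exp_def)
next
  case (Suc n)
  then show ?case using forms_mult[of f d "f ^ n" "d * n"] by simp
qed

lemma Const_forms: "Const c \<in> (forms 0 :: 'k::field pol3 set)"
  by (auto simp: forms_def Const_def deg_exp_def split: if_splits)

lemma Var_forms: "Var i \<in> (forms 1 :: 'k::field pol3 set)"
  by (simp add: Var_def monom_of_forms deg_exp_def lookup_single when_def)

text \<open>The homogeneous component of degree \<open>d\<close> of a polynomial.\<close>

definition hcomp :: "nat \<Rightarrow> 'k::zero pol3 \<Rightarrow> 'k pol3" where
  "hcomp d = Poly_Mapping.mapp (\<lambda>m c. c when deg_exp m = d)"

lemma lookup_hcomp: "Poly_Mapping.lookup (hcomp d f) m = (Poly_Mapping.lookup f m when deg_exp m = d)"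
  by (auto simp: hcomp_def lookup_mapp when_def in_keys_iff)

lemma hcomp_forms: "hcomp d f \<in> forms d"
  by (auto simp: forms_def in_keys_iff lookup_hcomp)

lemma hcomp_add: "hcomp d (f + g) = hcomp d f + (hcomp d g :: 'k::field pol3)"
  by (rule poly_mapping_eqI) (simp add: lookup_hcomp lookup_add when_def)

lemma hcomp_0: "hcomp d 0 = (0 :: 'k::field pol3)"
  by (rule poly_mapping_eqI) (simp add: lookup_hcomp)

lemma hcomp_sum: "hcomp d (sum f A) = (\<Sum>a\<in>A. hcomp d (f a) :: 'k::field pol3)"
  by (induction A rule: infinite_finite_induct) (simp_all add: hcomp_0 hcomp_add)

lemma hcomp_of_form:
  assumes "f \<in> forms e" shows "hcomp d f = (if d = e then f else (0 :: 'k::field pol3))"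
  using assms by (intro poly_mapping_eqI) (auto simp: lookup_hcomp forms_def in_keys_iff when_def)

lemma hcomp_mult_form:
  assumes f: "f \<in> forms e"
  shows "hcomp d (g * f) = (if e \<le> d then hcomp (d - e) g * f else (0 :: 'k::field pol3))"
proof -
  let ?t = "\<lambda>m. Const (Poly_Mapping.lookup g m) * monom_of m :: 'k pol3"
  have t: "?t m \<in> forms (deg_exp m)" for m
    using forms_mult[OF Const_forms, of "monom_of m" "deg_exp m"] by (simp add: monom_of_forms)
  have g: "g = (\<Sum>m\<in>Poly_Mapping.keys g. ?t m)" by (rule mpol_eq_sum) simp_all
  have 1: "hcomp d (?t m * f) = (if e \<le> d then hcomp (d - e) (?t m) * f else 0)" for m
    using hcomp_of_form[OF forms_mult[OF t f], of d m] hcomp_of_form[OF t, of "d - e" m] by auto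
  have "hcomp d (g * f) = (\<Sum>m\<in>Poly_Mapping.keys g. hcomp d (?t m * f))"
    by (subst g) (simp only: sum_distrib_right hcomp_sum)
  also have "\<dots> = (if e \<le> d then hcomp (d - e) (\<Sum>m\<in>Poly_Mapping.keys g. ?t m) * f else 0)"
    by (simp only: 1 hcomp_sum sum_distrib_right) simp
  finally show ?thesis using g by simp
qed

section \<open>Graded ideals and Hilbert functions\<close>

text \<open>Ideals closed under taking homogeneous components, that is, homogeneous ideals; the whole ring
  is included.\<close>

definition graded_ideal :: "'k::field pol3 set \<Rightarrow> bool" where
  "graded_ideal I \<longleftrightarrow> 0 \<in> I \<and> (\<forall>f\<in>I. \<forall>g\<in>I. f + g \<in> I) \<and> (\<forall>f\<in>I. \<forall>g. g * f \<in> I) \<and>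
     (\<forall>f\<in>I. \<forall>d. hcomp d f \<in> I)"

lemma graded_ideal_0: "graded_ideal I \<Longrightarrow> 0 \<in> I"
  and graded_ideal_add: "graded_ideal I \<Longrightarrow> f \<in> I \<Longrightarrow> g \<in> I \<Longrightarrow> f + g \<in> I"
  and graded_ideal_mult: "graded_ideal I \<Longrightarrow> f \<in> I \<Longrightarrow> g * f \<in> I"
  and graded_ideal_hcomp: "graded_ideal I \<Longrightarrow> f \<in> I \<Longrightarrow> hcomp d f \<in> I"
  by (auto simp: graded_ideal_def)

lemma graded_ideal_diff: "graded_ideal I \<Longrightarrow> f \<in> I \<Longrightarrow> g \<in> I \<Longrightarrow> f - g \<in> I"
  using graded_ideal_add[of I f "-1 * g"] graded_ideal_mult[of I g "-1"] by simp

lemma graded_ideal_sum: "graded_ideal I \<Longrightarrow> (\<And>i. i \<in> A \<Longrightarrow> f i \<in> I) \<Longrightarrow> sum f A \<in> I"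
  by (induction A rule: infinite_finite_induct) (auto simp: graded_ideal_0 graded_ideal_add)

lemma subspace_graded_ideal: "graded_ideal I \<Longrightarrow> pol.subspace I"
  by (simp add: pol.subspace_def graded_ideal_0 graded_ideal_add graded_ideal_mult)

lemma subspace_graded_part: "graded_ideal I \<Longrightarrow> pol.subspace (I \<inter> forms t)"
  by (intro pol.subspace_inter subspace_graded_ideal subspace_forms)

lemma fin_dim_graded_part: "pol.fin_dim (I \<inter> forms t :: 'k::field pol3 set)"
  by (rule pol.fin_dim_subset[OF fin_dim_forms]) auto

text \<open>The Hilbert function of \<open>S/I\<close>, extended by \<open>0\<close> to negative degrees.\<close>

definition hilbert :: "'k::field pol3 set \<Rightarrow> int \<Rightarrow> int" where
  "hilbert I t = (if t < 0 then 0
     else int (pol.dim (forms (nat t) :: 'k pol3 set)) - int (pol.dim (I \<inter> forms (nat t))))"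

text \<open>Adding a form of degree \<open>d\<close> that is a nonzerodivisor modulo \<open>I\<close>: in degree \<open>t\<close>, the new ideal is
  the sum of \<open>I\<close> and the multiples of \<open>f\<close>, and these two intersect in \<open>f\<close> times \<open>I\<close>.\<close>

lemma hilbert_add_form:
  assumes I: "graded_ideal I" and f: "f \<in> forms d" and f0: "f \<noteq> 0"
    and reg: "\<And>g. g * f \<in> I \<Longrightarrow> g \<in> I"
    and I': "I' = {x. \<exists>g. x - g * f \<in> I}"
  shows "graded_ideal I'" and "hilbert I' t = hilbert I t - hilbert I (t - int d)"
proof -
  have hc: "hcomp e x - (if d \<le> e then hcomp (e - d) g * f else 0) \<in> I" if "x - g * f \<in> I" for x g e
  proof -
    have "hcomp e x = hcomp e (x - g * f) + hcomp e (g * f)" by (simp flip: hcomp_add)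
    then show ?thesis
      using graded_ideal_hcomp[OF I that, of e] by (simp add: hcomp_mult_form[OF f])
  qed
  show gr: "graded_ideal I'"
    unfolding graded_ideal_def
  proof (intro conjI ballI allI)
    show "0 \<in> I'" unfolding I' using graded_ideal_0[OF I] by (auto intro: exI[of _ 0])
    fix x assume "x \<in> I'"
    then obtain g where g: "x - g * f \<in> I" unfolding I' by blast
    show "hcomp e x \<in> I'" for e
      unfolding I' using hc[OF g, of e] by (auto intro: exI[of _ 0] split: if_splits)
    show "c * x \<in> I'" for c
      using graded_ideal_mult[OF I g, of c] unfolding I'
      by (auto intro!: exI[of _ "c * g"] simp: algebra_simps)
    fix y assume "y \<in> I'"
    then obtain h where h: "y - h * f \<in> I" unfolding I' by blast
    show "x + y \<in> I'"
      using graded_ideal_add[OF I g h] unfolding I' by (auto intro!: exI[of _ "g + h"] simp: algebra_simps)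
  qed
  have II': "x \<in> I'" if "x \<in> I" for x unfolding I' using that by (auto intro!: exI[of _ 0])
  show "hilbert I' t = hilbert I t - hilbert I (t - int d)"
  proof (cases "t < 0")
    case True
    then show ?thesis by (simp add: hilbert_def)
  next
    case False
    define n where "n = nat t"
    have t: "t = int n" using False by (simp add: n_def)
    show ?thesis
    proof (cases "d \<le> n")
      case False
      have "I' \<inter> forms n = I \<inter> forms n"
      proof (intro equalityI subsetI)
        fix x assume x: "x \<in> I' \<inter> forms n"
        then obtain g where "x - g * f \<in> I" unfolding I' by blast
        from hc[OF this, of n] False hcomp_of_form[of x n n] x show "x \<in> I \<inter> forms n" by simp
      qed (auto intro: II')
      then show ?thesis using False t by (simp add: hilbert_def)
    next
      case True
      let ?F = "(\<lambda>g. f * g) ` (forms (n - d))"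
      have sum: "I' \<inter> forms n = {x + y | x y. x \<in> I \<inter> forms n \<and> y \<in> ?F}"
      proof (intro equalityI subsetI)
        fix x assume x: "x \<in> I' \<inter> forms n"
        then obtain g where "x - g * f \<in> I" unfolding I' by blast
        from hc[OF this, of n] True hcomp_of_form[of x n n] x
        have "x - f * hcomp (n - d) g \<in> I" by (simp add: mult.commute)
        moreover have fg: "f * hcomp (n - d) g \<in> forms n"
          using forms_mult[OF f hcomp_forms[of "n - d" g]] True by simp
        ultimately have "x - f * hcomp (n - d) g \<in> I \<inter> forms n" using x forms_diff by blast
        moreover have "x = (x - f * hcomp (n - d) g) + f * hcomp (n - d) g" by simp
        ultimately show "x \<in> {x + y | x y. x \<in> I \<inter> forms n \<and> y \<in> ?F}"
          using hcomp_forms[of "n - d" g] by blast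
      next
        fix z assume "z \<in> {x + y | x y. x \<in> I \<inter> forms n \<and> y \<in> ?F}"
        then obtain x g where xg: "z = x + f * g" "x \<in> I" "x \<in> forms n" "g \<in> forms (n - d)" by blast
        then have "z - g * f \<in> I" by (simp add: mult.commute)
        then have "z \<in> I'" unfolding I' by blast
        moreover have "f * g \<in> forms n" using forms_mult[OF f xg(4)] True by simp
        ultimately show "z \<in> I' \<inter> forms n" using xg forms_add by simp
      qed
      have int: "(I \<inter> forms n) \<inter> ?F = (\<lambda>g. f * g) ` (I \<inter> forms (n - d))"
      proof (intro equalityI subsetI)
        fix x assume "x \<in> (I \<inter> forms n) \<inter> ?F"
        then show "x \<in> (\<lambda>g. f * g) ` (I \<inter> forms (n - d))" using reg by (auto simp: mult.commute)
      next
        fix x assume "x \<in> (\<lambda>g. f * g) ` (I \<inter> forms (n - d))"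
        then obtain g where "x = f * g" "g \<in> I" "g \<in> forms (n - d)" by blast
        moreover from this have "x \<in> forms n" using forms_mult[OF f] True by force
        ultimately show "x \<in> (I \<inter> forms n) \<inter> ?F" using graded_ideal_mult[OF I, of g f] by blast
      qed
      have inj: "v = 0" if "f * v = 0" for v using that f0 by simp
      have "pol.dim (I' \<inter> forms n) + pol.dim ((\<lambda>g. f * g) ` (I \<inter> forms (n - d)))
        = pol.dim (I \<inter> forms n) + pol.dim ?F"
        unfolding sum int[symmetric]
        by (intro pol.dim_sum_Int subspace_graded_part I fin_dim_graded_part
            pol_pol.linear_subspace_image[OF linear_times] subspace_forms
            pol_pol.fin_dim_image[OF linear_times] fin_dim_forms)
      moreover have "pol.dim ?F = pol.dim (forms (n - d) :: 'a pol3 set)"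
        by (rule pol_pol.dim_image_inj[OF linear_times fin_dim_forms subspace_forms inj])
      moreover have "pol.dim ((\<lambda>g. f * g) ` (I \<inter> forms (n - d))) = pol.dim (I \<inter> forms (n - d))"
        by (rule pol_pol.dim_image_inj[OF linear_times fin_dim_graded_part subspace_graded_part[OF I] inj])
      moreover have "nat (t - int d) = n - d" "\<not> t - int d < 0" "nat t = n" using t True by auto
      ultimately show ?thesis by (simp add: hilbert_def t)
    qed
  qed
qed

section \<open>Changes of coordinates\<close>

lemma linear_lin_subst: "Vector_Spaces.linear scale_pol scale_pol (lin_subst (A :: 'k::field ^ 3 ^ 3))"
  by (simp add: Vector_Spaces.linear_iff pol.vector_space_axioms ring_hom_add[OF ring_hom_lin_subst]
      ring_hom_mult[OF ring_hom_lin_subst] lin_subst_Const)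

lemma lin_form_forms: "lin_form A j \<in> (forms 1 :: 'k::field pol3 set)"
  unfolding lin_form_def using forms_mult[OF Const_forms Var_forms] by (intro forms_sum) simp

lemma lin_subst_monom_of_forms:
  "lin_subst A (Const c * monom_of m) \<in> (forms (deg_exp m) :: 'k::field pol3 set)"
proof -
  have "lin_form A j ^ n \<in> (forms n :: 'k pol3 set)" for j n
    using forms_power[OF lin_form_forms, of A j n] by simp
  then have "Const c * (lin_form A 1 ^ Poly_Mapping.lookup m 1 * lin_form A 2 ^ Poly_Mapping.lookup m 2
      * lin_form A 3 ^ Poly_Mapping.lookup m 3)
    \<in> forms (0 + (Poly_Mapping.lookup m 1 + Poly_Mapping.lookup m 2 + Poly_Mapping.lookup m 3))"
    by (intro forms_mult Const_forms)
  moreover have "lin_subst A (Const c * monom_of m) = Const c * (lin_form A 1 ^ Poly_Mapping.lookup m 1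
      * lin_form A 2 ^ Poly_Mapping.lookup m 2 * lin_form A 3 ^ Poly_Mapping.lookup m 3)"
    unfolding ring_hom_mult[OF ring_hom_lin_subst] lin_subst_Const
    unfolding lin_subst_eq eval_poly_monom_of[OF ring_hom_Const] eval_monom_def UNIV_3
    by (simp add: mult.assoc)
  ultimately show ?thesis by (simp add: deg_exp_3)
qed

lemma lin_subst_sum_monomials:
  "lin_subst A f = (\<Sum>m\<in>Poly_Mapping.keys f. lin_subst A (Const (Poly_Mapping.lookup f m) * monom_of m))"
  using arg_cong[OF mpol_eq_sum[of "Poly_Mapping.keys f" f], of "lin_subst A"]
  by (simp add: ring_hom_sum[OF ring_hom_lin_subst])

lemma lin_subst_forms:
  assumes "f \<in> forms t" shows "lin_subst A f \<in> (forms t :: 'k::field pol3 set)"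
proof -
  have "lin_subst A (Const (Poly_Mapping.lookup f m) * monom_of m) \<in> forms t"
    if "m \<in> Poly_Mapping.keys f" for m
    using lin_subst_monom_of_forms[of A _ m] that assms by (auto simp: forms_def[of t])
  then show ?thesis unfolding lin_subst_sum_monomials[of A f] by (rule forms_sum)
qed

lemma hcomp_lin_subst: "hcomp d (lin_subst A f) = lin_subst A (hcomp d f :: 'k::field pol3)"
proof -
  let ?t = "\<lambda>m. Const (Poly_Mapping.lookup f m) * monom_of m :: 'k pol3"
  have t: "?t m \<in> forms (deg_exp m)" for m
    using forms_mult[OF Const_forms, of "monom_of m" "deg_exp m"] by (simp add: monom_of_forms)
  have 1: "hcomp d (lin_subst A (?t m)) = lin_subst A (hcomp d (?t m))" for m
    using hcomp_of_form[OF lin_subst_monom_of_forms, of d A "Poly_Mapping.lookup f m" m]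
      hcomp_of_form[OF t, of d m] ring_hom_0[OF ring_hom_lin_subst, of A] by simp
  have "hcomp d (lin_subst A f) = lin_subst A (hcomp d (\<Sum>m\<in>Poly_Mapping.keys f. ?t m))"
    unfolding lin_subst_sum_monomials[of A f] hcomp_sum 1
    by (simp only: ring_hom_sum[OF ring_hom_lin_subst])
  then show ?thesis using mpol_eq_sum[of "Poly_Mapping.keys f" f] by simp
qed

lemma lin_subst_inverse:
  fixes A :: "'k::field ^ 3 ^ 3"
  assumes "invertible A"
  obtains B where "invertible B" "\<And>f. lin_subst A (lin_subst B f) = f" "\<And>f. lin_subst B (lin_subst A f) = f"
proof -
  obtain B where "A ** B = mat 1" "B ** A = mat 1" using assms unfolding invertible_def by blast
  then show thesis using that[of B] by (auto simp: lin_subst_lin_subst lin_subst_mat_1 invertible_def)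
qed

lemma lin_subst_graded_part:
  fixes A :: "'k::field ^ 3 ^ 3"
  assumes "invertible A"
  shows "lin_subst A ` I \<inter> forms t = lin_subst A ` (I \<inter> forms t)"
proof
  obtain B where B: "\<And>f. lin_subst B (lin_subst A f) = f" using lin_subst_inverse[OF assms] by metis
  show "lin_subst A ` I \<inter> forms t \<subseteq> lin_subst A ` (I \<inter> forms t)"
    using lin_subst_forms[of _ t B] B by force
qed (auto intro: lin_subst_forms)

lemma graded_ideal_lin_subst:
  fixes A :: "'k::field ^ 3 ^ 3"
  assumes "invertible A" and I: "graded_ideal I"
  shows "graded_ideal (lin_subst A ` I)"
proof -
  obtain B where B: "\<And>f. lin_subst A (lin_subst B f) = f" using lin_subst_inverse[OF assms(1)] by metis
  note h = ring_hom_lin_subst[of A]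
  have "g * lin_subst A f \<in> lin_subst A ` I" if "f \<in> I" for g f
  proof -
    have "g * lin_subst A f = lin_subst A (lin_subst B g * f)" by (simp add: ring_hom_mult[OF h] B)
    then show ?thesis using graded_ideal_mult[OF I that] by blast
  qed
  moreover have "lin_subst A f + lin_subst A g \<in> lin_subst A ` I" if "f \<in> I" "g \<in> I" for f g
    using graded_ideal_add[OF I that] by (metis ring_hom_add[OF h] imageI)
  moreover have "0 \<in> lin_subst A ` I"
    using graded_ideal_0[OF I] ring_hom_0[OF h] by (metis imageI)
  moreover have "hcomp d (lin_subst A f) \<in> lin_subst A ` I" if "f \<in> I" for f d
    using graded_ideal_hcomp[OF I that] by (simp add: hcomp_lin_subst)
  ultimately show ?thesis unfolding graded_ideal_def by blast
qed

lemma hilbert_lin_subst: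
  fixes A :: "'k::field ^ 3 ^ 3"
  assumes "invertible A" and I: "graded_ideal I"
  shows "hilbert (lin_subst A ` I) t = hilbert I t"
proof -
  obtain B where B: "\<And>f. lin_subst B (lin_subst A f) = f" using lin_subst_inverse[OF assms(1)] by metis
  have inj: "v = 0" if "lin_subst A v = 0" for v
    using B[of v] that ring_hom_0[OF ring_hom_lin_subst, of B] by simp
  have "pol.dim (lin_subst A ` (I \<inter> forms n)) = pol.dim (I \<inter> forms n)" for n
    by (rule pol_pol.dim_image_inj[OF linear_lin_subst fin_dim_graded_part subspace_graded_part[OF I] inj])
  then show ?thesis by (simp add: hilbert_def lin_subst_graded_part[OF assms(1)])
qed

section \<open>Complete intersections\<close>

text \<open>Twice the Hilbert function of \<open>S\<close>.\<close>

definition ring_hilbert2 :: "int \<Rightarrow> int" where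
  "ring_hilbert2 t = (if t < 0 then 0 else (t + 1) * (t + 2))"

text \<open>Twice the Hilbert function of a complete intersection of degrees \<open>a\<close>, \<open>b\<close>, \<open>c\<close> in three
  variables. The factor \<open>2\<close> keeps the binomial coefficients integral polynomials in \<open>t\<close>.\<close>

definition ci_hilbert2 :: "int \<Rightarrow> int \<Rightarrow> int \<Rightarrow> int \<Rightarrow> int" where
  "ci_hilbert2 a b c t = ring_hilbert2 t - ring_hilbert2 (t - a) - ring_hilbert2 (t - b)
     - ring_hilbert2 (t - c) + ring_hilbert2 (t - a - b) + ring_hilbert2 (t - a - c)
     + ring_hilbert2 (t - b - c) - ring_hilbert2 (t - a - b - c)"

lemma ideal_gen_insert: "ideal_gen (insert f B) = {x. \<exists>g. x - g * f \<in> ideal_gen B}"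
  unfolding ideal_gen_def by (rule module.span_insert[OF module_times])

lemma graded_ideal_zero: "graded_ideal {0 :: 'k::field pol3}"
  by (simp add: graded_ideal_def hcomp_0)

lemma hilbert_zero: "2 * hilbert {0 :: 'k::field pol3} t = ring_hilbert2 t"
proof (cases "t < 0")
  case False
  have "{0} \<inter> forms n = {0 :: 'k pol3}" for n using forms_0 by blast
  moreover have "pol.dim {0 :: 'k pol3} = 0" using pol.dim_le_card[of "{0 :: 'k pol3}" "{}"] by simp
  moreover have "2 * int (pol.dim (forms (nat t) :: 'k pol3 set)) = (t + 1) * (t + 2)"
    using arg_cong[OF dim_forms[of "nat t", where 'k='k], of int] False
    unfolding of_nat_mult of_nat_add of_nat_numeral of_nat_1 by (simp only: int_nat_eq) simp
  ultimately have "2 * hilbert {0 :: 'k pol3} t = (t + 1) * (t + 2)" using False by (simp add: hilbert_def)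
  then show ?thesis using False by (simp only: ring_hilbert2_def if_False)
qed (simp add: hilbert_def ring_hilbert2_def)

lemma hilbert_complete_intersection:
  fixes f1 f2 f3 :: "'k::field pol3"
  assumes f: "f1 \<in> forms d1" "f2 \<in> forms d2" "f3 \<in> forms d3" and reg: "regular_sequence [f1, f2, f3]"
  shows "graded_ideal (ideal_gen {f1, f2, f3})"
    and "2 * hilbert (ideal_gen {f1, f2, f3}) t = ci_hilbert2 (int d1) (int d2) (int d3) t"
proof -
  interpret module "(*) :: 'k pol3 \<Rightarrow> 'k pol3 \<Rightarrow> 'k pol3" by (rule module_times)
  have I0: "ideal_gen {} = {0 :: 'k pol3}" by (simp add: ideal_gen_def)
  have reg': "g * [f1, f2, f3] ! i \<in> ideal_gen (set (take i [f1, f2, f3])) \<Longrightarrow>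
      g \<in> ideal_gen (set (take i [f1, f2, f3]))" if "i < 3" for i g
    using reg that by (auto simp: regular_sequence_def)
  have r1: "g * f1 \<in> {0} \<Longrightarrow> g \<in> {0}" for g using reg'[of 0 g] I0 by simp
  have r2: "g * f2 \<in> ideal_gen {f1} \<Longrightarrow> g \<in> ideal_gen {f1}" for g using reg'[of 1 g] by simp
  have r3: "g * f3 \<in> ideal_gen {f2, f1} \<Longrightarrow> g \<in> ideal_gen {f2, f1}" for g
    using reg'[of 2 g] by (simp add: numeral_2_eq_2 insert_commute)
  have proper: "B \<subseteq> {f1, f2, f3} \<Longrightarrow> 1 \<notin> ideal_gen B" for B
  proof
    assume "B \<subseteq> {f1, f2, f3}" and "1 \<in> ideal_gen B"
    then have "1 \<in> ideal_gen {f1, f2, f3}" unfolding ideal_gen_def using span_mono by blast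
    then have "x * 1 \<in> ideal_gen {f1, f2, f3}" for x unfolding ideal_gen_def by (rule span_scale)
    then show False using reg by (auto simp: regular_sequence_def)
  qed
  have ne: "f1 \<noteq> 0" "f2 \<noteq> 0" "f3 \<noteq> 0"
    using r1[of 1] r2[of 1] r3[of 1] proper[of "{f1}"] proper[of "{f2, f1}"]
    by (auto simp: ideal_gen_def span_zero)
  have s1: "ideal_gen {f1} = {x. \<exists>g. x - g * f1 \<in> {0}}"
    using ideal_gen_insert[of f1 "{}"] I0 by simp
  note h1 = hilbert_add_form[OF graded_ideal_zero f(1) ne(1) r1 s1]
  note h2 = hilbert_add_form[OF h1(1) f(2) ne(2) r2 ideal_gen_insert]
  note h3 = hilbert_add_form[OF h2(1) f(3) ne(3) r3 ideal_gen_insert]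
  have e1: "hilbert (ideal_gen {f1}) t = hilbert {0 :: 'k pol3} t - hilbert {0 :: 'k pol3} (t - int d1)" for t
    by (rule h1(2))
  have e2: "hilbert (ideal_gen {f2, f1}) t = hilbert (ideal_gen {f1}) t - hilbert (ideal_gen {f1}) (t - int d2)" for t
    by (rule h2(2))
  have e3: "hilbert (ideal_gen {f3, f2, f1}) t
    = hilbert (ideal_gen {f2, f1}) t - hilbert (ideal_gen {f2, f1}) (t - int d3)"
    by (rule h3(2))
  have d: "t - int d2 - int d1 = t - int d1 - int d2" "t - int d3 - int d1 = t - int d1 - int d3"
    "t - int d3 - int d2 = t - int d2 - int d3" "t - int d3 - int d2 - int d1 = t - int d1 - int d2 - int d3"
    "t - int d2 - int d3 - int d1 = t - int d1 - int d2 - int d3"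
    by simp_all
  have "{f3, f2, f1} = {f1, f2, f3}" by auto
  then show "graded_ideal (ideal_gen {f1, f2, f3})"
    "2 * hilbert (ideal_gen {f1, f2, f3}) t = ci_hilbert2 (int d1) (int d2) (int d3) t"
    using h3(1) e3 unfolding e2 e1 d by (simp_all add: ci_hilbert2_def flip: hilbert_zero[where 'k='k])
qed

text \<open>The Hilbert function of \<open>K[x\<^sub>1, x\<^sub>2]\<close> modulo a regular sequence of degrees \<open>a\<close> and \<open>b\<close>.\<close>

definition ci_hilbert_plane :: "int \<Rightarrow> int \<Rightarrow> int \<Rightarrow> int" where
  "ci_hilbert_plane a b t = max 0 (min (t + 1) (min a (min b (a + b - 1 - t))))"

text \<open>This reflects that the polynomial \<open>(t + 1) (t + 2)\<close> is invariant under \<open>t \<mapsto> - 3 - t\<close> and killed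
  by third differences.\<close>

lemma ci_hilbert2_symmetric: "ci_hilbert2 a b c (a + b + c - 3 - t) = ci_hilbert2 a b c t"
proof -
  have r: "ring_hilbert2 t = (t + 1) * (t + 2) - ring_hilbert2 (- 3 - t)" for t
  proof -
    consider "t \<le> - 3" | "t = - 2" | "t = - 1" | "t \<ge> 0" by linarith
    then show ?thesis by cases (auto simp: ring_hilbert2_def algebra_simps)
  qed
  let ?r = ring_hilbert2
  have e: "- 3 - t = a + b + c - 3 - t - a - b - c"
    "- 3 - (t - a) = a + b + c - 3 - t - b - c" "- 3 - (t - b) = a + b + c - 3 - t - a - c"
    "- 3 - (t - c) = a + b + c - 3 - t - a - b" "- 3 - (t - a - b) = a + b + c - 3 - t - c"
    "- 3 - (t - a - c) = a + b + c - 3 - t - b" "- 3 - (t - b - c) = a + b + c - 3 - t - a"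
    "- 3 - (t - a - b - c) = a + b + c - 3 - t"
    by simp_all
  have "ci_hilbert2 a b c t = ci_hilbert2 a b c (a + b + c - 3 - t)"
    unfolding ci_hilbert2_def[of a b c t] r[of t] r[of "t - a"] r[of "t - b"] r[of "t - c"] r[of "t - a - b"]
      r[of "t - a - c"] r[of "t - b - c"] r[of "t - a - b - c"] e
    unfolding ci_hilbert2_def by (simp add: algebra_simps)
  then show ?thesis ..
qed

lemma ci_hilbert2_negative: "a \<ge> 0 \<Longrightarrow> b \<ge> 0 \<Longrightarrow> c \<ge> 0 \<Longrightarrow> t < 0 \<Longrightarrow> ci_hilbert2 a b c t = 0"
  by (simp add: ci_hilbert2_def ring_hilbert2_def)

text \<open>Below degree \<open>c\<close> the third form does not contribute, and taking differences removes one variable.\<close>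

lemma ci_hilbert2_diff:
  assumes "0 \<le> a" "a \<le> b" "t < c"
  shows "ci_hilbert2 a b c t - ci_hilbert2 a b c (t - 1) = 2 * ci_hilbert_plane a b t"
proof -
  have d: "ring_hilbert2 t - ring_hilbert2 (t - 1) = 2 * max 0 (t + 1)" for t
  proof -
    consider "t < 0" | "t = 0" | "t > 0" by linarith
    then show ?thesis by cases (auto simp: ring_hilbert2_def algebra_simps)
  qed
  have e: "t - 1 - a = t - a - 1" "t - 1 - b = t - b - 1" "t - 1 - c = t - c - 1"
    "t - a - 1 - b = t - a - b - 1" "t - a - 1 - c = t - a - c - 1" "t - b - 1 - c = t - b - c - 1"
    "t - a - b - 1 - c = t - a - b - c - 1"
    by simp_all
  have "ci_hilbert2 a b c t - ci_hilbert2 a b c (t - 1)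
    = (ring_hilbert2 t - ring_hilbert2 (t - 1)) - (ring_hilbert2 (t - a) - ring_hilbert2 (t - a - 1))
      - (ring_hilbert2 (t - b) - ring_hilbert2 (t - b - 1))
      + (ring_hilbert2 (t - a - b) - ring_hilbert2 (t - a - b - 1))"
    unfolding ci_hilbert2_def e
    using assms by (simp add: ring_hilbert2_def[of "t - c"] ring_hilbert2_def[of "t - c - 1"]
        ring_hilbert2_def[of "t - a - c"] ring_hilbert2_def[of "t - a - c - 1"]
        ring_hilbert2_def[of "t - b - c"] ring_hilbert2_def[of "t - b - c - 1"]
        ring_hilbert2_def[of "t - a - b - c"] ring_hilbert2_def[of "t - a - b - c - 1"])
  also have "\<dots> = 2 * ci_hilbert_plane a b t"
    unfolding d ci_hilbert_plane_def using assms by (auto simp: max_def min_def)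
  finally show ?thesis .
qed

section \<open>The strong Lefschetz property\<close>

lemma subspace_colon_part:
  assumes I: "graded_ideal I"
  shows "pol.subspace {g \<in> forms u. p * g \<in> I}"
proof -
  have "p * (Const c * g) \<in> I" if "p * g \<in> I" for c g
    using graded_ideal_mult[OF I that, of "Const c"] by (simp add: mult.left_commute)
  then show ?thesis
    using graded_ideal_0[OF I] graded_ideal_add[OF I] pol.subspace_scale[OF subspace_forms]
    by (auto simp: pol.subspace_def forms_0 forms_add distrib_left)
qed

text \<open>The rank of multiplication by \<open>p\<close> from degree \<open>u\<close> to degree \<open>u + b\<close> of \<open>S/I\<close>.\<close>

lemma dim_mult_form:
  assumes I: "graded_ideal I" and p: "p \<in> forms b" "p \<noteq> (0 :: 'k::field pol3)"
  shows "pol.dim {x + y | x y. x \<in> I \<inter> forms (u + b) \<and> y \<in> (\<lambda>g. p * g) ` forms u}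
      + pol.dim {g \<in> forms u. p * g \<in> I}
    = pol.dim (I \<inter> forms (u + b)) + pol.dim (forms u :: 'k pol3 set)"
proof -
  let ?K = "{g \<in> forms u. p * g \<in> I}"
  have inj: "v = 0" if "p * v = 0" for v using that p(2) by simp
  have int: "(I \<inter> forms (u + b)) \<inter> (\<lambda>g. p * g) ` forms u = (\<lambda>g. p * g) ` ?K"
    using forms_mult[OF p(1)] by (fastforce simp: add.commute)
  have K: "pol.subspace ?K" "pol.fin_dim ?K"
    by (rule subspace_colon_part[OF I]) (rule pol.fin_dim_subset[OF fin_dim_forms], auto)
  have "pol.dim {x + y | x y. x \<in> I \<inter> forms (u + b) \<and> y \<in> (\<lambda>g. p * g) ` forms u}
      + pol.dim ((\<lambda>g. p * g) ` ?K)
    = pol.dim (I \<inter> forms (u + b)) + pol.dim ((\<lambda>g. p * g) ` (forms u :: 'k pol3 set))"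
    unfolding int[symmetric]
    by (intro pol.dim_sum_Int subspace_graded_part I fin_dim_graded_part
        pol_pol.linear_subspace_image[OF linear_times] subspace_forms
        pol_pol.fin_dim_image[OF linear_times] fin_dim_forms)
  moreover have "pol.dim ((\<lambda>g. p * g) ` ?K) = pol.dim ?K"
    by (rule pol_pol.dim_image_inj[OF linear_times K(2,1) inj])
  moreover have "pol.dim ((\<lambda>g. p * g) ` (forms u :: 'k pol3 set)) = pol.dim (forms u :: 'k pol3 set)"
    by (rule pol_pol.dim_image_inj[OF linear_times fin_dim_forms subspace_forms inj])
  ultimately show ?thesis by simp
qed

lemma mult_surjective_iff_injective:
  assumes I: "graded_ideal I" and p: "p \<in> forms b" "p \<noteq> (0 :: 'k::field pol3)"
    and h: "hilbert I (int u) = hilbert I (int (u + b))"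
  shows "(\<forall>g\<in>forms (u + b). \<exists>g'\<in>forms u. g - p * g' \<in> I) \<longleftrightarrow> (\<forall>g\<in>forms u. p * g \<in> I \<longrightarrow> g \<in> I)"
proof -
  let ?K = "{g \<in> forms u. p * g \<in> I}"
  let ?S = "{x + y | x y. x \<in> I \<inter> forms (u + b) \<and> y \<in> (\<lambda>g. p * g) ` forms u}"
  have d: "pol.dim ?S + pol.dim ?K = pol.dim (I \<inter> forms (u + b)) + pol.dim (forms u :: 'k pol3 set)"
    by (rule dim_mult_form[OF I p])
  have h': "pol.dim (forms u :: 'k pol3 set) + pol.dim (I \<inter> forms (u + b))
    = pol.dim (forms (u + b) :: 'k pol3 set) + pol.dim (I \<inter> forms u)"
    using h by (simp add: hilbert_def nat_int_add)
  have S: "pol.subspace ?S" "?S \<subseteq> forms (u + b)"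
  proof -
    show "pol.subspace ?S"
      by (intro pol.subspace_sums subspace_graded_part I subspace_forms
          pol_pol.linear_subspace_image[OF linear_times])
    have "p * g \<in> forms (u + b)" if "g \<in> forms u" for g
      using forms_mult[OF p(1) that] by (simp add: add.commute)
    then show "?S \<subseteq> forms (u + b)" by (auto intro: forms_add)
  qed
  have K: "pol.subspace ?K" "pol.fin_dim ?K"
    by (rule subspace_colon_part[OF I]) (rule pol.fin_dim_subset[OF fin_dim_forms], auto)
  have IK: "I \<inter> forms u \<subseteq> ?K" using graded_ideal_mult[OF I] by auto
  have Seq: "(\<forall>g\<in>forms (u + b). \<exists>g'\<in>forms u. g - p * g' \<in> I) \<longleftrightarrow> ?S = forms (u + b)"
  proof
    assume *: "\<forall>g\<in>forms (u + b). \<exists>g'\<in>forms u. g - p * g' \<in> I"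
    have "g \<in> ?S" if g: "g \<in> forms (u + b)" for g :: "'k pol3"
    proof -
      obtain g' where g': "g' \<in> forms u" "g - p * g' \<in> I" using * g by blast
      moreover have "g - p * g' \<in> forms (u + b)"
        using forms_mult[OF p(1) g'(1)] that by (intro forms_diff) (simp_all add: add.commute)
      ultimately have "g = (g - p * g') + p * g'" "g - p * g' \<in> I \<inter> forms (u + b)"
        "p * g' \<in> (\<lambda>g. p * g) ` forms u" by auto
      then show ?thesis by blast
    qed
    with S show "?S = forms (u + b)" by blast
  next
    assume S: "?S = forms (u + b)"
    show "\<forall>g\<in>forms (u + b). \<exists>g'\<in>forms u. g - p * g' \<in> I"
    proof
      fix g :: "'k pol3" assume "g \<in> forms (u + b)"
      then have "g \<in> ?S" using S by simp
      then obtain x g' where "g = x + p * g'" "x \<in> I" "g' \<in> forms u" by blast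
      then show "\<exists>g'\<in>forms u. g - p * g' \<in> I" by (intro bexI[of _ g']) simp_all
    qed
  qed
  have "?S = forms (u + b) \<longleftrightarrow> pol.dim ?S = pol.dim (forms (u + b) :: 'k pol3 set)"
  proof
    assume "pol.dim ?S = pol.dim (forms (u + b) :: 'k pol3 set)"
    then show "?S = forms (u + b)"
      by (intro pol.fin_dim_subspace_eq[OF fin_dim_forms S(1) subspace_forms S(2)]) simp
  qed (simp only:)
  also have "\<dots> \<longleftrightarrow> pol.dim ?K = pol.dim (I \<inter> forms u)" using d h' by linarith
  also have "\<dots> \<longleftrightarrow> I \<inter> forms u = ?K"
  proof
    assume "pol.dim ?K = pol.dim (I \<inter> forms u)"
    then show "I \<inter> forms u = ?K"
      by (intro pol.fin_dim_subspace_eq[OF K(2) subspace_graded_part[OF I] K(1) IK]) simp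
  qed (simp only:)
  also have "\<dots> \<longleftrightarrow> (\<forall>g\<in>forms u. p * g \<in> I \<longrightarrow> g \<in> I)"
    using graded_ideal_mult[OF I] by blast
  finally show ?thesis using Seq by simp
qed

lemma coset_eq_iff:
  assumes I: "graded_ideal I" shows "coset I f = coset I g \<longleftrightarrow> f - g \<in> I"
proof
  assume "coset I f = coset I g"
  moreover have "f \<in> coset I f" using graded_ideal_0[OF I] by (force simp: coset_def)
  ultimately show "f - g \<in> I" by (auto simp: coset_def)
next
  assume fg: "f - g \<in> I"
  have "coset I f \<subseteq> coset I g" if "f - g \<in> I" for f g
  proof
    fix x assume "x \<in> coset I f"
    then obtain u where "x = f + u" "u \<in> I" by (auto simp: coset_def)
    then have "x = g + ((f - g) + u)" "(f - g) + u \<in> I" using graded_ideal_add[OF I that] by auto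
    then show "x \<in> coset I g" unfolding coset_def by blast
  qed
  from this[OF fg] this[of g f] show "coset I f = coset I g"
    using graded_ideal_diff[OF I graded_ideal_0[OF I] fg] by auto
qed

text \<open>If the Hilbert function is symmetric about \<open>s/2\<close>, the multiplications by \<open>l^(s - 2u)\<close> from degree
  \<open>u\<close> to degree \<open>s - u\<close> of \<open>S/I\<close> are surjective, since injectivity and surjectivity are equivalent
  between spaces of the same dimension.\<close>

lemma strong_Lefschetz_symmetric:
  fixes I :: "'k::field pol3 set"
  assumes I: "graded_ideal I" "I = ideal_gen B" and slp: "strong_Lefschetz I"
    and sym: "\<And>u. hilbert I (int s - u) = hilbert I u" and h0: "hilbert I 0 \<noteq> 0" and s: "s > 0"
  obtains l where "l \<in> forms 1" "l \<noteq> 0"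
    "\<And>u g. 2 * u \<le> s \<Longrightarrow> g \<in> forms (s - u) \<Longrightarrow> \<exists>g'\<in>forms u. g - l ^ (s - 2 * u) * g' \<in> I"
proof -
  from slp obtain l where l: "l \<in> forms 1" and lef: "\<forall>b\<ge>1. \<forall>t.
      inj_on (quot_mult I (l ^ b)) (quot_part I t) \<or>
      quot_mult I (l ^ b) ` quot_part I t = quot_part I (t + b)"
    unfolding strong_Lefschetz_def by (rule bexE)
  have lb: "l ^ b \<in> forms b" for b using forms_power[OF l, of b] by simp
  have dich: "(\<forall>g\<in>forms t. l ^ b * g \<in> I \<longrightarrow> g \<in> I) \<or>
      (\<forall>g\<in>forms (t + b). \<exists>g'\<in>forms t. g - l ^ b * g' \<in> I)" if "b \<ge> 1" for b t
    using lef[rule_format, OF that, of t]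
  proof
    assume inj: "inj_on (quot_mult I (l ^ b)) (quot_part I t)"
    have "g \<in> I" if g: "g \<in> forms t" "l ^ b * g \<in> I" for g
    proof -
      have "quot_mult I (l ^ b) (coset I g) = quot_mult I (l ^ b) (coset I 0)"
        using g by (simp add: quot_mult_coset[OF I(2)] coset_eq_iff[OF I(1)])
      then have "coset I g = coset I 0"
        by (rule inj_onD[OF inj]) (use g forms_0 in \<open>auto simp: quot_part_def\<close>)
      then show ?thesis by (simp add: coset_eq_iff[OF I(1)])
    qed
    then show ?thesis by blast
  next
    assume sur: "quot_mult I (l ^ b) ` quot_part I t = quot_part I (t + b)"
    have "\<exists>g'\<in>forms t. g - l ^ b * g' \<in> I" if g: "g \<in> forms (t + b)" for g
    proof -
      have "coset I g \<in> quot_mult I (l ^ b) ` quot_part I t" using g sur by (auto simp: quot_part_def)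
      then obtain g' where "g' \<in> forms t" "coset I g = coset I (l ^ b * g')"
        by (auto simp: quot_part_def quot_mult_coset[OF I(2)])
      then show ?thesis by (auto simp: coset_eq_iff[OF I(1)])
    qed
    then show ?thesis by blast
  qed
  have full: "hilbert I (int n) = 0" if "forms n \<subseteq> I" for n
    using that by (simp add: hilbert_def Int_absorb1)
  have l0: "l \<noteq> 0"
  proof
    assume "l = 0"
    then have 0: "l ^ s = 0" using s by simp
    have "forms 0 \<subseteq> I \<or> forms s \<subseteq> I"
      using dich[of s 0, unfolded 0] s graded_ideal_0[OF I(1)] by auto
    then show False using full[of 0] full[of s] sym[of 0] h0 by auto
  qed
  show thesis
  proof (rule that[OF l l0])
    fix u and g :: "'k pol3"
    assume u: "2 * u \<le> s" and g: "g \<in> forms (s - u)"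
    show "\<exists>g'\<in>forms u. g - l ^ (s - 2 * u) * g' \<in> I"
    proof (cases "2 * u = s")
      case True
      then have "g \<in> forms u" "g - l ^ (s - 2 * u) * g \<in> I"
        using g graded_ideal_0[OF I(1)] by (auto simp: mult_2)
      then show ?thesis by blast
    next
      case False
      have e: "u + (s - 2 * u) = s - u" using u by simp
      have "hilbert I (int u) = hilbert I (int (u + (s - 2 * u)))"
        using sym[of "int u"] u by (simp add: e of_nat_diff)
      then have "\<forall>g\<in>forms (u + (s - 2 * u)). \<exists>g'\<in>forms u. g - l ^ (s - 2 * u) * g' \<in> I"
        using mult_surjective_iff_injective[OF I(1) lb, of "s - 2 * u" u] dich[of "s - 2 * u" u] l0 u False
        by auto
      then show ?thesis using g e by simp
    qed
  qed
qed

section \<open>The complementary monomials\<close>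

text \<open>The exponents of degree \<open>t\<close> of the monomials outside the ideal in the theorem. The three
  conditions read \<open>a < d\<^sub>1\<close>, \<open>2a + b \<le> d\<^sub>1 + d\<^sub>2 - 2\<close> and \<open>2a + 2b + c \<le> d\<^sub>1 + d\<^sub>2 + d\<^sub>3 - 3\<close>, written
  without subtraction of natural numbers.\<close>

definition std_exps :: "nat \<Rightarrow> nat \<Rightarrow> nat \<Rightarrow> nat \<Rightarrow> (3 \<Rightarrow>\<^sub>0 nat) set" where
  "std_exps d1 d2 d3 t = {m. deg_exp m = t \<and> Poly_Mapping.lookup m 1 < d1 \<and>
     2 * Poly_Mapping.lookup m 1 + Poly_Mapping.lookup m 2 + 2 \<le> d1 + d2 \<and>
     2 * Poly_Mapping.lookup m 1 + 2 * Poly_Mapping.lookup m 2 + Poly_Mapping.lookup m 3 + 3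
       \<le> d1 + d2 + d3}"

lemma expo_std_exps: "expo a b c \<in> std_exps d1 d2 d3 t \<longleftrightarrow>
    a + b + c = t \<and> a < d1 \<and> 2 * a + b + 2 \<le> d1 + d2 \<and> 2 * a + 2 * b + c + 3 \<le> d1 + d2 + d3"
  by (simp add: std_exps_def)

lemma finite_std_exps: "finite (std_exps d1 d2 d3 t)"
  by (rule finite_subset[OF _ finite_deg_exp[of t]]) (auto simp: std_exps_def)

text \<open>For \<open>d\<^sub>1 \<le> d\<^sub>2\<close> and \<open>2t \<le> d\<^sub>1 + d\<^sub>2 + d\<^sub>3 - 3\<close>, those among them that are not divisible by
  \<open>x\<^sub>3\<close>, indexed by the exponent of \<open>x\<^sub>1\<close>.\<close>

definition plane_exps :: "nat \<Rightarrow> nat \<Rightarrow> nat \<Rightarrow> (3 \<Rightarrow>\<^sub>0 nat) set" where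
  "plane_exps d1 d2 t = (\<lambda>a. expo a (t - a) 0) ` {a. int a < ci_hilbert_plane (int d1) (int d2) (int t)}"

lemma plane_exps_bound:
  "int a < ci_hilbert_plane (int d1) (int d2) (int t) \<longleftrightarrow> a \<le> t \<and> a < d1 \<and> a < d2 \<and> a + t + 2 \<le> d1 + d2"
  by (auto simp: ci_hilbert_plane_def)

lemma card_plane_exps: "int (card (plane_exps d1 d2 t)) = ci_hilbert_plane (int d1) (int d2) (int t)"
proof -
  let ?e = "ci_hilbert_plane (int d1) (int d2) (int t)"
  have "{a. int a < ?e} = {..<nat ?e}" by auto
  moreover have "inj_on (\<lambda>a. expo a (t - a) 0) {a. int a < ?e}"
    by (rule inj_onI) (metis lookup_expo(1))
  ultimately have "card (plane_exps d1 d2 t) = nat ?e" by (simp add: plane_exps_def card_image)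
  then show ?thesis by (simp add: ci_hilbert_plane_def)
qed

lemma finite_plane_exps: "finite (plane_exps d1 d2 t)"
proof -
  have "{a. int a < ci_hilbert_plane (int d1) (int d2) (int t)} \<subseteq> {..t}"
    by (auto simp: plane_exps_bound)
  then show ?thesis unfolding plane_exps_def by (intro finite_imageI) (rule finite_subset, auto)
qed

lemma plane_exps_subset:
  assumes "d1 \<le> d2" "2 * t + 3 \<le> d1 + d2 + d3"
  shows "plane_exps d1 d2 t \<subseteq> std_exps d1 d2 d3 t"
  using assms by (auto simp: plane_exps_def plane_exps_bound expo_std_exps)

lemma std_exps_shift:
  assumes "m \<in> std_exps d1 d2 d3 u" "u + t + 3 \<le> d1 + d2 + d3" "u + k = t"
  shows "m + expo 0 0 k \<in> std_exps d1 d2 d3 t"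
proof -
  obtain a b c where "m = expo a b c" using expo_lookup[of m] by metis
  then show ?thesis using assms by (auto simp: expo_add expo_std_exps)
qed

lemma std_exps_low:
  assumes "d1 \<le> d2"
  shows "std_exps d1 d2 d3 (Suc t) \<subseteq> (\<lambda>m. m + expo 0 0 1) ` std_exps d1 d2 d3 t \<union> plane_exps d1 d2 (Suc t)"
proof
  fix m assume m: "m \<in> std_exps d1 d2 d3 (Suc t)"
  obtain a b c where abc: "m = expo a b c" using expo_lookup[of m] by metis
  show "m \<in> (\<lambda>m. m + expo 0 0 1) ` std_exps d1 d2 d3 t \<union> plane_exps d1 d2 (Suc t)"
  proof (cases c)
    case 0
    then have "b = Suc t - a" "int a < ci_hilbert_plane (int d1) (int d2) (int (Suc t))"
      using m assms unfolding plane_exps_bound by (auto simp: abc expo_std_exps)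
    then show ?thesis unfolding plane_exps_def abc 0 by blast
  next
    case (Suc k)
    then have "m = expo a b k + expo 0 0 1" "expo a b k \<in> std_exps d1 d2 d3 t"
      using m by (auto simp: abc expo_add expo_std_exps)
    then show ?thesis by blast
  qed
qed

lemma std_exps_high:
  assumes "t + 3 \<le> d1 + d2 + d3" "d1 + d2 + d3 \<le> 2 * t + 3"
  shows "std_exps d1 d2 d3 t
    \<subseteq> (\<lambda>m. m + expo 0 0 (2 * t + 3 - (d1 + d2 + d3))) ` std_exps d1 d2 d3 (d1 + d2 + d3 - 3 - t)"
proof
  let ?k = "2 * t + 3 - (d1 + d2 + d3)"
  fix m assume m: "m \<in> std_exps d1 d2 d3 t"
  obtain a b c where abc: "m = expo a b c" using expo_lookup[of m] by metis
  have "m = expo a b (c - ?k) + expo 0 0 ?k" "expo a b (c - ?k) \<in> std_exps d1 d2 d3 (d1 + d2 + d3 - 3 - t)"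
    using m assms by (auto simp: abc expo_add expo_std_exps)
  then show "m \<in> (\<lambda>m. m + expo 0 0 ?k) ` std_exps d1 d2 d3 (d1 + d2 + d3 - 3 - t)" by blast
qed

lemma std_exps_beyond: "d1 + d2 + d3 < t + 3 \<Longrightarrow> std_exps d1 d2 d3 t = {}"
  by (auto simp: std_exps_def deg_exp_3)

lemma card_std_exps_le:
  assumes d: "0 < d1" "d1 \<le> d2" "d2 < d3" "d1 + d2 \<le> d3 + 1"
  shows "2 * int (card (std_exps d1 d2 d3 t)) \<le> ci_hilbert2 (int d1) (int d2) (int d3) (int t)"
proof -
  let ?h = "ci_hilbert2 (int d1) (int d2) (int d3)" and ?e = "ci_hilbert_plane (int d1) (int d2)"
  have low: "2 * int (card (std_exps d1 d2 d3 t)) \<le> ?h (int t)" if "2 * t + 3 \<le> d1 + d2 + d3" for t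
    using that
  proof (induction t)
    case 0
    have "std_exps d1 d2 d3 0 \<subseteq> {expo 0 0 0}"
      by (auto simp: std_exps_def deg_exp_3 intro: exponent_eqI)
    then have "card (std_exps d1 d2 d3 0) \<le> 1" using card_mono[of "{expo 0 0 0}"] by fastforce
    moreover have "?h 0 = 2" using d by (simp add: ci_hilbert2_def ring_hilbert2_def)
    ultimately show ?case by simp
  next
    case (Suc t)
    have "card (std_exps d1 d2 d3 (Suc t))
      \<le> card ((\<lambda>m. m + expo 0 0 1) ` std_exps d1 d2 d3 t \<union> plane_exps d1 d2 (Suc t))"
      by (rule card_mono[OF _ std_exps_low[OF d(2)]]) (simp add: finite_std_exps finite_plane_exps)
    also have "\<dots> \<le> card ((\<lambda>m. m + expo 0 0 1) ` std_exps d1 d2 d3 t) + card (plane_exps d1 d2 (Suc t))"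
      by (rule card_Un_le)
    also have "\<dots> \<le> card (std_exps d1 d2 d3 t) + card (plane_exps d1 d2 (Suc t))"
      by (simp add: card_image_le finite_std_exps)
    finally have c: "int (card (std_exps d1 d2 d3 (Suc t))) \<le> int (card (std_exps d1 d2 d3 t)) + ?e (int (Suc t))"
      unfolding card_plane_exps[symmetric] by linarith
    have e: "int (Suc t) - 1 = int t" by simp
    have "?h (int (Suc t)) - ?h (int (Suc t) - 1) = 2 * ?e (int (Suc t))"
    proof (rule ci_hilbert2_diff)
      have "Suc t < d3" using d Suc.prems by presburger
      then show "int (Suc t) < int d3" by linarith
    qed (use d in simp_all)
    moreover note c
    moreover have "2 * int (card (std_exps d1 d2 d3 t)) \<le> ?h (int t)"
      using Suc.prems by (intro Suc.IH) simp
    ultimately show ?case unfolding e by linarith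
  qed
  have "2 * t + 3 \<le> d1 + d2 + d3 \<or> t + 3 \<le> d1 + d2 + d3 \<and> d1 + d2 + d3 \<le> 2 * t + 3
    \<or> d1 + d2 + d3 < t + 3" by linarith
  then consider "2 * t + 3 \<le> d1 + d2 + d3" | "t + 3 \<le> d1 + d2 + d3" "d1 + d2 + d3 \<le> 2 * t + 3"
    | "d1 + d2 + d3 < t + 3" by blast
  then show ?thesis
  proof cases
    case 1
    then show ?thesis by (rule low)
  next
    case 2
    define u where "u = d1 + d2 + d3 - 3 - t"
    have "card (std_exps d1 d2 d3 t)
      \<le> card ((\<lambda>m. m + expo 0 0 (2 * t + 3 - (d1 + d2 + d3))) ` std_exps d1 d2 d3 u)"
      unfolding u_def by (rule card_mono[OF _ std_exps_high[OF 2]]) (simp add: finite_std_exps)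
    also have "\<dots> \<le> card (std_exps d1 d2 d3 u)" by (simp add: card_image_le finite_std_exps)
    finally have "card (std_exps d1 d2 d3 t) \<le> card (std_exps d1 d2 d3 u)" .
    moreover have "2 * u + 3 \<le> d1 + d2 + d3" using 2 unfolding u_def by linarith
    note low[OF this]
    ultimately have "2 * int (card (std_exps d1 d2 d3 t)) \<le> ?h (int u)" by linarith
    also have "int u = int d1 + int d2 + int d3 - 3 - int t" using 2 by (simp add: u_def)
    finally show ?thesis by (simp add: ci_hilbert2_symmetric)
  next
    case 3
    have "?h (int t) = ?h (int d1 + int d2 + int d3 - 3 - int t)" by (simp add: ci_hilbert2_symmetric)
    also have "\<dots> = 0" by (intro ci_hilbert2_negative) (use 3 in linarith)+
    finally show ?thesis using std_exps_beyond[OF 3] by simp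
  qed
qed

section \<open>Restriction to the line \<open>x\<^sub>3 = 0\<close>\<close>

text \<open>Setting \<open>x\<^sub>1 = 1\<close>, \<open>x\<^sub>2 = X\<close> and \<open>x\<^sub>3 = 0\<close> identifies forms of degree \<open>t\<close> modulo \<open>x\<^sub>3\<close> with
  univariate polynomials of degree at most \<open>t\<close>.\<close>

definition restr :: "'k::field pol3 \<Rightarrow> 'k poly" where
  "restr = eval_poly (\<lambda>c. [:c:]) (\<lambda>i. if i = 1 then 1 else if i = 2 then [:0, 1:] else 0)"

lemma ring_hom_pCons: "ring_hom (\<lambda>c :: 'k::field. [:c:])"
  by (simp add: ring_hom_def one_pCons)

lemma ring_hom_restr: "ring_hom restr"
  unfolding restr_def by (rule ring_hom_eval_poly[OF ring_hom_pCons])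

lemma restr_Const: "restr (Const c) = [:c:]"
  unfolding restr_def by (rule eval_poly_Const[OF ring_hom_pCons])

lemma restr_Var: "restr (Var 1) = 1" "restr (Var 2) = [:0, 1:]" "restr (Var 3) = 0"
  unfolding restr_def eval_poly_Var[OF ring_hom_pCons] using distinct_3 by simp_all

lemma linear_restr: "Vector_Spaces.linear scale_pol smult restr"
  by (simp add: Vector_Spaces.linear_iff pol.vector_space_axioms upol.vector_space_axioms
      ring_hom_add[OF ring_hom_restr] ring_hom_mult[OF ring_hom_restr] restr_Const)

lemma restr_monom: "restr (monom_of (expo a b c)) = (if c = 0 then Polynomial.monom 1 b else 0)"
  by (simp add: monom_of_expo ring_hom_mult[OF ring_hom_restr] ring_hom_power[OF ring_hom_restr]
      restr_Var monom_altdef power_0_left)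

lemma coeff_restr:
  assumes f: "f \<in> forms t" and b: "b \<le> t"
  shows "coeff (restr f) b = Poly_Mapping.lookup f (expo (t - b) b 0)"
proof -
  let ?A = "{m :: 3 \<Rightarrow>\<^sub>0 nat. deg_exp m = t}"
  have "f = (\<Sum>m\<in>?A. Const (Poly_Mapping.lookup f m) * monom_of m)"
    by (rule mpol_eq_sum) (use f in \<open>auto simp: finite_deg_exp forms_def\<close>)
  from arg_cong[OF this, of restr]
  have "restr f = (\<Sum>m\<in>?A. smult (Poly_Mapping.lookup f m) (restr (monom_of m)))"
    by (simp add: ring_hom_sum[OF ring_hom_restr]
        ring_hom_mult[OF ring_hom_restr] restr_Const)
  then have "coeff (restr f) b = (\<Sum>m\<in>?A. Poly_Mapping.lookup f m * coeff (restr (monom_of m)) b)"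
    by (simp add: coeff_sum)
  also have "\<dots> = (\<Sum>m\<in>?A. if m = expo (t - b) b 0 then Poly_Mapping.lookup f m else 0)"
  proof (rule sum.cong)
    fix m :: "3 \<Rightarrow>\<^sub>0 nat" assume m: "m \<in> ?A"
    obtain x y z where xyz: "m = expo x y z" using expo_lookup[of m] by metis
    have "m = expo (t - b) b 0 \<longleftrightarrow> z = 0 \<and> y = b"
    proof
      assume "m = expo (t - b) b 0"
      then show "z = 0 \<and> y = b" unfolding xyz by (metis lookup_expo(2,3))
    next
      assume "z = 0 \<and> y = b"
      then show "m = expo (t - b) b 0" using m b by (auto simp: xyz)
    qed
    then show "Poly_Mapping.lookup f m * coeff (restr (monom_of m)) b
      = (if m = expo (t - b) b 0 then Poly_Mapping.lookup f m else 0)"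
      unfolding xyz restr_monom by auto
  qed simp
  also have "\<dots> = Poly_Mapping.lookup f (expo (t - b) b 0)"
    using b by (simp add: finite_deg_exp)
  finally show ?thesis .
qed

lemma restr_eq_0_lookup:
  assumes "f \<in> forms t" "restr f = 0" shows "Poly_Mapping.lookup f (expo a b 0) = 0"
proof (cases "a + b = t")
  case True
  then show ?thesis using coeff_restr[OF assms(1), of b] assms(2) by auto
next
  case False
  then have "expo a b 0 \<notin> Poly_Mapping.keys f" using assms(1) by (auto simp: forms_def)
  then show ?thesis by (simp add: in_keys_iff)
qed

lemma restr_kernel:
  assumes f: "f \<in> forms t" "restr f = 0"
  obtains g where "f = Var 3 * g" "g \<in> forms (t - 1)" "t = 0 \<Longrightarrow> g = 0"
proof -
  let ?l = "\<lambda>m. Poly_Mapping.lookup m"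
  have pos: "?l m 3 > 0" if "m \<in> Poly_Mapping.keys f" for m
  proof (rule ccontr)
    assume "\<not> ?thesis"
    then have "m = expo (?l m 1) (?l m 2) 0" using expo_lookup[of m] by simp
    then have "?l f m = 0" using restr_eq_0_lookup[OF f] by metis
    then show False using that by (simp add: in_keys_iff)
  qed
  define g where "g = (\<Sum>m\<in>Poly_Mapping.keys f. Const (?l f m) * monom_of (expo (?l m 1) (?l m 2) (?l m 3 - 1)))"
  have "Var 3 * g = (\<Sum>m\<in>Poly_Mapping.keys f. Const (?l f m) * (Var 3 * monom_of (expo (?l m 1) (?l m 2) (?l m 3 - 1))))"
    by (simp add: g_def sum_distrib_left mult_ac)
  also have "\<dots> = (\<Sum>m\<in>Poly_Mapping.keys f. Const (?l f m) * monom_of m)"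
  proof (rule sum.cong)
    fix m assume m: "m \<in> Poly_Mapping.keys f"
    have "Var 3 * monom_of (expo (?l m 1) (?l m 2) (?l m 3 - 1))
      = (monom_of (expo 0 0 1 + expo (?l m 1) (?l m 2) (?l m 3 - 1)) :: 'a pol3)"
      by (simp add: monom_of_mult monom_of_expo)
    also have "expo 0 0 1 + expo (?l m 1) (?l m 2) (?l m 3 - 1) = m"
      using pos[OF m] expo_lookup[of m] by (simp add: expo_add)
    finally show "Const (?l f m) * (Var 3 * monom_of (expo (?l m 1) (?l m 2) (?l m 3 - 1)))
      = Const (?l f m) * monom_of m" by simp
  qed simp
  also have "\<dots> = f" using mpol_eq_sum[of "Poly_Mapping.keys f" f] by simp
  finally have "f = Var 3 * g" by simp
  moreover have "g \<in> forms (t - 1)"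
    unfolding g_def
  proof (rule forms_sum)
    fix m assume m: "m \<in> Poly_Mapping.keys f"
    then have "deg_exp (expo (?l m 1) (?l m 2) (?l m 3 - 1)) = t - 1"
      using pos[OF m] f(1) by (auto simp: forms_def deg_exp_3)
    then have "monom_of (expo (?l m 1) (?l m 2) (?l m 3 - 1)) \<in> (forms (t - 1) :: 'a pol3 set)"
      by (simp add: monom_of_forms)
    from forms_mult[OF Const_forms this]
    show "Const (?l f m) * monom_of (expo (?l m 1) (?l m 2) (?l m 3 - 1)) \<in> forms (t - 1)" by simp
  qed
  moreover have "g = 0" if "t = 0"
  proof -
    have "Poly_Mapping.keys f = {}"
    proof (rule ccontr)
      assume "Poly_Mapping.keys f \<noteq> {}"
      then obtain m where m: "m \<in> Poly_Mapping.keys f" by blast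
      then have "deg_exp m = 0" using f(1) that by (simp add: forms_def)
      then show False using pos[OF m] by (simp add: deg_exp_3)
    qed
    then show ?thesis by (simp add: g_def)
  qed
  ultimately show thesis using that by blast
qed

text \<open>The kernel of the restriction on \<open>I\<close> in degree \<open>t\<close> is \<open>x\<^sub>3\<close> times \<open>I\<close> in degree \<open>t - 1\<close> as soon as
  \<open>x\<^sub>3\<close> is injective on \<open>S/I\<close> there.\<close>

lemma dim_restr_kernel:
  fixes I :: "'k::field pol3 set"
  assumes I: "graded_ideal I"
    and inj: "\<And>g. t > 0 \<Longrightarrow> g \<in> forms (t - 1) \<Longrightarrow> Var 3 * g \<in> I \<Longrightarrow> g \<in> I"
  shows "pol.dim {f \<in> I \<inter> forms t. restr f = 0} = (if t = 0 then 0 else pol.dim (I \<inter> forms (t - 1)))"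
proof (cases "t = 0")
  case True
  have "{f \<in> I \<inter> forms t. restr f = 0} \<subseteq> pol.span {}"
  proof
    fix f assume "f \<in> {f \<in> I \<inter> forms t. restr f = 0}"
    then show "f \<in> pol.span {}" using restr_kernel[of f t] True by auto
  qed
  then have "pol.dim {f \<in> I \<inter> forms t. restr f = 0} \<le> card ({} :: 'k pol3 set)"
    by (rule pol.dim_le_card) simp
  then show ?thesis using True by simp
next
  case False
  have V1: "Var 3 * g \<in> forms t" if "g \<in> forms (t - 1)" for g :: "'k pol3"
    using forms_mult[OF Var_forms that, of 3] False by simp
  have "{f \<in> I \<inter> forms t. restr f = 0} = (\<lambda>g. Var 3 * g) ` (I \<inter> forms (t - 1))"
  proof (intro equalityI subsetI)
    fix f assume f: "f \<in> {f \<in> I \<inter> forms t. restr f = 0}"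
    then obtain g where g: "f = Var 3 * g" "g \<in> forms (t - 1)" using restr_kernel[of f t] by blast
    then have "g \<in> I" using inj[of g] f False by simp
    then show "f \<in> (\<lambda>g. Var 3 * g) ` (I \<inter> forms (t - 1))" using g by blast
  next
    fix f assume "f \<in> (\<lambda>g. Var 3 * g) ` (I \<inter> forms (t - 1))"
    then show "f \<in> {f \<in> I \<inter> forms t. restr f = 0}"
      using V1 graded_ideal_mult[OF I] by (auto simp: ring_hom_mult[OF ring_hom_restr] restr_Var)
  qed
  moreover have "Var 3 \<noteq> (0 :: 'k pol3)"
  proof
    assume "Var 3 = (0 :: 'k pol3)"
    then have "Poly_Mapping.keys (Var 3 :: 'k pol3) = {}" by simp
    then show False by (simp add: Var_def)
  qed
  then have "pol.dim ((\<lambda>g. Var 3 * g) ` (I \<inter> forms (t - 1))) = pol.dim (I \<inter> forms (t - 1))"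
    by (intro pol_pol.dim_image_inj[OF linear_times fin_dim_graded_part subspace_graded_part[OF I]]) simp
  ultimately show ?thesis using False by simp
qed

lemma dim_restr:
  fixes I :: "'k::field pol3 set"
  assumes I: "graded_ideal I"
    and inj: "\<And>g. t > 0 \<Longrightarrow> g \<in> forms (t - 1) \<Longrightarrow> Var 3 * g \<in> I \<Longrightarrow> g \<in> I"
  shows "upol.dim (restr ` (forms t :: 'k pol3 set)) = t + 1"
    and "int (upol.dim (restr ` (I \<inter> forms t))) = int (t + 1) - (hilbert I (int t) - hilbert I (int t - 1))"
proof -
  have UN: "graded_ideal (UNIV :: 'k pol3 set)" by (simp add: graded_ideal_def)
  have k0: "pol.dim {f \<in> forms t. restr f = (0 :: 'k poly)}
      = (if t = 0 then 0 else pol.dim (forms (t - 1) :: 'k pol3 set))"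
    using dim_restr_kernel[OF UN, of t] by (cases "t = 0") simp_all
  have r0: "pol.dim (forms t :: 'k pol3 set) = upol.dim (restr ` (forms t :: 'k pol3 set))
      + pol.dim {f \<in> forms t. restr f = (0 :: 'k poly)}"
    by (rule pol_upol.rank_nullity[OF linear_restr fin_dim_forms subspace_forms])
  have "2 * pol.dim (forms t :: 'k pol3 set)
    = 2 * (if t = 0 then 0 else pol.dim (forms (t - 1) :: 'k pol3 set)) + 2 * (t + 1)"
    by (cases t) (simp_all only: dim_forms distrib_left mult_2 if_True if_False, simp_all add: dim_forms flip: mult_2)
  then show *: "upol.dim (restr ` (forms t :: 'k pol3 set)) = t + 1" using r0 k0 by simp
  have k1: "pol.dim {f \<in> I \<inter> forms t. restr f = 0} = (if t = 0 then 0 else pol.dim (I \<inter> forms (t - 1)))"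
    by (rule dim_restr_kernel[OF I inj])
  have r1: "pol.dim (I \<inter> forms t) = upol.dim (restr ` (I \<inter> forms t)) + pol.dim {f \<in> I \<inter> forms t. restr f = 0}"
    by (rule pol_upol.rank_nullity[OF linear_restr fin_dim_graded_part subspace_graded_part[OF I]])
  have "nat (int t - 1) = t - 1" by simp
  then show "int (upol.dim (restr ` (I \<inter> forms t))) = int (t + 1) - (hilbert I (int t) - hilbert I (int t - 1))"
    using * r0 r1 k0 k1 by (cases "t = 0") (simp_all add: hilbert_def)
qed

section \<open>Generic coordinates\<close>

text \<open>The substitution \<open>x\<^sub>2 \<mapsto> x\<^sub>2 + c x\<^sub>1\<close>.\<close>

definition shear :: "'k::field \<Rightarrow> 'k ^ 3 ^ 3" where
  "shear c = (\<chi> i j. if i = j then 1 else if i = 1 \<and> j = 2 then c else 0)"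

lemma invertible_shear: "invertible (shear c)"
  by (simp add: invertible_det_nz det_3 shear_def distinct_3)

lemma lin_subst_shear:
  "lin_subst (shear c) (Var 1) = Var 1"
  "lin_subst (shear c) (Var 2) = Var 2 + Const c * Var 1"
  "lin_subst (shear c) (Var 3) = Var 3"
  unfolding lin_subst_Var lin_form_def sum_3
  using distinct_3 by (simp_all add: shear_def ring_hom_0[OF ring_hom_Const] ring_hom_1[OF ring_hom_Const])

lemma restr_shear_monom:
  "restr (lin_subst (shear c) (monom_of (expo a b 0))) = [:c, 1:] ^ b"
  unfolding monom_of_expo
  by (simp add: ring_hom_mult[OF ring_hom_lin_subst] ring_hom_power[OF ring_hom_lin_subst]
      lin_subst_shear ring_hom_mult[OF ring_hom_restr] ring_hom_power[OF ring_hom_restr]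
      ring_hom_add[OF ring_hom_restr] restr_Var restr_Const)

lemma plane_exps_forms: "supported (plane_exps d1 d2 t) \<subseteq> (forms t :: 'k::field pol3 set)"
  unfolding forms_eq_supported
  by (rule supported_mono) (auto simp: plane_exps_def plane_exps_bound)

lemma restr_shear_inj:
  fixes w :: "'k::field pol3"
  assumes w: "w \<in> supported (plane_exps d1 d2 t)" and 0: "restr (lin_subst (shear c) w) = 0"
  shows "w = 0"
proof -
  have wt: "w \<in> forms t" using w plane_exps_forms by blast
  obtain D where D: "\<And>f. lin_subst D (lin_subst (shear c) f) = f"
    using lin_subst_inverse[OF invertible_shear] by metis
  obtain g where g: "lin_subst (shear c) w = Var 3 * g"
    using restr_kernel[OF lin_subst_forms[OF wt] 0] by metis
  have "w = lin_subst D (Var 3) * lin_subst D g"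
    using arg_cong[OF g, of "lin_subst D"] by (simp add: D ring_hom_mult[OF ring_hom_lin_subst])
  moreover have "lin_subst D (Var 3) = Var 3" using D[of "Var 3"] by (simp add: lin_subst_shear)
  ultimately have r: "restr w = 0" by (simp add: ring_hom_mult[OF ring_hom_restr] restr_Var)
  show "w = 0"
  proof (rule poly_mapping_eqI)
    fix m
    show "Poly_Mapping.lookup w m = Poly_Mapping.lookup 0 m"
    proof (cases "m \<in> plane_exps d1 d2 t")
      case True
      then obtain a where "m = expo a (t - a) 0" by (auto simp: plane_exps_def)
      then show ?thesis using restr_eq_0_lookup[OF wt r] by simp
    next
      case False
      then show ?thesis using w by (simp add: supported_iff)
    qed
  qed
qed

text \<open>For all but finitely many \<open>c\<close>, the products \<open>x\<^sub>1^a (x\<^sub>2 + c x\<^sub>1)^(t - a)\<close> with \<open>a\<close> less than the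
  increment of the Hilbert function span \<open>S/I\<close> in degree \<open>t\<close> modulo \<open>x\<^sub>3\<close>. Their restrictions to the
  line are divisible by \<open>(X + c)^n\<close>, where \<open>n\<close> is the dimension of the restriction of \<open>I\<close>.\<close>

lemma generic_plane_complement:
  fixes I :: "'k::field_char_0 pol3 set"
  assumes I: "graded_ideal I"
    and inj: "\<And>g. t > 0 \<Longrightarrow> g \<in> forms (t - 1) \<Longrightarrow> Var 3 * g \<in> I \<Longrightarrow> g \<in> I"
    and e: "hilbert I (int t) - hilbert I (int t - 1) = ci_hilbert_plane (int d1) (int d2) (int t)"
  obtains P where "P \<noteq> 0" "\<And>c g. poly P (- c) \<noteq> 0 \<Longrightarrow> g \<in> forms t \<Longrightarrow>
    \<exists>w\<in>supported (plane_exps d1 d2 t). \<exists>i\<in>I \<inter> forms t. restr g = restr i + restr (lin_subst (shear c) w)"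
proof -
  define V where "V = restr ` (I \<inter> forms t)"
  have V: "upol.subspace V" "upol.fin_dim V"
    unfolding V_def
    using pol_upol.linear_subspace_image[OF linear_restr subspace_graded_part[OF I]]
      pol_upol.fin_dim_image[OF linear_restr fin_dim_graded_part] by auto
  obtain B where B: "upol.independent B" "upol.span B = V" "finite B" "card B = upol.dim V"
    using upol.extend_to_basis[OF V(2,1) empty_subsetI upol.independent_empty] by metis
  have dV: "int (card B) = int (t + 1) - ci_hilbert_plane (int d1) (int d2) (int t)"
    using dim_restr(2)[OF I inj] e by (simp add: B(4) V_def)
  have indB: "\<forall>b\<in>B. c b = 0" if "(\<Sum>b\<in>B. smult (c b) b) = 0" for c
    using upol.independentD[OF B(1,3) order_refl that] by blast
  have "\<exists>P. P \<noteq> 0 \<and> (\<forall>z b. poly P z \<noteq> 0 \<longrightarrow>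
      [:- z, 1:] ^ card B dvd (\<Sum>i\<in>B. smult (b i) i) \<longrightarrow> (\<forall>i\<in>B. b i = 0))"
    by (rule generic_vanishing_order[of B "\<lambda>b. b", OF B(3) indB]) blast+
  then obtain P where P: "P \<noteq> 0" "\<And>z b. poly P z \<noteq> 0 \<Longrightarrow>
      [:- z, 1:] ^ card B dvd (\<Sum>i\<in>B. smult (b i) i) \<Longrightarrow> \<forall>i\<in>B. b i = 0"
    by blast
  show thesis
  proof (rule that[OF P(1)])
    fix c and g :: "'k pol3"
    assume c: "poly P (- c) \<noteq> 0" and g: "g \<in> forms t"
    let ?S = "supported (plane_exps d1 d2 t) :: 'k pol3 set"
    define \<rho> where "\<rho> = (\<lambda>w. restr (lin_subst (shear c) w))"
    have \<rho>: "Vector_Spaces.linear scale_pol smult \<rho>"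
      using Vector_Spaces.linear_compose[OF linear_lin_subst linear_restr, of "shear c"]
      unfolding \<rho>_def comp_def .
    define Q where "Q = \<rho> ` ?S"
    have Q: "upol.subspace Q" "upol.fin_dim Q"
      unfolding Q_def
      using pol_upol.linear_subspace_image[OF \<rho> subspace_supported]
        pol_upol.fin_dim_image[OF \<rho> fin_dim_supported[OF finite_plane_exps]] by auto
    have "upol.dim Q = pol.dim ?S"
      unfolding Q_def
      by (rule pol_upol.dim_image_inj[OF \<rho> fin_dim_supported[OF finite_plane_exps] subspace_supported])
        (auto simp: \<rho>_def intro: restr_shear_inj)
    then have dQ: "int (upol.dim Q) = ci_hilbert_plane (int d1) (int d2) (int t)"
      by (simp add: dim_supported[OF finite_plane_exps] card_plane_exps)
    have dvd: "[:c, 1:] ^ card B dvd \<rho> w" if w: "w \<in> ?S" for w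
    proof -
      have "w = (\<Sum>m\<in>plane_exps d1 d2 t. Const (Poly_Mapping.lookup w m) * monom_of m)"
        using w by (intro mpol_eq_sum finite_plane_exps) (simp add: supported_def)
      from arg_cong[OF this, of \<rho>]
      have "\<rho> w = (\<Sum>m\<in>plane_exps d1 d2 t. smult (Poly_Mapping.lookup w m) (\<rho> (monom_of m)))"
        by (simp add: \<rho>_def ring_hom_sum[OF ring_hom_restr] ring_hom_mult[OF ring_hom_restr] restr_Const
          ring_hom_sum[OF ring_hom_lin_subst] ring_hom_mult[OF ring_hom_lin_subst] lin_subst_Const)
      also have "[:c, 1:] ^ card B dvd \<dots>"
      proof (intro dvd_sum dvd_smult)
        fix m assume "m \<in> plane_exps d1 d2 t"
        then obtain a where a: "m = expo a (t - a) 0" "int a < ci_hilbert_plane (int d1) (int d2) (int t)"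
          by (auto simp: plane_exps_def)
        then have "card B \<le> t - a" using dV by linarith
        then show "[:c, 1:] ^ card B dvd \<rho> (monom_of m)"
          unfolding \<rho>_def a(1) restr_shear_monom by (rule le_imp_power_dvd)
      qed
      finally show ?thesis .
    qed
    \<comment> \<open>The genericity of \<open>c\<close> enters here only.\<close>
    have "x = 0" if x: "x \<in> V" "x \<in> Q" for x
    proof -
      obtain b where b: "x = (\<Sum>i\<in>B. smult (b i) i)"
        using x(1) unfolding B(2)[symmetric] upol.span_finite[OF B(3)] by auto
      have "[:- (- c), 1:] ^ card B dvd x" using x(2) dvd by (auto simp: Q_def)
      then have "\<forall>i\<in>B. b i = 0" using P(2)[OF c] unfolding b by blast
      then show "x = 0" unfolding b by simp
    qed
    then have "V \<inter> Q \<subseteq> upol.span {}" by auto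
    then have "upol.dim (V \<inter> Q) = 0" using upol.dim_le_card[of "V \<inter> Q" "{}"] by simp
    then have sum: "upol.dim {x + y | x y. x \<in> V \<and> y \<in> Q} = card B + upol.dim Q"
      using upol.dim_sum_Int[OF V Q] B(4) by simp
    have sub: "upol.subspace (restr ` (forms t :: 'k pol3 set))" "upol.fin_dim (restr ` (forms t :: 'k pol3 set))"
      using pol_upol.linear_subspace_image[OF linear_restr subspace_forms]
        pol_upol.fin_dim_image[OF linear_restr fin_dim_forms] by auto
    have VQ: "V \<subseteq> restr ` forms t" "Q \<subseteq> restr ` forms t"
      unfolding V_def Q_def \<rho>_def using plane_exps_forms lin_subst_forms by fast+
    have "{x + y | x y. x \<in> V \<and> y \<in> Q} = restr ` forms t"
    proof (rule upol.fin_dim_subspace_eq[OF sub(2) upol.subspace_sums[OF V(1) Q(1)] sub(1)])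
      show "{x + y | x y. x \<in> V \<and> y \<in> Q} \<subseteq> restr ` forms t"
        using VQ upol.subspace_add[OF sub(1)] by blast
      show "upol.dim (restr ` (forms t :: 'k pol3 set)) \<le> upol.dim {x + y | x y. x \<in> V \<and> y \<in> Q}"
        using dim_restr(1)[OF I inj] sum dV dQ by simp
    qed
    then have "restr g \<in> {x + y | x y. x \<in> V \<and> y \<in> Q}" using g by blast
    then show "\<exists>w\<in>?S. \<exists>i\<in>I \<inter> forms t. restr g = restr i + restr (lin_subst (shear c) w)"
      unfolding V_def Q_def \<rho>_def by blast
  qed
qed

text \<open>Multiplication by \<open>x\<^sub>3^k\<close> shifts exponents.\<close>

lemma Var3_power_supported:
  fixes w :: "'k::field pol3"
  assumes w: "w \<in> supported A" and A: "\<And>m. m \<in> A \<Longrightarrow> m + expo 0 0 k \<in> B"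
  shows "Var 3 ^ k * w \<in> supported B"
proof -
  have "m \<in> B" if m: "m \<in> Poly_Mapping.keys (w * monom_of (expo 0 0 k))" for m
  proof -
    have "m \<in> {a + b | a b. a \<in> Poly_Mapping.keys w \<and> b \<in> Poly_Mapping.keys (monom_of (expo 0 0 k) :: 'k pol3)}"
      using subsetD[OF keys_mult m] .
    then show ?thesis using w A by (auto simp: supported_def)
  qed
  then show ?thesis by (auto simp: supported_def monom_of_expo mult.commute)
qed

text \<open>If \<open>x\<^sub>3\<close> is a strong Lefschetz element, the complementary monomials in the coordinates
  \<open>x\<^sub>1, x\<^sub>2 + c x\<^sub>1, x\<^sub>3\<close> span \<open>S/I\<close>.\<close>

lemma std_spanning_shear:
  fixes I :: "'k::field_char_0 pol3 set"
  assumes d: "0 < d1" "d1 \<le> d2" "d2 < d3" "d1 + d2 \<le> d3 + 1"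
    and s: "s + 3 = d1 + d2 + d3"
    and I: "graded_ideal I"
    and h: "\<And>t. 2 * hilbert I t = ci_hilbert2 (int d1) (int d2) (int d3) t"
    and lef: "\<And>u g. 2 * u \<le> s \<Longrightarrow> g \<in> forms (s - u) \<Longrightarrow> \<exists>g'\<in>forms u. g - Var 3 ^ (s - 2 * u) * g' \<in> I"
  obtains c where "\<And>t g. g \<in> forms t \<Longrightarrow>
    \<exists>w\<in>supported (std_exps d1 d2 d3 t). g - lin_subst (shear c) w \<in> I"
proof -
  have sint: "int d1 + int d2 + int d3 - 3 = int s" using s by linarith
  have sym: "hilbert I (int s - t) = hilbert I t" for t
    using h[of t] h[of "int s - t"] ci_hilbert2_symmetric[of "int d1" "int d2" "int d3" t] sint by simp
  have V3: "Var 3 ^ k \<in> (forms k :: 'k pol3 set)" "Var 3 ^ k \<noteq> (0 :: 'k pol3)" for k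
  proof -
    have eq: "Var 3 ^ k = (monom_of (expo 0 0 k) :: 'k pol3)" by (simp add: monom_of_expo)
    show "Var 3 ^ k \<in> (forms k :: 'k pol3 set)" by (simp add: eq monom_of_forms)
    show "Var 3 ^ k \<noteq> (0 :: 'k pol3)" unfolding eq by (metis keys_monom_of keys_zero insert_not_empty)
  qed
  \<comment> \<open>\<open>x\<^sub>3\<close> is injective in degree \<open>t - 1\<close> because its power \<open>x\<^sub>3^(s - 2(t - 1))\<close> is.\<close>
  have inj: "g \<in> I" if t: "t > 0" "2 * t \<le> s" and g: "g \<in> forms (t - 1)" "Var 3 * g \<in> I" for t and g :: "'k pol3"
  proof -
    define u where "u = t - 1"
    define b where "b = s - 2 * u"
    have ub: "u + b = s - u" "2 * u \<le> s" "b > 0" using t by (auto simp: u_def b_def)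
    have "hilbert I (int u) = hilbert I (int (u + b))" using sym[of "int u"] ub by (simp add: of_nat_diff)
    then have "(\<forall>g\<in>forms (u + b). \<exists>g'\<in>forms u. g - Var 3 ^ b * g' \<in> I) \<longleftrightarrow>
        (\<forall>g\<in>forms u. Var 3 ^ b * g \<in> I \<longrightarrow> g \<in> I)"
      by (rule mult_surjective_iff_injective[OF I V3])
    moreover have "\<forall>g\<in>forms (u + b). \<exists>g'\<in>forms u. g - Var 3 ^ b * g' \<in> I"
    proof
      fix g :: "'k pol3" assume "g \<in> forms (u + b)"
      then have "g \<in> forms (s - u)" unfolding ub(1) .
      from lef[OF ub(2) this] show "\<exists>g'\<in>forms u. g - Var 3 ^ b * g' \<in> I" unfolding b_def .
    qed
    ultimately have *: "\<And>g. g \<in> forms u \<Longrightarrow> Var 3 ^ b * g \<in> I \<Longrightarrow> g \<in> I" by blast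
    have "Var 3 ^ b * g = Var 3 ^ (b - 1) * (Var 3 * g)"
      using ub(3) by (cases b) (simp_all add: mult_ac)
    then have "Var 3 ^ b * g \<in> I" by (simp only: graded_ideal_mult[OF I g(2)])
    with * g(1) show "g \<in> I" by (simp add: u_def)
  qed
  have e: "hilbert I (int t) - hilbert I (int t - 1) = ci_hilbert_plane (int d1) (int d2) (int t)"
    if "2 * t \<le> s" for t
  proof -
    have "t < d3" using that s d by linarith
    then show ?thesis using ci_hilbert2_diff[of "int d1" "int d2" "int t" "int d3"] d h[of "int t"] h[of "int t - 1"]
      by simp
  qed
  define G where "G = (\<lambda>t c. \<forall>g\<in>forms t. \<exists>w\<in>supported (plane_exps d1 d2 t). \<exists>i\<in>I \<inter> forms t.
    restr g = restr i + restr (lin_subst (shear c) w))"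
  have "\<exists>P. P \<noteq> 0 \<and> (2 * t \<le> s \<longrightarrow> (\<forall>c. poly P (- c) \<noteq> 0 \<longrightarrow> G t c))" for t
  proof (cases "2 * t \<le> s")
    case True
    show ?thesis
    proof (rule generic_plane_complement[OF I inj[OF _ True] e[OF True]], goal_cases)
      case (4 P)
      then have "G t c" if "poly P (- c) \<noteq> 0" for c
        unfolding G_def using that by blast
      with \<open>P \<noteq> 0\<close> show ?case by blast
    qed
  next
    case False
    then show ?thesis by (intro exI[of _ 1]) simp
  qed
  then obtain P where P0: "\<And>t. P t \<noteq> 0" and PG: "\<And>t c. 2 * t \<le> s \<Longrightarrow> poly (P t) (- c) \<noteq> 0 \<Longrightarrow> G t c"
    by metis
  have "(\<Prod>t\<le>s. P t) \<noteq> 0" using P0 by simp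
  then have "finite {z. poly (\<Prod>t\<le>s. P t) z = 0}" by (rule poly_roots_finite)
  then obtain z where z: "poly (\<Prod>t\<le>s. P t) z \<noteq> 0"
    using ex_new_if_finite[OF infinite_UNIV_char_0] by blast
  define c where "c = - z"
  have c: "poly (P t) (- c) \<noteq> 0" if "t \<le> s" for t
    using z that by (simp add: c_def poly_prod)
  have P: "\<exists>w\<in>supported (plane_exps d1 d2 t). \<exists>i\<in>I \<inter> forms t.
      restr g = restr i + restr (lin_subst (shear c) w)" if "2 * t \<le> s" "g \<in> forms t" for t g
  proof -
    have "t \<le> s" using that(1) by simp
    then show ?thesis using PG[OF that(1) c] that(2) unfolding G_def by blast
  qed
  have low: "\<exists>w\<in>supported (std_exps d1 d2 d3 t). g - lin_subst (shear c) w \<in> I"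
    if "2 * t \<le> s" "g \<in> forms t" for t g
    using that
  proof (induction t arbitrary: g)
    case 0
    obtain w i where wi: "w \<in> supported (plane_exps d1 d2 0)" "i \<in> I" "i \<in> forms 0"
        "restr g = restr i + restr (lin_subst (shear c) w)"
      using P[OF 0] by blast
    have w0: "w \<in> forms 0" using wi(1) plane_exps_forms by blast
    have "restr (g - i - lin_subst (shear c) w) = 0"
      using wi(4) by (simp add: ring_hom_diff[OF ring_hom_restr])
    then have "g - i - lin_subst (shear c) w = 0"
      using restr_kernel[of "g - i - lin_subst (shear c) w" 0]
        forms_diff[OF forms_diff[OF 0(2) wi(3)] lin_subst_forms[OF w0]] by (metis mult_zero_right)
    then have "g - lin_subst (shear c) w = i" by (simp add: algebra_simps)
    then have "g - lin_subst (shear c) w \<in> I" using wi(2) by simp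
    moreover have "w \<in> supported (std_exps d1 d2 d3 0)"
      using supported_mono[OF plane_exps_subset[OF d(2), of 0 d3]] wi(1) s by auto
    ultimately show ?case by blast
  next
    case (Suc t)
    obtain w i where wi: "w \<in> supported (plane_exps d1 d2 (Suc t))" "i \<in> I" "i \<in> forms (Suc t)"
        "restr g = restr i + restr (lin_subst (shear c) w)"
      using P[OF Suc.prems] by blast
    have w0: "w \<in> forms (Suc t)" using wi(1) plane_exps_forms by blast
    have "restr (g - i - lin_subst (shear c) w) = 0"
      using wi(4) by (simp add: ring_hom_diff[OF ring_hom_restr])
    then obtain g' where g': "g - i - lin_subst (shear c) w = Var 3 * g'" "g' \<in> forms t"
      using restr_kernel[of "g - i - lin_subst (shear c) w" "Suc t"]
        forms_diff[OF forms_diff[OF Suc.prems(2) wi(3)] lin_subst_forms[OF w0]] by (metis diff_Suc_1)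
    obtain w' where w': "w' \<in> supported (std_exps d1 d2 d3 t)" "g' - lin_subst (shear c) w' \<in> I"
      using Suc.IH[OF _ g'(2)] Suc.prems(1) by auto
    have "g - lin_subst (shear c) (w + Var 3 * w') = i + Var 3 * (g' - lin_subst (shear c) w')"
      using g'(1) by (simp add: ring_hom_add[OF ring_hom_lin_subst] ring_hom_mult[OF ring_hom_lin_subst]
          lin_subst_shear algebra_simps)
    also have "\<dots> \<in> I" by (rule graded_ideal_add[OF I wi(2) graded_ideal_mult[OF I w'(2)]])
    finally have 1: "g - lin_subst (shear c) (w + Var 3 * w') \<in> I" .
    have "Var 3 ^ 1 * w' \<in> supported (std_exps d1 d2 d3 (Suc t))"
      using w'(1) by (rule Var3_power_supported) (rule std_exps_shift, use Suc.prems s in auto)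
    moreover have "w \<in> supported (std_exps d1 d2 d3 (Suc t))"
      using supported_mono[OF plane_exps_subset[OF d(2), of "Suc t" d3]] wi(1) s Suc.prems(1) by auto
    ultimately have "w + Var 3 * w' \<in> supported (std_exps d1 d2 d3 (Suc t))"
      using pol.subspace_add[OF subspace_supported] by simp
    with 1 show ?case by blast
  qed
  show thesis
  proof (rule that[of c])
    fix t and g :: "'k pol3" assume g: "g \<in> forms t"
    have "2 * t \<le> s \<or> s < 2 * t \<and> t \<le> s \<or> s < t" by linarith
    then consider "2 * t \<le> s" | "s < 2 * t" "t \<le> s" | "s < t" by blast
    then show "\<exists>w\<in>supported (std_exps d1 d2 d3 t). g - lin_subst (shear c) w \<in> I"
    proof cases
      case 1
      then show ?thesis using low g by blast
    next
      case 2
      define u where "u = s - t"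
      have u: "2 * u \<le> s" "t = s - u" "s - 2 * u = t - u" "u \<le> t" using 2 by (auto simp: u_def)
      obtain g' where g': "g' \<in> forms u" "g - Var 3 ^ (t - u) * g' \<in> I"
        using lef[OF u(1), of g] g u(2,3) by auto
      obtain w where w: "w \<in> supported (std_exps d1 d2 d3 u)" "g' - lin_subst (shear c) w \<in> I"
        using low[OF u(1) g'(1)] by blast
      have "g - lin_subst (shear c) (Var 3 ^ (t - u) * w)
        = (g - Var 3 ^ (t - u) * g') + Var 3 ^ (t - u) * (g' - lin_subst (shear c) w)"
        by (simp add: ring_hom_mult[OF ring_hom_lin_subst] ring_hom_power[OF ring_hom_lin_subst]
            lin_subst_shear algebra_simps)
      also have "\<dots> \<in> I" by (rule graded_ideal_add[OF I g'(2) graded_ideal_mult[OF I w(2)]])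
      finally have "g - lin_subst (shear c) (Var 3 ^ (t - u) * w) \<in> I" .
      moreover have "Var 3 ^ (t - u) * w \<in> supported (std_exps d1 d2 d3 t)"
        using w(1) by (rule Var3_power_supported) (rule std_exps_shift, use 2 s in \<open>auto simp: u_def\<close>)
      ultimately show ?thesis by blast
    next
      case 3
      have "2 * hilbert I (int t) = 2 * hilbert I (int s - int t)" by (simp add: sym)
      also have "hilbert I (int s - int t) = 0" using 3 by (simp add: hilbert_def)
      finally have "pol.dim (forms t :: 'k pol3 set) = pol.dim (I \<inter> forms t)" by (simp add: hilbert_def)
      then have "I \<inter> forms t = forms t"
        by (intro pol.fin_dim_subspace_eq[OF fin_dim_forms subspace_graded_part[OF I] subspace_forms]) auto
      then have "g - lin_subst (shear c) 0 \<in> I"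
        using g by (auto simp: ring_hom_0[OF ring_hom_lin_subst])
      moreover have "0 \<in> (supported (std_exps d1 d2 d3 t) :: 'k pol3 set)"
        by (rule pol.subspace_0[OF subspace_supported])
      ultimately show ?thesis by blast
    qed
  qed
qed

section \<open>Moving a linear form to \<open>x\<^sub>3\<close>\<close>

lemma linear_form_eq:
  assumes "l \<in> forms 1"
  shows "l = Const (Poly_Mapping.lookup l (expo 1 0 0)) * Var 1 + Const (Poly_Mapping.lookup l (expo 0 1 0)) * Var 2
    + Const (Poly_Mapping.lookup l (expo 0 0 1)) * (Var 3 :: 'k::field pol3)"
proof -
  have ne: "expo 1 0 0 \<noteq> expo 0 1 0" "expo 1 0 0 \<noteq> expo 0 0 1" "expo 0 1 0 \<noteq> expo 0 0 1"
    by (metis lookup_expo(1) zero_neq_one, metis lookup_expo(1) zero_neq_one, metis lookup_expo(2) zero_neq_one)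
  have "Poly_Mapping.keys l \<subseteq> {expo 1 0 0, expo 0 1 0, expo 0 0 1}"
  proof
    fix m assume m: "m \<in> Poly_Mapping.keys l"
    obtain a b c where abc: "m = expo a b c" using expo_lookup[of m] by metis
    have "a + b + c = 1" using assms m by (auto simp: forms_def abc)
    then have "a = 1 \<and> b = 0 \<and> c = 0 \<or> a = 0 \<and> b = 1 \<and> c = 0 \<or> a = 0 \<and> b = 0 \<and> c = 1" by linarith
    then show "m \<in> {expo 1 0 0, expo 0 1 0, expo 0 0 1}" unfolding abc by blast
  qed
  from mpol_eq_sum[OF _ this] ne show ?thesis by (simp add: monom_of_expo add.assoc)
qed

text \<open>A nonzero vector and two suitable unit vectors are the columns of an invertible matrix.\<close>

lemma exists_invertible_column:
  fixes v :: "3 \<Rightarrow> 'k::field"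
  assumes "v 1 \<noteq> 0 \<or> v 2 \<noteq> 0 \<or> v 3 \<noteq> 0"
  obtains A :: "'k ^ 3 ^ 3" where "invertible A" "\<And>i. A $ i $ 3 = v i"
proof -
  define M :: "3 \<Rightarrow> 3 \<Rightarrow> 'k ^ 3 ^ 3" where
    "M p q = (\<chi> i j. if j = 1 then (if i = p then 1 else 0) else if j = 2 then (if i = q then 1 else 0) else v i)" for p q
  have c: "M p q $ i $ 3 = v i" for p q i using distinct_3 by (simp add: M_def)
  have "v 3 \<noteq> 0 \<Longrightarrow> invertible (M 1 2)" "v 2 \<noteq> 0 \<Longrightarrow> invertible (M 1 3)" "v 1 \<noteq> 0 \<Longrightarrow> invertible (M 2 3)"
    using distinct_3 by (simp_all add: invertible_det_nz det_3 M_def)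
  then show thesis using assms that c by metis
qed

lemma exists_lin_subst_Var3:
  assumes l: "l \<in> forms 1" "l \<noteq> (0 :: 'k::field pol3)"
  obtains A where "invertible A" "lin_subst A (Var 3) = l"
proof -
  define v :: "3 \<Rightarrow> 'k" where "v i = Poly_Mapping.lookup l
    (if i = 1 then expo 1 0 0 else if i = 2 then expo 0 1 0 else expo 0 0 1)" for i
  have l_eq: "l = Const (v 1) * Var 1 + Const (v 2) * Var 2 + Const (v 3) * Var 3"
    using linear_form_eq[OF l(1)] distinct_3 by (simp add: v_def)
  have "v 1 \<noteq> 0 \<or> v 2 \<noteq> 0 \<or> v 3 \<noteq> 0"
  proof (rule ccontr)
    assume "\<not> ?thesis"
    then have "l = 0" using l_eq by (simp add: ring_hom_0[OF ring_hom_Const])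
    with l(2) show False by simp
  qed
  then obtain A :: "'k ^ 3 ^ 3" where A: "invertible A" "\<And>i. A $ i $ 3 = v i"
    using exists_invertible_column by metis
  have "lin_subst A (Var 3) = l" unfolding l_eq lin_subst_Var lin_form_def sum_3 A(2) ..
  then show thesis using A(1) that by metis
qed

section \<open>Complements and their openness\<close>

lemma std_exps_forms: "supported (std_exps d1 d2 d3 t) \<subseteq> (forms t :: 'k::field pol3 set)"
  unfolding forms_eq_supported by (rule supported_mono) (auto simp: std_exps_def)

text \<open>A set of at most \<open>dim (S/L)\<^sub>t\<close> monomials of degree \<open>t\<close> spans \<open>S/L\<close> in degree \<open>t\<close> if and only if it
  has exactly this number of elements and is independent modulo \<open>L\<close>.\<close>

lemma dim_complement:
  fixes L :: "'k::field pol3 set"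
  assumes L: "graded_ideal L" and A: "supported A \<subseteq> (forms t :: 'k pol3 set)" "finite A"
  shows "(\<forall>g\<in>forms t. \<exists>w\<in>supported A. g - w \<in> L) \<and> int (card A) \<le> hilbert L (int t) \<longleftrightarrow>
    L \<inter> supported A = {0} \<and> int (card A) = hilbert L (int t)"
proof -
  let ?W = "supported A :: 'k pol3 set" and ?U = "L \<inter> forms t"
  let ?S = "{x + y | x y. x \<in> ?U \<and> y \<in> ?W}"
  note W = subspace_supported[of A, where 'k = 'k] fin_dim_supported[OF A(2), where 'k = 'k]
  have U: "pol.subspace ?U" "pol.fin_dim ?U" by (rule subspace_graded_part[OF L], rule fin_dim_graded_part)
  have d: "pol.dim ?S + pol.dim (?U \<inter> ?W) = pol.dim ?U + card A"
    using pol.dim_sum_Int[OF U W] dim_supported[OF A(2), where 'k = 'k] by simp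
  have UW: "?U \<inter> ?W = L \<inter> ?W" using A(1) by blast
  have S: "pol.subspace ?S" "?S \<subseteq> forms t"
    using pol.subspace_sums[OF U(1) W(1)] A(1) forms_add by blast+
  have full: "(\<forall>g\<in>forms t. \<exists>w\<in>?W. g - w \<in> L) \<longleftrightarrow> ?S = forms t"
  proof
    assume *: "\<forall>g\<in>forms t. \<exists>w\<in>?W. g - w \<in> L"
    have "g \<in> ?S" if g: "g \<in> forms t" for g
    proof -
      obtain w where w: "w \<in> ?W" "g - w \<in> L" using * g by blast
      have "g - w \<in> ?U" using w A(1) g forms_diff by blast
      moreover have "g = (g - w) + w" by simp
      ultimately show ?thesis using w(1) by blast
    qed
    then show "?S = forms t" using S(2) by blast
  next
    assume S: "?S = forms t"
    show "\<forall>g\<in>forms t. \<exists>w\<in>?W. g - w \<in> L"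
    proof
      fix g :: "'k pol3" assume "g \<in> forms t"
      then have "g \<in> ?S" unfolding S .
      then obtain x w where "g = x + w" "x \<in> L" "w \<in> ?W" by blast
      then show "\<exists>w\<in>?W. g - w \<in> L" by (intro bexI[of _ w]) simp_all
    qed
  qed
  have dimS: "?S = forms t \<longleftrightarrow> pol.dim ?S = pol.dim (forms t :: 'k pol3 set)"
  proof
    assume "pol.dim ?S = pol.dim (forms t :: 'k pol3 set)"
    then show "?S = forms t"
      by (intro pol.fin_dim_subspace_eq[OF fin_dim_forms S(1) subspace_forms S(2)]) simp
  qed (simp only:)
  have le: "pol.dim ?S \<le> pol.dim (forms t :: 'k pol3 set)"
    by (rule pol.fin_dim_dim_mono[OF fin_dim_forms subspace_forms S(2)])
  have dim0: "pol.dim (L \<inter> ?W) = 0 \<longleftrightarrow> L \<inter> ?W = {0}"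
  proof
    assume 0: "pol.dim (L \<inter> ?W) = 0"
    have sub: "pol.subspace (L \<inter> ?W)" by (intro pol.subspace_inter subspace_graded_ideal L W)
    have "{0} = L \<inter> ?W"
      by (rule pol.fin_dim_subspace_eq[OF _ pol.subspace_single_0 sub])
        (use 0 pol.fin_dim_subset[OF W(2)] pol.subspace_0[OF sub] in auto)
    then show "L \<inter> ?W = {0}" ..
  next
    assume "L \<inter> ?W = {0}"
    then show "pol.dim (L \<inter> ?W) = 0" using pol.dim_le_card[of "L \<inter> ?W" "{}"] by simp
  qed
  have h: "hilbert L (int t) = int (pol.dim (forms t :: 'k pol3 set)) - int (pol.dim ?U)"
    by (simp add: hilbert_def)
  show ?thesis
    unfolding full dimS dim0[symmetric] using d le h UW by auto
qed

text \<open>The value of a polynomial in the entries of a matrix.\<close>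

definition eval_matrix :: "'k::field ^ 3 ^ 3 \<Rightarrow> (3 \<times> 3, 'k) mpol \<Rightarrow> 'k" where
  "eval_matrix A = eval_poly id (\<lambda>(i, j). A $ i $ j)"

lemma ring_hom_eval_matrix: "ring_hom (eval_matrix A)"
  unfolding eval_matrix_def by (rule ring_hom_eval_poly[OF ring_hom_id])

text \<open>The substitution by a matrix of indeterminates; its coefficients are polynomials in these, and
  specializing them gives back \<open>lin_subst\<close>.\<close>

definition generic_subst :: "'k::field pol3 \<Rightarrow> (3, (3 \<times> 3, 'k) mpol) mpol" where
  "generic_subst = eval_poly (\<lambda>c. Const (Const c)) (\<lambda>j. \<Sum>i\<in>UNIV. Const (Var (i, j)) * Var i)"

lemma lookup_generic_subst:
  "eval_matrix A (Poly_Mapping.lookup (generic_subst g) m) = Poly_Mapping.lookup (lin_subst A g) m"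
proof -
  define \<sigma> where "\<sigma> = (eval_poly (\<lambda>d. Const (eval_matrix A d)) Var :: (3, (3 \<times> 3, 'a) mpol) mpol \<Rightarrow> 'a pol3)"
  have h: "ring_hom (\<lambda>d. Const (eval_matrix A d) :: 'a pol3)"
    by (rule ring_hom_comp[OF ring_hom_Const ring_hom_eval_matrix])
  have \<sigma>: "ring_hom \<sigma>" unfolding \<sigma>_def by (rule ring_hom_eval_poly[OF h])
  have cc: "ring_hom (\<lambda>c :: 'a. Const (Const c) :: (3, (3 \<times> 3, 'a) mpol) mpol)"
    by (rule ring_hom_comp[OF ring_hom_Const ring_hom_Const])
  have "\<sigma> (generic_subst g) = eval_poly (\<lambda>c. \<sigma> (Const (Const c))) (\<lambda>j. \<sigma> (\<Sum>i\<in>UNIV. Const (Var (i, j)) * Var i)) g"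
    unfolding generic_subst_def by (rule hom_eval_poly[OF \<sigma> cc])
  also have "(\<lambda>c. \<sigma> (Const (Const c))) = Const"
    unfolding \<sigma>_def eval_poly_Const[OF h] by (simp add: eval_matrix_def eval_poly_Const[OF ring_hom_id])
  also have "(\<lambda>j. \<sigma> (\<Sum>i\<in>UNIV. Const (Var (i, j)) * Var i)) = lin_form A"
    unfolding ring_hom_sum[OF \<sigma>] ring_hom_mult[OF \<sigma>]
    unfolding \<sigma>_def eval_poly_Const[OF h] eval_poly_Var[OF h]
    by (rule ext) (simp add: lin_form_def eval_matrix_def eval_poly_Var[OF ring_hom_id])
  finally have "\<sigma> (generic_subst g) = lin_subst A g" by (simp add: lin_subst_eq)
  then show ?thesis
    using eval_poly_map_coeffs[OF ring_hom_eval_matrix, of A "generic_subst g" m] by (simp add: \<sigma>_def)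
qed

text \<open>That \<open>I\<close>, moved by a matrix, avoids a given span of monomials is an open condition on the matrix.\<close>

lemma disjoint_supported_open:
  fixes I :: "'k::field pol3 set"
  assumes I: "graded_ideal I" and A0: "\<And>f. f \<in> I \<inter> forms t \<Longrightarrow> lin_subst A0 f \<in> supported M \<Longrightarrow> f = 0"
  obtains P where "eval_matrix A0 P \<noteq> 0" "\<And>A f. eval_matrix A P \<noteq> 0 \<Longrightarrow> f \<in> I \<inter> forms t \<Longrightarrow>
    lin_subst A f \<in> supported M \<Longrightarrow> f = 0"
proof -
  obtain B where B: "B \<subseteq> I \<inter> forms t" "pol.independent B" "pol.span B = I \<inter> forms t" "finite B"
    using pol.extend_to_basis[OF fin_dim_graded_part subspace_graded_part[OF I] empty_subsetI pol.independent_empty]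
    by metis
  define v where "v = (\<lambda>(g :: 'k pol3) m. if m \<in> M then 0 else Poly_Mapping.lookup (generic_subst g) m)"
  have lk: "Poly_Mapping.lookup (lin_subst A (\<Sum>g\<in>B. Const (c g) * g)) m
      = (\<Sum>g\<in>B. c g * eval_matrix A (Poly_Mapping.lookup (generic_subst g) m))" for A c m
    by (simp add: ring_hom_sum[OF ring_hom_lin_subst] ring_hom_mult[OF ring_hom_lin_subst] lin_subst_Const
        lookup_sum lookup_Const_times lookup_generic_subst)
  have supp: "lin_subst A (\<Sum>g\<in>B. Const (c g) * g) \<in> supported M \<longleftrightarrow>
      (\<forall>m. (\<Sum>g\<in>B. c g * eval_matrix A (v g m)) = 0)" for A c
  proof -
    have "(\<Sum>g\<in>B. c g * eval_matrix A (v g m)) = (if m \<in> M then 0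
        else \<Sum>g\<in>B. c g * eval_matrix A (Poly_Mapping.lookup (generic_subst g) m))" for m
      by (simp add: v_def ring_hom_0[OF ring_hom_eval_matrix])
    then show ?thesis unfolding supported_iff lk by simp
  qed
  have "indep_family B (\<lambda>g m. eval_matrix A0 (v g m))"
    unfolding indep_family_def supp[symmetric]
  proof (intro allI impI)
    fix c assume *: "lin_subst A0 (\<Sum>g\<in>B. Const (c g) * g) \<in> supported M"
    have "(\<Sum>g\<in>B. Const (c g) * g) \<in> pol.span B"
      by (intro pol.span_sum pol.span_scale pol.span_base)
    then have "(\<Sum>g\<in>B. Const (c g) * g) = 0" using A0 * B(3) by blast
    then show "\<forall>g\<in>B. c g = 0" using pol.independentD[OF B(2,4) order_refl] by blast
  qed
  then obtain P where P: "eval_matrix A0 P \<noteq> 0" and ind: "\<And>\<phi> :: (3 \<times> 3, 'k) mpol \<Rightarrow> 'k. ring_hom \<phi> \<Longrightarrow>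
      \<phi> P \<noteq> 0 \<Longrightarrow> indep_family B (\<lambda>g m. \<phi> (v g m))"
    using indep_family_open[OF B(4) ring_hom_eval_matrix, of A0 v, where 'k = 'k] by blast
  show thesis
  proof (rule that[OF P])
    fix A f assume A: "eval_matrix A P \<noteq> 0" and f: "f \<in> I \<inter> forms t" "lin_subst A f \<in> supported M"
    obtain c where c: "f = (\<Sum>g\<in>B. Const (c g) * g)"
      using f(1) unfolding B(3)[symmetric] pol.span_finite[OF B(4)] by auto
    have "\<forall>g\<in>B. c g = 0"
      using ind[OF ring_hom_eval_matrix A] f(2) unfolding c supp indep_family_def by blast
    then show "f = 0" unfolding c by (simp add: ring_hom_0[OF ring_hom_Const])
  qed
qed

section \<open>Initial ideals\<close>

lemma grevlex_less_asym: "grevlex_less m n \<Longrightarrow> \<not> grevlex_less n m"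
  by (auto simp: grevlex_less_def)

lemma grevlex_less_expo: "grevlex_less (expo a b c) (expo a' b' c') \<longleftrightarrow>
    a + b + c < a' + b' + c' \<or> a + b + c = a' + b' + c' \<and> (c > c' \<or> c = c' \<and> b > b')"
  by (simp add: grevlex_less_def)

lemma grevlex_less_irrefl: "\<not> grevlex_less m m"
  by (simp add: grevlex_less_def)

context
  fixes d1 d2 d3 :: nat and L :: "'k::field pol3 set"
  assumes L: "graded_ideal L"
    and spanning: "\<And>t g. g \<in> forms t \<Longrightarrow> \<exists>w\<in>supported (std_exps d1 d2 d3 t). g - w \<in> L"
    and disjoint: "\<And>t. L \<inter> supported (std_exps d1 d2 d3 t) = {0}"
begin

text \<open>A monomial that is not complementary is congruent modulo \<open>L\<close> to a combination of smaller
  complementary ones.\<close>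

lemma reduce_monom:
  assumes m: "m \<notin> std_exps d1 d2 d3 (deg_exp m)"
  obtains w where "w \<in> supported {n \<in> std_exps d1 d2 d3 (deg_exp m). grevlex_less n m}" "monom_of m - w \<in> L"
proof -
  obtain a b c where abc: "m = expo a b c" using expo_lookup[of m] by metis
  show thesis
  proof (cases "2 * a + 2 * b + c + 3 \<le> d1 + d2 + d3")
    case False
    \<comment> \<open>Every complementary monomial of the degree of \<open>m\<close> contains a higher power of \<open>x\<^sub>3\<close>.\<close>
    obtain w where w: "w \<in> supported (std_exps d1 d2 d3 (deg_exp m))" "monom_of m - w \<in> L"
      using spanning[of "monom_of m" "deg_exp m"] by (auto simp: monom_of_forms)
    have "grevlex_less n m" if n: "n \<in> std_exps d1 d2 d3 (deg_exp m)" for n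
    proof -
      obtain a' b' c' where n': "n = expo a' b' c'" using expo_lookup[of n] by metis
      have "a' + b' + c' = a + b + c" "2 * a' + 2 * b' + c' + 3 \<le> d1 + d2 + d3"
        using n by (simp_all add: abc n' expo_std_exps)
      then have "c' > c" using False by linarith
      then show ?thesis using \<open>a' + b' + c' = a + b + c\<close> by (simp add: abc n' grevlex_less_expo)
    qed
    then have "supported (std_exps d1 d2 d3 (deg_exp m))
      \<subseteq> (supported {n \<in> std_exps d1 d2 d3 (deg_exp m). grevlex_less n m} :: 'k pol3 set)"
      by (intro supported_mono) blast
    then show thesis using that w by blast
  next
    case True
    \<comment> \<open>Reduce \<open>x\<^sub>1^a x\<^sub>2^b\<close> and multiply by \<open>x\<^sub>3^c\<close>, which does not leave the complement.\<close>
    obtain w where w: "w \<in> supported (std_exps d1 d2 d3 (a + b))" "monom_of (expo a b 0) - w \<in> L"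
      using spanning[of "monom_of (expo a b 0)" "a + b"] by (auto simp: monom_of_forms)
    have "Var 3 ^ c * w \<in> supported {n \<in> std_exps d1 d2 d3 (deg_exp m). grevlex_less n m}"
      using w(1)
    proof (rule Var3_power_supported)
      fix n assume n: "n \<in> std_exps d1 d2 d3 (a + b)"
      obtain a' b' c' where n': "n = expo a' b' c'" using expo_lookup[of n] by metis
      have eq: "a' + b' + c' = a + b" and le: "a' < d1" "2 * a' + b' + 2 \<le> d1 + d2"
        using n by (simp_all add: n' expo_std_exps)
      have std: "n + expo 0 0 c \<in> std_exps d1 d2 d3 (deg_exp m)"
        using True eq le by (simp add: n' expo_add abc expo_std_exps)
      have "c' > 0 \<or> c' = 0 \<and> b' > b"
      proof (cases "c' = 0")
        case True
        have "\<not> (a < d1 \<and> 2 * a + b + 2 \<le> d1 + d2)"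
          using m \<open>2 * a + 2 * b + c + 3 \<le> d1 + d2 + d3\<close> by (simp add: abc expo_std_exps)
        then have "a' < a" using eq le True by linarith
        then show ?thesis using eq True by linarith
      qed simp
      then have "grevlex_less (n + expo 0 0 c) m"
        using eq by (auto simp: n' expo_add abc grevlex_less_expo)
      with std show "n + expo 0 0 c \<in> {n \<in> std_exps d1 d2 d3 (deg_exp m). grevlex_less n m}" by blast
    qed
    moreover have "monom_of m - Var 3 ^ c * w = Var 3 ^ c * (monom_of (expo a b 0) - w)"
      by (simp add: abc monom_of_expo right_diff_distrib mult_ac)
    then have "monom_of m - Var 3 ^ c * w \<in> L" using graded_ideal_mult[OF L w(2)] by simp
    ultimately show thesis by (rule that)
  qed
qed

lemma initial_exponents:
  "{m. \<exists>f\<in>L. is_initial_exp f m} = {m. m \<notin> std_exps d1 d2 d3 (deg_exp m)}"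
proof (intro equalityI subsetI CollectI)
  fix n assume "n \<in> {m. \<exists>f\<in>L. is_initial_exp f m}"
  then obtain f where f: "f \<in> L" "n \<in> Poly_Mapping.keys f"
    and less: "\<And>m. m \<in> Poly_Mapping.keys f \<Longrightarrow> m \<noteq> n \<Longrightarrow> grevlex_less m n"
    by (auto simp: is_initial_exp_def)
  define t where "t = deg_exp n"
  show "n \<notin> std_exps d1 d2 d3 (deg_exp n)"
  proof
    assume n: "n \<in> std_exps d1 d2 d3 (deg_exp n)"
    define h where "h = hcomp t f"
    define N where "N = {m \<in> Poly_Mapping.keys h. m \<notin> std_exps d1 d2 d3 t}"
    have keys: "m \<in> Poly_Mapping.keys f" "deg_exp m = t" if "m \<in> Poly_Mapping.keys h" for m
      using that by (auto simp: h_def in_keys_iff lookup_hcomp)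
    have "\<exists>w. w \<in> supported {k \<in> std_exps d1 d2 d3 t. grevlex_less k m} \<and> monom_of m - w \<in> L"
      if m: "m \<in> N" for m
    proof -
      have "deg_exp m = t" using m keys by (simp add: N_def)
      moreover have "m \<notin> std_exps d1 d2 d3 t" using m by (simp add: N_def)
      ultimately show ?thesis using reduce_monom[of m] by metis
    qed
    then have "\<forall>m\<in>N. \<exists>w. w \<in> supported {k \<in> std_exps d1 d2 d3 t. grevlex_less k m} \<and> monom_of m - w \<in> L"
      by blast
    from bchoice[OF this] obtain w where w: "\<And>m. m \<in> N \<Longrightarrow> w m \<in> supported {k \<in> std_exps d1 d2 d3 t. grevlex_less k m}"
      "\<And>m. m \<in> N \<Longrightarrow> monom_of m - w m \<in> L" by blast
    let ?c = "\<lambda>m. Const (Poly_Mapping.lookup h m) :: 'k pol3"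
    \<comment> \<open>Reducing the monomials of \<open>h\<close> outside the complement does not change the coefficient of \<open>n\<close>.\<close>
    define r where "r = h - (\<Sum>m\<in>N. ?c m * (monom_of m - w m))"
    have rL: "r \<in> L"
      unfolding r_def h_def
      by (intro graded_ideal_diff[OF L] graded_ideal_hcomp[OF L f(1)] graded_ideal_sum[OF L]
          graded_ideal_mult[OF L] w(2)[unfolded h_def])
    have fin: "finite N" "N \<subseteq> Poly_Mapping.keys h" by (auto simp: N_def)
    have r_eq: "r = (\<Sum>m\<in>Poly_Mapping.keys h - N. ?c m * monom_of m) + (\<Sum>m\<in>N. ?c m * w m)"
    proof -
      have "h = (\<Sum>m\<in>Poly_Mapping.keys h. ?c m * monom_of m)" by (rule mpol_eq_sum) simp_all
      also have "\<dots> = (\<Sum>m\<in>Poly_Mapping.keys h - N. ?c m * monom_of m) + (\<Sum>m\<in>N. ?c m * monom_of m)"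
        by (rule sum.subset_diff) (use fin in auto)
      finally have "h - (\<Sum>m\<in>N. ?c m * monom_of m) = (\<Sum>m\<in>Poly_Mapping.keys h - N. ?c m * monom_of m)"
        by (simp add: algebra_simps)
      then show ?thesis unfolding r_def right_diff_distrib sum_subtractf by (simp add: algebra_simps)
    qed
    have "r \<in> supported (std_exps d1 d2 d3 t)"
      unfolding r_eq
    proof (intro pol.subspace_add[OF subspace_supported] pol.subspace_sum[OF subspace_supported]
        pol.subspace_scale[OF subspace_supported])
      show "(monom_of m :: 'k pol3) \<in> supported (std_exps d1 d2 d3 t)" if "m \<in> Poly_Mapping.keys h - N" for m
        using that by (intro monom_of_supported) (simp add: N_def)
      show "w m \<in> supported (std_exps d1 d2 d3 t)" if "m \<in> N" for m
        using w(1)[OF that] by (auto simp: supported_def)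
    qed
    then have "r = 0" using rL disjoint[of t] by blast
    moreover have "Poly_Mapping.lookup r n = Poly_Mapping.lookup f n"
    proof -
      have "Poly_Mapping.lookup (?c m * (monom_of m - w m)) n = 0" if m: "m \<in> N" for m
      proof -
        have mn: "m \<noteq> n" using m n by (auto simp: N_def t_def)
        then have "grevlex_less m n" using less m keys by (simp add: N_def)
        then have "\<not> grevlex_less n m" by (rule grevlex_less_asym)
        then have "Poly_Mapping.lookup (w m) n = 0" using w(1)[OF m] by (simp add: supported_iff)
        then show ?thesis using mn by (simp add: lookup_Const_times lookup_minus lookup_monom_of)
      qed
      then have "Poly_Mapping.lookup r n = Poly_Mapping.lookup h n"
        by (simp add: r_def lookup_minus lookup_sum)
      then show ?thesis by (simp add: h_def lookup_hcomp t_def)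
    qed
    ultimately show False using f(2) by (simp add: in_keys_iff)
  qed
next
  fix m assume "m \<in> {m. m \<notin> std_exps d1 d2 d3 (deg_exp m)}"
  then have m: "m \<notin> std_exps d1 d2 d3 (deg_exp m)" by simp
  obtain w where w: "w \<in> supported {n \<in> std_exps d1 d2 d3 (deg_exp m). grevlex_less n m}"
      "monom_of m - w \<in> L" using reduce_monom[OF m] by metis
  have "Poly_Mapping.lookup w m = 0" using w(1) by (simp add: supported_iff grevlex_less_irrefl)
  then have "m \<in> Poly_Mapping.keys (monom_of m - w)"
    by (simp add: in_keys_iff lookup_minus lookup_monom_of)
  moreover have "grevlex_less n m" if n: "n \<in> Poly_Mapping.keys (monom_of m - w)" "n \<noteq> m" for n
  proof -
    have "n \<in> Poly_Mapping.keys w"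
      using n by (simp add: in_keys_iff lookup_minus lookup_monom_of)
    then show ?thesis using w(1) by (auto simp: supported_def)
  qed
  ultimately show "\<exists>f\<in>L. is_initial_exp f m" using w(2) by (auto simp: is_initial_exp_def)
qed

lemma initial_ideal_eq:
  "initial_ideal L = ideal_gen (monom_of ` {m. m \<notin> std_exps d1 d2 d3 (deg_exp m)})"
proof -
  have "{monom_of m | f m. f \<in> L \<and> is_initial_exp f m}
    = (monom_of ` {m. \<exists>f\<in>L. is_initial_exp f m} :: 'k pol3 set)" by auto
  then show ?thesis unfolding initial_ideal_def initial_exponents by simp
qed

end

section \<open>Uniqueness of generic initial ideals\<close>

text \<open>On the line joining a point of one set to a point of the other, each open condition excludes
  only finitely many points.\<close>

lemma zariski_open_GL3_meet:
  fixes U V :: "('k::field_char_0 ^ 3 ^ 3) set"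
  assumes "zariski_open_GL3 U" "zariski_open_GL3 V" "U \<noteq> {}" "V \<noteq> {}"
  shows "U \<inter> V \<noteq> {}"
proof -
  obtain P Q where U: "U = {A. invertible A \<and> (\<exists>p\<in>P. eval_matrix A p \<noteq> 0)}"
    and V: "V = {A. invertible A \<and> (\<exists>p\<in>Q. eval_matrix A p \<noteq> 0)}"
    using assms(1,2) unfolding zariski_open_GL3_def eval_matrix_def by blast
  obtain A p where A: "invertible A" "p \<in> P" "eval_matrix A p \<noteq> 0" using assms(3) U by blast
  obtain B q where B: "invertible B" "q \<in> Q" "eval_matrix B q \<noteq> 0" using assms(4) V by blast
  define M where "M = (\<lambda>i j. [:A $ i $ j, B $ i $ j - A $ i $ j:])"
  define C :: "'k \<Rightarrow> 'k ^ 3 ^ 3" where "C z = (\<chi> i j. poly (M i j) z)" for z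
  have C01: "C 0 = A" "C 1 = B" by (simp_all add: C_def M_def vec_eq_iff)
  define r where "r = (\<lambda>p. eval_poly (\<lambda>c :: 'k. [:c:]) (\<lambda>(i, j). M i j) p)"
  have r: "poly (r p) z = eval_matrix (C z) p" for p z
  proof -
    have h: "ring_hom (\<lambda>q. poly q z)" by (simp add: ring_hom_def)
    have "(\<lambda>x. poly (case x of (i, j) \<Rightarrow> M i j) z) = (\<lambda>(i, j). C z $ i $ j)"
      by (rule ext) (simp add: C_def split: prod.split)
    then show ?thesis
      using hom_eval_poly[OF h ring_hom_pCons, of "\<lambda>(i, j). M i j" p]
      by (simp add: r_def eval_matrix_def id_def)
  qed
  define d where "d = det (\<chi> i j. M i j)"
  have d: "poly d z = det (C z)" for z by (simp add: d_def C_def det_3)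
  have "r p \<noteq> 0" "r q \<noteq> 0" "d \<noteq> 0"
    using r[of p 0] r[of q 1] d[of 0] A B by (auto simp: C01 invertible_det_nz)
  then have "r p * r q * d \<noteq> 0" by simp
  then have "finite {z. poly (r p * r q * d) z = 0}" by (rule poly_roots_finite)
  then obtain z where "poly (r p * r q * d) z \<noteq> 0"
    using ex_new_if_finite[OF infinite_UNIV_char_0] by blast
  then have "invertible (C z)" "eval_matrix (C z) p \<noteq> 0" "eval_matrix (C z) q \<noteq> 0"
    by (auto simp: r d invertible_det_nz)
  then have "C z \<in> U \<inter> V" using U V A(2) B(2) by blast
  then show ?thesis by blast
qed

lemma Gin_eqI:
  fixes I :: "'k::field_char_0 pol3 set"
  assumes "is_Gin I J" shows "Gin I = J"
  unfolding Gin_def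
proof (rule the_equality)
  fix J' assume "is_Gin I J'"
  then obtain V where V: "zariski_open_GL3 V" "V \<noteq> {}" "\<forall>A\<in>V. initial_ideal (lin_subst A ` I) = J'"
    unfolding is_Gin_def by blast
  obtain U where U: "zariski_open_GL3 U" "U \<noteq> {}" "\<forall>A\<in>U. initial_ideal (lin_subst A ` I) = J"
    using assms unfolding is_Gin_def by blast
  obtain A where "A \<in> U" "A \<in> V" using zariski_open_GL3_meet[OF U(1) V(1) U(2) V(2)] by blast
  then show "J' = J" using U(3) V(3) by metis
qed fact

section \<open>The generic initial ideal of a complete intersection\<close>

text \<open>If \<open>l\<close> is a strong Lefschetz element, the complementary monomials span \<open>S/I\<close> in coordinates in
  which \<open>l\<close> becomes \<open>x\<^sub>3\<close> and \<open>x\<^sub>2\<close> is generic.\<close>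

lemma exists_std_spanning:
  fixes I :: "'k::field_char_0 pol3 set"
  assumes d: "0 < d1" "d1 \<le> d2" "d2 < d3" "d1 + d2 \<le> d3 + 1" and s: "s + 3 = d1 + d2 + d3"
    and I: "graded_ideal I"
    and h: "\<And>t. 2 * hilbert I t = ci_hilbert2 (int d1) (int d2) (int d3) t"
    and l: "l \<in> forms 1" "l \<noteq> 0"
    and lef: "\<And>u g. 2 * u \<le> s \<Longrightarrow> g \<in> forms (s - u) \<Longrightarrow> \<exists>g'\<in>forms u. g - l ^ (s - 2 * u) * g' \<in> I"
  obtains A where "invertible A"
    "\<And>t g. g \<in> forms t \<Longrightarrow> \<exists>w\<in>supported (std_exps d1 d2 d3 t). g - w \<in> lin_subst A ` I"
proof -
  obtain B where B: "invertible B" "lin_subst B (Var 3) = l" using exists_lin_subst_Var3[OF l] by metis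
  obtain B' where B': "invertible B'" "\<And>f. lin_subst B (lin_subst B' f) = f" "\<And>f. lin_subst B' (lin_subst B f) = f"
    using lin_subst_inverse[OF B(1)] by metis
  define I' where "I' = lin_subst B' ` I"
  have I': "graded_ideal I'" unfolding I'_def by (rule graded_ideal_lin_subst[OF B'(1) I])
  have h': "2 * hilbert I' t = ci_hilbert2 (int d1) (int d2) (int d3) t" for t
    unfolding I'_def hilbert_lin_subst[OF B'(1) I] by (rule h)
  have lef': "\<exists>g'\<in>forms u. g - Var 3 ^ (s - 2 * u) * g' \<in> I'" if u: "2 * u \<le> s" and g: "g \<in> forms (s - u)" for u g
  proof -
    obtain g' where g': "g' \<in> forms u" "lin_subst B g - l ^ (s - 2 * u) * g' \<in> I"
      using lef[OF u lin_subst_forms[OF g]] by blast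
    have "lin_subst B' (lin_subst B g - l ^ (s - 2 * u) * g') = g - Var 3 ^ (s - 2 * u) * lin_subst B' g'"
      by (simp add: ring_hom_diff[OF ring_hom_lin_subst] ring_hom_mult[OF ring_hom_lin_subst]
          ring_hom_power[OF ring_hom_lin_subst] B'(3) flip: B(2))
    then have "g - Var 3 ^ (s - 2 * u) * lin_subst B' g' \<in> I'" using g'(2) unfolding I'_def by (metis imageI)
    then show ?thesis using lin_subst_forms[OF g'(1)] by blast
  qed
  obtain c where c: "\<And>t g. g \<in> forms t \<Longrightarrow>
      \<exists>w\<in>supported (std_exps d1 d2 d3 t). g - lin_subst (shear c) w \<in> I'"
    using std_spanning_shear[OF d s I' h' lef'] by metis
  obtain D where D: "invertible D" "\<And>f. lin_subst D (lin_subst (shear c) f) = f"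
    using lin_subst_inverse[OF invertible_shear] by metis
  show thesis
  proof (rule that)
    show "invertible (D ** B')" using D(1) B'(1) by (rule invertible_mult)
    fix t and g :: "'k pol3" assume "g \<in> forms t"
    then obtain w where w: "w \<in> supported (std_exps d1 d2 d3 t)" "lin_subst (shear c) g - lin_subst (shear c) w \<in> I'"
      using c[OF lin_subst_forms] by blast
    then obtain f where f: "f \<in> I" "lin_subst (shear c) g - lin_subst (shear c) w = lin_subst B' f"
      unfolding I'_def by blast
    have "lin_subst (D ** B') f = lin_subst D (lin_subst (shear c) g - lin_subst (shear c) w)"
      unfolding f(2) lin_subst_lin_subst ..
    then have "g - w = lin_subst (D ** B') f"
      unfolding ring_hom_diff[OF ring_hom_lin_subst] D(2) by simp
    then show "\<exists>w\<in>supported (std_exps d1 d2 d3 t). g - w \<in> lin_subst (D ** B') ` I" using w(1) f(1) by blast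
  qed
qed

lemma Gin_complete_intersection:
  fixes f1 f2 f3 :: "'k::field_char_0 pol3"
  assumes d: "2 \<le> d1" "d1 < d2" "d2 < d3" "d1 + d2 \<le> d3 + 1"
    and f: "f1 \<in> forms d1" "f2 \<in> forms d2" "f3 \<in> forms d3"
    and reg: "regular_sequence [f1, f2, f3]" and I_def: "I = ideal_gen {f1, f2, f3}"
    and slp: "strong_Lefschetz I"
  shows "Gin I = ideal_gen (monom_of ` {m. m \<notin> std_exps d1 d2 d3 (deg_exp m)})"
proof (rule Gin_eqI)
  let ?std = "std_exps d1 d2 d3"
  define s where "s = d1 + d2 + d3 - 3"
  have s: "s + 3 = d1 + d2 + d3" "s > 0" "int s = int d1 + int d2 + int d3 - 3" using d by (auto simp: s_def)
  have d': "0 < d1" "d1 \<le> d2" using d by simp_all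
  have I: "graded_ideal I" and h: "\<And>t. 2 * hilbert I t = ci_hilbert2 (int d1) (int d2) (int d3) t"
    using hilbert_complete_intersection[OF f reg] unfolding I_def by auto
  have sym: "hilbert I (int s - u) = hilbert I u" for u
    using h[of u] h[of "int s - u"] by (simp add: s(3) ci_hilbert2_symmetric)
  have "2 * hilbert I 0 = 2" unfolding h using d by (simp add: ci_hilbert2_def ring_hilbert2_def)
  then have h0: "hilbert I 0 \<noteq> 0" by simp
  obtain l where l: "l \<in> forms 1" "l \<noteq> 0"
    and lef: "\<And>u g. 2 * u \<le> s \<Longrightarrow> g \<in> forms (s - u) \<Longrightarrow> \<exists>g'\<in>forms u. g - l ^ (s - 2 * u) * g' \<in> I"
    using strong_Lefschetz_symmetric[OF I I_def slp sym h0 s(2)] by metis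
  obtain A0 where A0: "invertible A0"
    "\<And>t g. g \<in> forms t \<Longrightarrow> \<exists>w\<in>supported (?std t). g - w \<in> lin_subst A0 ` I"
    using exists_std_spanning[OF d' d(3,4) s(1) I h l lef] by metis
  have le: "int (card (?std t)) \<le> hilbert I (int t)" for t
    using card_std_exps_le[OF d' d(3,4), of t] h[of "int t"] by simp
  have comp: "(\<forall>g\<in>forms t. \<exists>w\<in>supported (?std t). g - w \<in> lin_subst A ` I) \<and> int (card (?std t)) \<le> hilbert I (int t) \<longleftrightarrow>
      lin_subst A ` I \<inter> supported (?std t) = {0} \<and> int (card (?std t)) = hilbert I (int t)"
    if "invertible A" for A t
    using dim_complement[OF graded_ideal_lin_subst[OF that I] std_exps_forms finite_std_exps, of t d1 d2 d3]
    unfolding hilbert_lin_subst[OF that I] .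
  have disj0: "lin_subst A0 ` I \<inter> supported (?std t) = {0}" and card: "int (card (?std t)) = hilbert I (int t)" for t
    using comp[OF A0(1), of t] A0(2) le by blast+
  have disj_iff: "lin_subst A ` I \<inter> supported (?std t) = {0} \<longleftrightarrow>
      (\<forall>f\<in>I \<inter> forms t. lin_subst A f \<in> supported (?std t) \<longrightarrow> f = 0)" if A: "invertible A" for A t
  proof -
    obtain B where B: "\<And>f. lin_subst B (lin_subst A f) = f" using lin_subst_inverse[OF A] by metis
    have z: "lin_subst A f = 0 \<longleftrightarrow> f = 0" for f
      using B[of f] by (metis ring_hom_0[OF ring_hom_lin_subst])
    have ft: "f \<in> forms t" if f: "lin_subst A f \<in> supported (?std t)" for f
    proof -
      have "lin_subst A f \<in> forms t" using f std_exps_forms by blast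
      from lin_subst_forms[OF this, of B] show ?thesis unfolding B .
    qed
    have "0 \<in> lin_subst A ` I \<inter> supported (?std t)"
      using graded_ideal_0[OF graded_ideal_lin_subst[OF A I]] pol.subspace_0[OF subspace_supported] by blast
    then have "lin_subst A ` I \<inter> supported (?std t) = {0} \<longleftrightarrow>
        (\<forall>f\<in>I. lin_subst A f \<in> supported (?std t) \<longrightarrow> lin_subst A f = 0)" by blast
    also have "\<dots> \<longleftrightarrow> (\<forall>f\<in>I \<inter> forms t. lin_subst A f \<in> supported (?std t) \<longrightarrow> f = 0)"
      unfolding z using ft by blast
    finally show ?thesis .
  qed
  have "\<exists>P. eval_matrix A0 P \<noteq> 0 \<and> (\<forall>A f. eval_matrix A P \<noteq> 0 \<longrightarrow> f \<in> I \<inter> forms t \<longrightarrow>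
      lin_subst A f \<in> supported (?std t) \<longrightarrow> f = 0)" for t
  proof -
    have "f = 0" if "f \<in> I \<inter> forms t" "lin_subst A0 f \<in> supported (?std t)" for f
      using disj0[of t] that unfolding disj_iff[OF A0(1)] by blast
    from disjoint_supported_open[OF I this] show ?thesis by metis
  qed
  then obtain P where P0: "\<And>t. eval_matrix A0 (P t) \<noteq> 0" and P: "\<And>t A f. eval_matrix A (P t) \<noteq> 0 \<Longrightarrow>
      f \<in> I \<inter> forms t \<Longrightarrow> lin_subst A f \<in> supported (?std t) \<Longrightarrow> f = 0"
    by metis
  define Q where "Q = (\<Prod>t\<le>s. P t)"
  have Q: "eval_matrix A Q = (\<Prod>t\<le>s. eval_matrix A (P t))" for A
    unfolding Q_def by (rule ring_hom_prod[OF ring_hom_eval_matrix])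
  define U where "U = {A. invertible A \<and> eval_matrix A Q \<noteq> 0}"
  have "initial_ideal (lin_subst A ` I) = ideal_gen (monom_of ` {m. m \<notin> ?std (deg_exp m)})" if "A \<in> U" for A
  proof -
    have A: "invertible A" "\<And>t. t \<le> s \<Longrightarrow> eval_matrix A (P t) \<noteq> 0" using that by (auto simp: U_def Q)
    have disj: "lin_subst A ` I \<inter> supported (?std t) = {0}" for t
    proof (cases "t \<le> s")
      case True
      then show ?thesis unfolding disj_iff[OF A(1)] using P[OF A(2)] by blast
    next
      case False
      then have "?std t = {}" using s(1) by (intro std_exps_beyond) simp
      then have "supported (?std t) = {0 :: 'k pol3}" by (auto simp: supported_def)
      then show ?thesis using graded_ideal_0[OF graded_ideal_lin_subst[OF A(1) I]] by simp
    qed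
    have "\<exists>w\<in>supported (?std t). g - w \<in> lin_subst A ` I" if "g \<in> forms t" for t g
      using comp[OF A(1), of t] disj[of t] card[of t] that by blast
    then show ?thesis by (rule initial_ideal_eq[OF graded_ideal_lin_subst[OF A(1) I] _ disj])
  qed
  moreover have "zariski_open_GL3 U"
    unfolding zariski_open_GL3_def U_def eval_matrix_def by (rule exI[of _ "{Q}"]) simp
  moreover have "A0 \<in> U" using A0(1) P0 by (simp add: U_def Q)
  ultimately show "is_Gin I (ideal_gen (monom_of ` {m. m \<notin> ?std (deg_exp m)}))"
    unfolding is_Gin_def by blast
qed

section \<open>Generators of the monomial ideal\<close>

lemma ideal_gen_subset:
  assumes "\<And>f. f \<in> A \<Longrightarrow> f \<in> ideal_gen B" shows "ideal_gen A \<subseteq> ideal_gen B"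
proof -
  interpret module "(*) :: 'a \<Rightarrow> 'a \<Rightarrow> 'a" by (rule module_times)
  show ?thesis using assms unfolding ideal_gen_def by (intro span_minimal subspace_span) blast
qed

lemma ideal_gen_base: "f \<in> B \<Longrightarrow> f \<in> ideal_gen B"
  unfolding ideal_gen_def by (rule module.span_base[OF module_times])

lemma ideal_gen_multiple:
  assumes "monom_of (expo a' b' c') \<in> B" "a' \<le> a" "b' \<le> b" "c' \<le> c"
  shows "(monom_of (expo a b c) :: 'k::comm_ring_1 pol3) \<in> ideal_gen B"
proof -
  have "expo a b c = expo (a - a') (b - b') (c - c') + expo a' b' c'" using assms by (simp add: expo_add)
  then have "(monom_of (expo a b c) :: 'k pol3) = monom_of (expo (a - a') (b - b') (c - c')) * monom_of (expo a' b' c')"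
    by (simp add: monom_of_mult)
  then show ?thesis using assms(1) unfolding ideal_gen_def
    by (metis module.span_base[OF module_times] module.span_scale[OF module_times])
qed

text \<open>The generators in the theorem.\<close>

definition gin_gens :: "nat \<Rightarrow> nat \<Rightarrow> nat \<Rightarrow> 'k::comm_ring_1 pol3 set" where
  "gin_gens d1 d2 d3 =
      {Var 1 ^ d1}
      \<union> {Var 1 ^ (d1 - j) * Var 2 ^ (d2 - d1 + 2 * j - 1) | j. 1 \<le> j \<and> j \<le> d1 - 1}
      \<union> {Var 2 ^ (d1 + d2 - 1)}
      \<union> {Var 2 ^ (d1 + d2 - 2) * Var 3 ^ (d3 + 2 - (d1 + d2))}
      \<union> (\<Union>j\<in>{1..d1 - 2}.
           (*) (Var 3 ^ (d3 + 2 * j + 2 - (d1 + d2)) * Var 2 ^ (d1 + d2 - 2 * j - 2)) ` monos12 j)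
      \<union> (\<Union>j\<in>{1..d2 - d1}.
           (*) (Var 3 ^ (d3 + d1 + 2 * j - (d2 + 2)) * Var 2 ^ (d2 + 1 - (d1 + j))) ` monos12 (d1 - 1))
      \<union> (\<Union>j\<in>{1..d1}.
           (*) (Var 3 ^ (d3 + d2 + 2 * j - (d1 + 2))) ` monos12 (d1 - j))"

lemma times_monos12: "(*) (Var 3 ^ c * Var 2 ^ b) ` monos12 j
    = {monom_of (expo x (b + y) c) :: 'k::comm_ring_1 pol3 | x y. x + y = j}"
proof -
  have "Var 3 ^ c * Var 2 ^ b * (Var 1 ^ x * Var 2 ^ y) = (monom_of (expo x (b + y) c) :: 'k pol3)" for x y
    by (simp add: monom_of_expo power_add mult_ac)
  then show ?thesis unfolding monos12_def by (auto simp: image_iff) metis+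
qed

lemma gin_gens_eq:
  "gin_gens d1 d2 d3 =
      {monom_of (expo d1 0 0)}
      \<union> {monom_of (expo (d1 - j) (d2 - d1 + 2 * j - 1) 0) | j. 1 \<le> j \<and> j \<le> d1 - 1}
      \<union> {monom_of (expo 0 (d1 + d2 - 1) 0)}
      \<union> {monom_of (expo 0 (d1 + d2 - 2) (d3 + 2 - (d1 + d2)))}
      \<union> (\<Union>j\<in>{1..d1 - 2}. {monom_of (expo x (d1 + d2 - 2 * j - 2 + y) (d3 + 2 * j + 2 - (d1 + d2))) | x y. x + y = j})
      \<union> (\<Union>j\<in>{1..d2 - d1}. {monom_of (expo x (d2 + 1 - (d1 + j) + y) (d3 + d1 + 2 * j - (d2 + 2))) | x y. x + y = d1 - 1})
      \<union> (\<Union>j\<in>{1..d1}. {monom_of (expo x y (d3 + d2 + 2 * j - (d1 + 2))) :: 'k::comm_ring_1 pol3 | x y. x + y = d1 - j})"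
proof -
  have t: "(*) (Var 3 ^ c) ` monos12 j = {monom_of (expo x y c) :: 'k pol3 | x y. x + y = j}" for c j
    using times_monos12[of c 0 j, where 'k = 'k] by simp
  show ?thesis unfolding gin_gens_def times_monos12 t by (simp add: monom_of_expo)
qed

lemma expo_notin_std_exps:
  "d1 \<le> a \<Longrightarrow> expo a b c \<notin> std_exps d1 d2 d3 t"
  "d1 + d2 < a + a + b + 2 \<Longrightarrow> expo a b c \<notin> std_exps d1 d2 d3 t"
  "d1 + d2 + d3 < a + a + b + b + c + 3 \<Longrightarrow> expo a b c \<notin> std_exps d1 d2 d3 t"
  by (auto simp: expo_std_exps)

lemma ideal_gen_gin_gens:
  assumes d: "2 \<le> d1" "d1 < d2" "d2 < d3" "d1 + d2 \<le> d3 + 1"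
  shows "ideal_gen (gin_gens d1 d2 d3)
    = ideal_gen (monom_of ` {m. m \<notin> std_exps d1 d2 d3 (deg_exp m)} :: 'k::field pol3 set)"
proof (rule antisym; rule ideal_gen_subset)
  fix g :: "'k pol3"
  have ex: "\<exists>a b c. g = monom_of (expo a b c) \<and> expo a b c \<notin> std_exps d1 d2 d3 (a + b + c)"
    if "g = monom_of (expo a b c)" "expo a b c \<notin> std_exps d1 d2 d3 (a + b + c)" for a b c
    using that by blast
  assume "g \<in> gin_gens d1 d2 d3"
  then have "\<exists>a b c. g = monom_of (expo a b c) \<and> expo a b c \<notin> std_exps d1 d2 d3 (a + b + c)"
    unfolding gin_gens_eq Un_iff
  proof (elim disjE)
    assume "g \<in> {monom_of (expo (d1 - j) (d2 - d1 + 2 * j - 1) 0) | j. 1 \<le> j \<and> j \<le> d1 - 1}"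
    then obtain j where g: "g = monom_of (expo (d1 - j) (d2 - d1 + 2 * j - 1) 0)" and j: "1 \<le> j" "j \<le> d1 - 1" by blast
    show ?thesis by (rule ex[OF g], rule expo_notin_std_exps(2)) (use d j in linarith)
  next
    assume "g \<in> (\<Union>j\<in>{1..d1 - 2}. {monom_of (expo x (d1 + d2 - 2 * j - 2 + y) (d3 + 2 * j + 2 - (d1 + d2))) | x y. x + y = j})"
    then obtain j x y where g: "g = monom_of (expo x (d1 + d2 - 2 * j - 2 + y) (d3 + 2 * j + 2 - (d1 + d2)))"
      and j: "x + y = j" "1 \<le> j" "j \<le> d1 - 2"
      unfolding UN_iff Bex_def mem_Collect_eq atLeastAtMost_iff by blast
    define p q where "p = d1 + d2 - 2 * j - 2" and "q = d3 + 2 * j + 2 - (d1 + d2)"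
    have "p + 2 * j + 2 = d1 + d2" "q + d1 + d2 = d3 + 2 * j + 2" using d j unfolding p_def q_def by simp_all
    with d j show ?thesis by (intro ex[OF g, folded p_def q_def] expo_notin_std_exps(3)) linarith
  next
    assume "g \<in> (\<Union>j\<in>{1..d2 - d1}. {monom_of (expo x (d2 + 1 - (d1 + j) + y) (d3 + d1 + 2 * j - (d2 + 2))) | x y. x + y = d1 - 1})"
    then obtain j x y where g: "g = monom_of (expo x (d2 + 1 - (d1 + j) + y) (d3 + d1 + 2 * j - (d2 + 2)))"
      and j: "x + y = d1 - 1" "1 \<le> j" "j \<le> d2 - d1"
      unfolding UN_iff Bex_def mem_Collect_eq atLeastAtMost_iff by blast
    define p q where "p = d2 + 1 - (d1 + j)" and "q = d3 + d1 + 2 * j - (d2 + 2)"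
    have "p + d1 + j = d2 + 1" "q + d2 + 2 = d3 + d1 + 2 * j" using d j unfolding p_def q_def by simp_all
    with d j show ?thesis by (intro ex[OF g, folded p_def q_def] expo_notin_std_exps(3)) linarith
  next
    assume "g \<in> (\<Union>j\<in>{1..d1}. {monom_of (expo x y (d3 + d2 + 2 * j - (d1 + 2))) | x y. x + y = d1 - j})"
    then obtain j x y where g: "g = monom_of (expo x y (d3 + d2 + 2 * j - (d1 + 2)))"
      and j: "x + y = d1 - j" "1 \<le> j" "j \<le> d1"
      unfolding UN_iff Bex_def mem_Collect_eq atLeastAtMost_iff by blast
    define p q where "p = d1 - j" and "q = d3 + d2 + 2 * j - (d1 + 2)"
    have "p + j = d1" "q + d1 + 2 = d3 + d2 + 2 * j" using d j unfolding p_def q_def by simp_all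
    with d j show ?thesis by (intro ex[OF g, folded p_def q_def] expo_notin_std_exps(3)) linarith
  next
    assume "g \<in> {monom_of (expo d1 0 0)}"
    then have g: "g = monom_of (expo d1 0 0)" by simp
    show ?thesis by (rule ex[OF g], rule expo_notin_std_exps(1)) simp
  next
    assume "g \<in> {monom_of (expo 0 (d1 + d2 - 1) 0)}"
    then have g: "g = monom_of (expo 0 (d1 + d2 - 1) 0)" by simp
    show ?thesis by (rule ex[OF g], rule expo_notin_std_exps(2)) (use d in linarith)
  next
    assume "g \<in> {monom_of (expo 0 (d1 + d2 - 2) (d3 + 2 - (d1 + d2)))}"
    then have g: "g = monom_of (expo 0 (d1 + d2 - 2) (d3 + 2 - (d1 + d2)))" by simp
    show ?thesis by (rule ex[OF g], rule expo_notin_std_exps(3)) (use d in linarith)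
  qed
  then have "g \<in> monom_of ` {m. m \<notin> std_exps d1 d2 d3 (deg_exp m)}" by auto
  then show "g \<in> ideal_gen (monom_of ` {m. m \<notin> std_exps d1 d2 d3 (deg_exp m)})" by (rule ideal_gen_base)
next
  fix f :: "'k pol3" assume "f \<in> monom_of ` {m. m \<notin> std_exps d1 d2 d3 (deg_exp m)}"
  then obtain m where m: "f = monom_of m" "m \<notin> std_exps d1 d2 d3 (deg_exp m)" by blast
  obtain a b c where abc: "m = expo a b c" using expo_lookup[of m] by metis
  have not: "\<not> (a < d1 \<and> 2 * a + b + 2 \<le> d1 + d2 \<and> 2 * a + 2 * b + c + 3 \<le> d1 + d2 + d3)"
    using m(2) by (simp add: abc expo_std_exps)
  have goal: "f \<in> ideal_gen (gin_gens d1 d2 d3)"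
    if "monom_of (expo a' b' c') \<in> (gin_gens d1 d2 d3 :: 'k pol3 set)" "a' \<le> a" "b' \<le> b" "c' \<le> c" for a' b' c'
    unfolding m(1) abc using that by (rule ideal_gen_multiple)
  show "f \<in> ideal_gen (gin_gens d1 d2 d3)"
  proof (cases "d1 \<le> a")
    case True
    show ?thesis by (rule goal[of d1 0 0]) (use True in \<open>simp_all add: gin_gens_eq\<close>)
  next
    case a: False
    show ?thesis
    proof (cases "2 * a + b + 2 \<le> d1 + d2")
      case False
      show ?thesis
      proof (cases "a = 0")
        case True
        show ?thesis by (rule goal[of 0 "d1 + d2 - 1" 0]) (use True False in \<open>simp_all add: gin_gens_eq\<close>)
      next
        case a0: False
        show ?thesis
        proof (rule goal[of "d1 - (d1 - a)" "d2 - d1 + 2 * (d1 - a) - 1" 0])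
          show "monom_of (expo (d1 - (d1 - a)) (d2 - d1 + 2 * (d1 - a) - 1) 0) \<in> (gin_gens d1 d2 d3 :: 'k pol3 set)"
            unfolding gin_gens_eq
            by (rule UnI1, rule UnI1, rule UnI1, rule UnI1, rule UnI1, rule UnI2, rule CollectI,
                rule exI[of _ "d1 - a"]) (use a a0 in auto)
        qed (use a False d in linarith)+
      qed
    next
      case b: True
      \<comment> \<open>The exponents \<open>a\<close>, \<open>b\<close> are kept; the generator has the least possible power of \<open>x\<^sub>3\<close>, and the
        family it belongs to depends on \<open>a + b\<close>.\<close>
      define t where "t = a + b"
      have c: "d1 + d2 + d3 \<le> 2 * t + c + 2" using not a b by (simp add: t_def)
      have t: "a + t + 2 \<le> d1 + d2" using b by (simp add: t_def)
      have "t + 2 = d1 + d2 \<or> t + 2 < d1 + d2 \<and> d2 \<le> t \<or> d1 \<le> t \<and> t < d2 \<or> t < d1" using t by linarith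
      then consider "t + 2 = d1 + d2" | "t + 2 < d1 + d2" "d2 \<le> t" | "d1 \<le> t" "t < d2" | "t < d1" by blast
      then show ?thesis
      proof cases
        case 1
        show ?thesis
        proof (rule goal[of 0 "d1 + d2 - 2" "d3 + 2 - (d1 + d2)"])
          show "monom_of (expo 0 (d1 + d2 - 2) (d3 + 2 - (d1 + d2))) \<in> (gin_gens d1 d2 d3 :: 'k pol3 set)"
            by (simp add: gin_gens_eq)
        qed (use 1 t c t_def in linarith)+
      next
        case 2
        define j where "j = d1 + d2 - 2 - t"
        have j: "j \<in> {1..d1 - 2}" "a \<le> j" "j + t + 2 = d1 + d2" "j \<le> t" using 2 t d by (auto simp: j_def)
        have "d1 + d2 - 2 * j - 2 = t - j" using j(3) by simp
        then have e2: "d1 + d2 - 2 * j - 2 + (j - a) \<le> b" using j(2,4) t_def by linarith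
        have e3: "d3 + 2 * j + 2 - (d1 + d2) \<le> c" using c j(3) by linarith
        show ?thesis
        proof (rule goal)
          show "monom_of (expo a (d1 + d2 - 2 * j - 2 + (j - a)) (d3 + 2 * j + 2 - (d1 + d2))) \<in> (gin_gens d1 d2 d3 :: 'k pol3 set)"
            unfolding gin_gens_eq
            by (rule UnI1, rule UnI1, rule UnI2, rule UN_I[OF j(1)], rule CollectI,
                rule exI[of _ a], rule exI[of _ "j - a"]) (use j(2) in simp)
        qed (use e2 e3 in simp_all)
      next
        case 3
        define j where "j = d2 - t"
        have j: "j \<in> {1..d2 - d1}" "j + t = d2" using 3 by (auto simp: j_def)
        have "d2 + 1 - (d1 + j) = t + 1 - d1" using j(2) by simp
        then have e2: "d2 + 1 - (d1 + j) + (d1 - 1 - a) \<le> b" using a 3(1) t_def by linarith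
        have e3: "d3 + d1 + 2 * j - (d2 + 2) \<le> c" using c j(2) by linarith
        show ?thesis
        proof (rule goal)
          show "monom_of (expo a (d2 + 1 - (d1 + j) + (d1 - 1 - a)) (d3 + d1 + 2 * j - (d2 + 2))) \<in> (gin_gens d1 d2 d3 :: 'k pol3 set)"
            unfolding gin_gens_eq
            by (rule UnI1, rule UnI2, rule UN_I[OF j(1)], rule CollectI,
                rule exI[of _ a], rule exI[of _ "d1 - 1 - a"]) (use a in simp)
        qed (use e2 e3 in simp_all)
      next
        case 4
        define j where "j = d1 - t"
        have j: "j \<in> {1..d1}" "j + t = d1" using 4 by (auto simp: j_def)
        have e3: "d3 + d2 + 2 * j - (d1 + 2) \<le> c" using c j(2) by linarith
        show ?thesis
        proof (rule goal)
          show "monom_of (expo a b (d3 + d2 + 2 * j - (d1 + 2))) \<in> (gin_gens d1 d2 d3 :: 'k pol3 set)"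
            unfolding gin_gens_eq
            by (rule UnI2, rule UN_I[OF j(1)], rule CollectI,
                rule exI[of _ a], rule exI[of _ b]) (use j t_def in simp)
        qed (use e3 in simp_all)
      qed
    qed
  qed
qed

theorem proposition2p2p8:
  fixes f1 f2 f3 :: "'k::field_char_0 pol3" and I J :: "'k pol3 set"
    and x1 x2 x3 :: "'k pol3" and d1 d2 d3 :: nat
  assumes "2 \<le> d1" and "d1 < d2" and "d2 < d3" and "d1 + d2 \<le> d3 + 1"
    and "f1 \<in> forms d1" and "f2 \<in> forms d2" and "f3 \<in> forms d3"
    and "regular_sequence [f1, f2, f3]"
    and "I = ideal_gen {f1, f2, f3}"
    and "J = Gin I"
    and "strong_Lefschetz I"
    and "x1 = Var 1" and "x2 = Var 2" and "x3 = Var 3"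
  shows "J = ideal_gen (
      {x1 ^ d1}
      \<union> {x1 ^ (d1 - j) * x2 ^ (d2 - d1 + 2 * j - 1) | j. 1 \<le> j \<and> j \<le> d1 - 1}
      \<union> {x2 ^ (d1 + d2 - 1)}
      \<union> {x2 ^ (d1 + d2 - 2) * x3 ^ (d3 + 2 - (d1 + d2))}
      \<union> (\<Union>j\<in>{1..d1 - 2}.
           (*) (x3 ^ (d3 + 2 * j + 2 - (d1 + d2)) * x2 ^ (d1 + d2 - 2 * j - 2)) ` monos12 j)
      \<union> (\<Union>j\<in>{1..d2 - d1}.
           (*) (x3 ^ (d3 + d1 + 2 * j - (d2 + 2)) * x2 ^ (d2 + 1 - (d1 + j))) ` monos12 (d1 - 1))
      \<union> (\<Union>j\<in>{1..d1}.
           (*) (x3 ^ (d3 + d2 + 2 * j - (d1 + 2))) ` monos12 (d1 - j)))"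
  using Gin_complete_intersection[OF assms(1-9) assms(11)] ideal_gen_gin_gens[OF assms(1-4), where 'k = 'k]
  unfolding assms(10,12-14) gin_gens_def by simp

end
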